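(* Let $\sigma$ and $\omega$ be positive locally finite Borel measures on $\mathbb{R}^{n}$, let $1<p<\infty$, $\frac1p+\frac1{p'}=1$, and let $T_{\flat}$ and $T_{\natural}$ be the maximal and strongly maximal singular integral operators associated with a kernel $K(x,y)$ satisfying the size and smoothness conditions given in the context. (1) Suppose that the maximal operator satisfies $\|\mathcal{M}(f\sigma)\|_{L^{p,\infty}(\omega)}\leq C\|f\|_{L^p(\sigma)}$ for all $f\in L^p(\sigma)$. Then $$\|T_{\natural}(f\sigma)\|_{L^{p,\infty}(\omega)}\leq C\|f\|_{L^{p}(\sigma)},\qquad f\in L^{p}(\sigma),\qquad(\mathrm{W})$$ holds if and only if $$\int_{Q}T_{\natural}(\chi_{Q}f\sigma)(x)\,d\omega(x)\leq C_{2}\left(\int_{Q}|f(x)|^{p}d\sigma(x)\right)^{\frac1p}\left(\int_{Q}d\omega(x)\right)^{\frac1{p'}}$$ for all cubes $Q\subset\mathbb{R}^{n}$ and all $f\in L^{p}(\sigma)$, for some constant $C_2$. (2) The same characterization as in (1) holds with $T_{\flat}$ in place of $T_{\natural}$ everywhere. (3) Suppose that $\sigma$ and $\omega$ are absolutely continuous with respect to Lebesgue measure, that $\|\mathcal{M}(f\sigma)\|_{L^{p,\infty}(\omega)}\leq C\|f\|_{L^p(\sigma)}$ for all $f\in L^p(\sigma)$, and that $T$ is a standard singular integral operator with kernel $K$. If (W) holds for $T_{\natural}$, or (W) holds with $T_{\flat}$ in place of $T_\natural$, then $$\|T(f\sigma)\|_{L^{p,\infty}(\omega)}\leq C\|f\|_{L^{p}(\sigma)}$$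 for all $f\in L^{p}(\sigma)$ such that $f\sigma\in L^{\infty}$ and $f\sigma$ has compact support. (4) Suppose $c>0$ and that $\{K_{j}\}_{j=1}^{J}$ is a collection of standard kernels such that for each unit vector $\mathbf{u}$ there is $j$ satisfying $$|K_{j}(x,x+t\mathbf{u})|\geq c|t|^{-n},\qquad t\in\mathbb{R}\setminus\{0\},\ x\in\mathbb{R}^n .$$ Suppose also that $\sigma$ and $\omega$ have no common point masses, i.e. $\sigma(\{x\})\,\omega(\{x\})=0$ for all $x\in\mathbb{R}^{n}$. Then $$\|(T_{j})_{\flat}(f\sigma)\|_{L^{p,\infty}(\omega)}\leq C\|f\|_{L^{p}(\sigma)},\qquad f\in L^{p}(\sigma),\ 1\leq j\leq J,$$ if and only if the two weight $A_p$ condition $$\left[\frac1{|Q|}\int_Q d\omega\right]^{\frac1p}\left[\frac1{|Q|}\int_Q d\sigma\right]^{\frac1{p'}}\leq C_2\qquad\text{for all cubes }Q\subset\mathbb{R}^n$$ holds and $$\int_{Q}(T_{j})_{\flat}(\chi_{Q}f\sigma)(x)\,d\omega(x)\leq C_{2}\left(\int_{Q}|f(x)|^{p}d\sigma(x)\right)^{\frac1p}\left(\int_{Q}d\omega(x)\right)^{\frac1{p'}}$$ for all $f\in L^{p}(\sigma)$, all cubes $Q\subset\mathbb{R}^{n}$ and all $1\leq j\leq J$ (for some constants).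
   Context: Cubes have sides parallel to the coordinate axes. $f\sigma$ denotes the measure $f\,d\sigma$; when $\sigma$ is absolutely continuous it is also identified with the function $f\frac{d\sigma}{dx}$. $\|h\|_{L^{p,\infty}(\omega)}=\sup_{\lambda>0}\lambda\,\omega(\{|h|>\lambda\})^{1/p}$. The maximal operator is $\mathcal{M}\nu(x)=\sup_{Q\ni x}\frac{1}{|Q|}\int_Q d|\nu|$, supremum over all cubes containing $x$. Size and smoothness conditions on a kernel $K$ on $\mathbb{R}^n\times\mathbb{R}^n$: there are $C$ and a Dini modulus $\delta$ (a nondecreasing function on $[0,1]$ with $\delta(0)=0$, $\int_0^1\delta(s)\frac{ds}{s}<\infty$) with $$|K(x,y)|\leq C|x-y|^{-n},\qquad |K(x,y)-K(x',y)|\leq C\,\delta\!\left(\tfrac{|x-x'|}{|x-y|}\right)|x-y|^{-n}\ \text{ if }\ \tfrac{|x-x'|}{|x-y|}\leq\tfrac12 .$$ A kernel is standard if it satisfies these and the Hörmander condition $\int_{B(y,2\varepsilon)^c}|K(x,y)-K(x,y')|dx\leq C$ for $y'\in B(y,\varepsilon)$, $\varepsilon>0$. $T$ is a standard singular integral operator with kernel $K$ if $K$ is standard, $T$ is bounded and linear on $L^q(\mathbb{R}^n)$ for some fixed $1<q<\infty$, and $Tf(x)=\int K(x,y)f(y)dy$ for a.e. $x\notin\operatorname{supp}f$ whenever $f\in L^q$ has compact support. Truncations. Fix smooth $\zeta,\eta$ on $\mathbb{R}$: $\zeta$ nondecreasing, $\zeta(t)=0$ for $t\leq\frac12$, $\zeta(t)=1$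 for $t\geq1$; $\eta$ nonincreasing, $\eta(t)=1$ for $t\leq1$, $\eta(t)=0$ for $t\geq2$. Put $\zeta_\varepsilon(t)=\zeta(t/\varepsilon)$, $\eta_R(t)=\eta(t/R)$. For a locally finite (signed/complex) measure $\nu$: $$T_{\flat}\nu(x)=\sup_{0<\varepsilon<R<\infty}\left|\int K(x,y)\zeta_\varepsilon(|x-y|)\eta_R(|x-y|)d\nu(y)\right|,$$ $$T_{\natural}\nu(x)=\sup_{\boldsymbol\varepsilon,R}\left|\int K(x,y)\zeta_{\boldsymbol\varepsilon}(x-y)\eta_R(|x-y|)d\nu(y)\right|,$$ $$\zeta_{\boldsymbol\varepsilon}(x-y)=1-\prod_{k=1}^n\left[1-\{\zeta_{\varepsilon_{2k-1}}(x_k-y_k)+\zeta_{\varepsilon_{2k}}(y_k-x_k)\}\right],$$ the last supremum being over $R\in(0,\infty)$ and $\boldsymbol\varepsilon=(\varepsilon_1,\dots,\varepsilon_{2n})\in(0,R)^{2n}$ with $\frac14\leq\frac{\varepsilon_i}{\varepsilon_j}\leq4$ for all $i,j$. $(T_j)_\flat$ is the operator $T_\flat$ with kernel $K_j$. *)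

theory Defs
  imports "HOL-Analysis.Analysis"
begin

definition locally_finite_borel :: "(real ^ 'n) measure \<Rightarrow> bool" where
  "locally_finite_borel \<mu> \<longleftrightarrow>
     sets \<mu> = sets borel \<and> (\<forall>A. compact A \<longrightarrow> emeasure \<mu> A < \<infinity>)"

text \<open>Cubes are closed. For locally finite measures, open or half-open cubes lead to equivalent
  conditions below, by regularity.\<close>

definition cubes :: "(real ^ 'n) set set" where
  "cubes = {cbox a (\<chi> i. a $ i + l) | a l. 0 < l}"

definition Lp_fun :: "real \<Rightarrow> (real ^ 'n) measure \<Rightarrow> (real ^ 'n \<Rightarrow> complex) set" where
  "Lp_fun p \<mu> = {f. f \<in> borel_measurable \<mu> \<and> integrable \<mu> (\<lambda>x. norm (f x) powr p)}"

definition Lp_norm :: "real \<Rightarrow> (real ^ 'n) measure \<Rightarrow> (real ^ 'n \<Rightarrow> complex) \<Rightarrow> real" where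
  "Lp_norm p \<mu> f = (\<integral>x. norm (f x) powr p \<partial>\<mu>) powr (1 / p)"

text \<open>Real powers on \<open>[0, \<infinity>]\<close>, meant for positive exponents only.\<close>

definition ennreal_powr :: "ennreal \<Rightarrow> real \<Rightarrow> ennreal" where
  "ennreal_powr t a = (if t = \<infinity> then \<infinity> else ennreal (enn2real t powr a))"

definition weak_Lp_norm :: "real \<Rightarrow> (real ^ 'n) measure \<Rightarrow> (real ^ 'n \<Rightarrow> ennreal) \<Rightarrow> ennreal" where
  "weak_Lp_norm p \<omega> h =
     (SUP t\<in>{0<..}. ennreal t * ennreal_powr (emeasure \<omega> {x. ennreal t < h x}) (1 / p))"

text \<open>Essential support: the complement of the largest open set on which \<open>f\<close> vanishes
  Lebesgue almost everywhere.\<close>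

definition ess_support :: "(real ^ 'n \<Rightarrow> complex) \<Rightarrow> (real ^ 'n) set" where
  "ess_support f = - \<Union>{U. open U \<and> (AE x in lborel. x \<in> U \<longrightarrow> f x = 0)}"

text \<open>The function \<open>f d\<sigma>/dx\<close> with which \<open>f\<sigma>\<close> is identified if \<open>\<sigma>\<close> is absolutely continuous.\<close>

definition density_fun ::
  "(real ^ 'n) measure \<Rightarrow> (real ^ 'n \<Rightarrow> complex) \<Rightarrow> real ^ 'n \<Rightarrow> complex" where
  "density_fun \<sigma> f x = f x * of_real (enn2real (RN_deriv lborel \<sigma> x))"

definition ess_bounded :: "(real ^ 'n \<Rightarrow> complex) \<Rightarrow> bool" where
  "ess_bounded f \<longleftrightarrow> f \<in> borel_measurable lborel \<and> (\<exists>B. AE x in lborel. norm (f x) \<le> B)"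

definition dini_modulus :: "(real \<Rightarrow> real) \<Rightarrow> bool" where
  "dini_modulus \<delta> \<longleftrightarrow>
     mono_on {0..1} \<delta> \<and> \<delta> 0 = 0 \<and> set_integrable lborel {0<..1} (\<lambda>s. \<delta> s / s)"

text \<open>The values of a kernel on the diagonal are irrelevant, and nothing is required of them.
  Measurability in the second variable is what gives a meaning to the integrals of
  \<open>K x\<close> against a Borel measure; in the first variable the smoothness condition provides it.\<close>

definition size_smooth_kernel :: "(real ^ 'n \<Rightarrow> real ^ 'n \<Rightarrow> complex) \<Rightarrow> bool" where
  "size_smooth_kernel K \<longleftrightarrow>
     (\<forall>x. K x \<in> borel_measurable borel) \<and>
     (\<exists>C \<delta>. dini_modulus \<delta> \<and>
        (\<forall>x y. x \<noteq> y \<longrightarrow> norm (K x y) \<le> C / norm (x - y) ^ CARD('n)) \<and>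
        (\<forall>x x' y. x \<noteq> y \<longrightarrow> norm (x - x') / norm (x - y) \<le> 1 / 2 \<longrightarrow>
           norm (K x y - K x' y)
             \<le> C * \<delta> (norm (x - x') / norm (x - y)) / norm (x - y) ^ CARD('n)))"

definition hoermander_kernel :: "(real ^ 'n \<Rightarrow> real ^ 'n \<Rightarrow> complex) \<Rightarrow> bool" where
  "hoermander_kernel K \<longleftrightarrow>
     (\<exists>C::real. \<forall>y \<epsilon>. 0 < \<epsilon> \<longrightarrow> (\<forall>y'\<in>ball y \<epsilon>.
        (\<integral>\<^sup>+ x \<in> - ball y (2 * \<epsilon>). ennreal (norm (K x y - K x y')) \<partial>lborel) \<le> ennreal C))"

definition standard_kernel :: "(real ^ 'n \<Rightarrow> real ^ 'n \<Rightarrow> complex) \<Rightarrow> bool" where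
  "standard_kernel K \<longleftrightarrow> size_smooth_kernel K \<and> hoermander_kernel K"

text \<open>\<open>T\<close> acts on representatives; linearity and boundedness make it well defined on classes
  modulo equality almost everywhere.\<close>

definition bounded_linear_on_Lp ::
  "real \<Rightarrow> ((real ^ 'n \<Rightarrow> complex) \<Rightarrow> real ^ 'n \<Rightarrow> complex) \<Rightarrow> bool" where
  "bounded_linear_on_Lp q T \<longleftrightarrow>
     (\<forall>f\<in>Lp_fun q lborel. T f \<in> Lp_fun q lborel) \<and>
     (\<forall>f\<in>Lp_fun q lborel. \<forall>g\<in>Lp_fun q lborel. \<forall>a b.
        AE x in lborel. T (\<lambda>z. a * f z + b * g z) x = a * T f x + b * T g x) \<and>
     (\<exists>B. \<forall>f\<in>Lp_fun q lborel. Lp_norm q lborel (T f) \<le> B * Lp_norm q lborel f)"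

definition standard_sio ::
  "(real ^ 'n \<Rightarrow> real ^ 'n \<Rightarrow> complex) \<Rightarrow>
   ((real ^ 'n \<Rightarrow> complex) \<Rightarrow> real ^ 'n \<Rightarrow> complex) \<Rightarrow> bool" where
  "standard_sio K T \<longleftrightarrow>
     standard_kernel K \<and>
     (\<exists>q>1. bounded_linear_on_Lp q T \<and>
        (\<forall>f\<in>Lp_fun q lborel. compact (ess_support f) \<longrightarrow>
           (AE x in lborel. x \<notin> ess_support f \<longrightarrow> T f x = (\<integral>y. K x y * f y \<partial>lborel))))"

definition smooth_real :: "(real \<Rightarrow> real) \<Rightarrow> bool" where
  "smooth_real g \<longleftrightarrow> (\<forall>k t. (deriv ^^ k) g differentiable (at t))"

definition truncation_pair :: "(real \<Rightarrow> real) \<Rightarrow> (real \<Rightarrow> real) \<Rightarrow> bool" where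
  "truncation_pair \<zeta> \<eta> \<longleftrightarrow>
     smooth_real \<zeta> \<and> mono \<zeta> \<and> (\<forall>t\<le>1/2. \<zeta> t = 0) \<and> (\<forall>t\<ge>1. \<zeta> t = 1) \<and>
     smooth_real \<eta> \<and> antimono \<eta> \<and> (\<forall>t\<le>1. \<eta> t = 1) \<and> (\<forall>t\<ge>2. \<eta> t = 0)"

text \<open>The operators below are evaluated at the complex measure \<open>\<nu> = f\<sigma>\<close>, so that
  \<open>\<integral> g d\<nu> = \<integral> g f d\<sigma>\<close> and \<open>|\<nu>|\<close> is \<open>|f|\<sigma>\<close>.\<close>

definition maximal_op ::
  "(real ^ 'n) measure \<Rightarrow> (real ^ 'n \<Rightarrow> complex) \<Rightarrow> real ^ 'n \<Rightarrow> ennreal" where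
  "maximal_op \<sigma> f x =
     (SUP Q\<in>{Q \<in> cubes. x \<in> Q}.
        emeasure (density \<sigma> (\<lambda>y. ennreal (norm (f y)))) Q / emeasure lborel Q)"

definition T_flat ::
  "(real \<Rightarrow> real) \<Rightarrow> (real \<Rightarrow> real) \<Rightarrow> (real ^ 'n \<Rightarrow> real ^ 'n \<Rightarrow> complex) \<Rightarrow>
   (real ^ 'n) measure \<Rightarrow> (real ^ 'n \<Rightarrow> complex) \<Rightarrow> real ^ 'n \<Rightarrow> ennreal" where
  "T_flat \<zeta> \<eta> K \<sigma> f x =
     (SUP (\<epsilon>, R)\<in>{(\<epsilon>, R). 0 < \<epsilon> \<and> \<epsilon> < R}.
        ennreal (norm (\<integral>y. K x y * of_real (\<zeta> (norm (x - y) / \<epsilon>) * \<eta> (norm (x - y) / R)) * f y \<partial>\<sigma>)))"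

text \<open>The index set \<open>{1, \<dots>, 2n}\<close> is rendered as \<open>'n + 'n\<close>: \<open>Inl k\<close> stands for \<open>2k - 1\<close>
  and \<open>Inr k\<close> for \<open>2k\<close>.\<close>

definition zeta_strong ::
  "(real \<Rightarrow> real) \<Rightarrow> ('n::finite + 'n \<Rightarrow> real) \<Rightarrow> real ^ 'n \<Rightarrow> real" where
  "zeta_strong \<zeta> \<epsilon> z =
     1 - (\<Prod>k\<in>UNIV. 1 - (\<zeta> (z $ k / \<epsilon> (Inl k)) + \<zeta> (- z $ k / \<epsilon> (Inr k))))"

definition T_strong ::
  "(real \<Rightarrow> real) \<Rightarrow> (real \<Rightarrow> real) \<Rightarrow> (real ^ 'n \<Rightarrow> real ^ 'n \<Rightarrow> complex) \<Rightarrow>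
   (real ^ 'n) measure \<Rightarrow> (real ^ 'n \<Rightarrow> complex) \<Rightarrow> real ^ 'n \<Rightarrow> ennreal" where
  "T_strong \<zeta> \<eta> K \<sigma> f x =
     (SUP (\<epsilon>, R)\<in>{(\<epsilon>, R). (\<forall>i. 0 < \<epsilon> i \<and> \<epsilon> i < R) \<and>
                          (\<forall>i j. 1/4 \<le> \<epsilon> i / \<epsilon> j \<and> \<epsilon> i / \<epsilon> j \<le> 4)}.
        ennreal (norm (\<integral>y. K x y * of_real (zeta_strong \<zeta> \<epsilon> (x - y) * \<eta> (norm (x - y) / R)) * f y \<partial>\<sigma>)))"

text \<open>In the next two definitions \<open>S f\<close> is the value of a maximal operator at \<open>f\<sigma>\<close>.\<close>

definition weak_type ::
  "real \<Rightarrow> (real ^ 'n) measure \<Rightarrow> (real ^ 'n) measure \<Rightarrow>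
   ((real ^ 'n \<Rightarrow> complex) \<Rightarrow> real ^ 'n \<Rightarrow> ennreal) \<Rightarrow> real \<Rightarrow> bool" where
  "weak_type p \<sigma> \<omega> S C \<longleftrightarrow>
     (\<forall>f\<in>Lp_fun p \<sigma>. weak_Lp_norm p \<omega> (S f) \<le> ennreal (C * Lp_norm p \<sigma> f))"

definition testing_condition ::
  "real \<Rightarrow> real \<Rightarrow> (real ^ 'n) measure \<Rightarrow> (real ^ 'n) measure \<Rightarrow>
   ((real ^ 'n \<Rightarrow> complex) \<Rightarrow> real ^ 'n \<Rightarrow> ennreal) \<Rightarrow> real \<Rightarrow> bool" where
  "testing_condition p p' \<sigma> \<omega> S C \<longleftrightarrow>
     (\<forall>Q\<in>cubes. \<forall>f\<in>Lp_fun p \<sigma>.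
        (\<integral>\<^sup>+ x \<in> Q. S (\<lambda>y. indicator Q y * f y) x \<partial>\<omega>)
          \<le> ennreal (C * (LINT x:Q|\<sigma>. norm (f x) powr p) powr (1 / p)
                       * measure \<omega> Q powr (1 / p')))"

definition two_weight_Ap ::
  "real \<Rightarrow> real \<Rightarrow> (real ^ 'n) measure \<Rightarrow> (real ^ 'n) measure \<Rightarrow> real \<Rightarrow> bool" where
  "two_weight_Ap p p' \<sigma> \<omega> C \<longleftrightarrow>
     (\<forall>Q\<in>cubes. (measure \<omega> Q / measure lborel Q) powr (1 / p)
                 * (measure \<sigma> Q / measure lborel Q) powr (1 / p') \<le> C)"

end

theory Submission
  imports Defs
begin

text \<open>Both maximal operators are suprema of truncated integrals over a family of cutoffs, and only three
  properties of the family matter: the cutoffs live away from the origin and from infinity; moving the base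
  point by \<open>L\<close> one may pass to a cutoff that does not see distances below a multiple of \<open>L\<close>; and
  cutoffs equal to one on any prescribed annulus exist. The first two, with the Dini condition, give a maximum
  principle: the part of the integral far from a ball, evaluated in the ball, is at most its value at a nearby
  point where the operator is small, plus the maximal function.

  Testing gives the weak type inequality by a good lambda argument. Cover the open set where the operator exceeds
  \<open>\<alpha>\<close> by balls of Vitali type with radii comparable to the distance to the complement; outside the
  exceptional set of the maximal function the far part is at most \<open>2\<alpha>\<close>, so where the operator exceeds
  \<open>3\<alpha>\<close> the local part exceeds \<open>\<alpha>\<close>, and testing bounds the measure of that set. Bounded
  overlap and Young's inequality absorb the rest.

  For a singular integral, the same comparison shows that at points where the operator is large but its maximal
  truncation and the maximal function are small, the local part is large, which by boundedness on \<open>L\<^sup>q\<close>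
  happens only on a set of small density. For the necessity of the two weight condition, the lower bounds on the
  kernels bound the product of the measures of separated sets; a Whitney type decomposition off the diagonal
  then gives cubes, since common point masses are excluded.\<close>

text \<open>Several obstacles shape the argument. Smooth cutoffs matter: moving the base point by L
  changes such a cutoff at distance |w| by at most a multiple of L / |w|, which is summable over
  dyadic annuli. Absorbing the last term of the good lambda inequality needs a quantity known in
  advance to be finite; hence f is first taken with compact support, where the operator far away is
  dominated by the maximal function, and only levels up to \<alpha> are considered. No doubling is
  available, so the covering cubes must stay inside the superlevel set and overlap boundedly; this
  dictates their size. Finally, the kernel bounds give information on separated sets with \<sigma>
  raised to the power p - 1, and summing over scales uses subadditivity of t^(p - 1), which holds
  only for p \<le> 2. For p > 2 the two measures exchange roles and the exponent becomes 1 / (p -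
  1). The sum over scales converges because the powers n p and n p / (p - 1) of the side length both
  exceed n.\<close>

section \<open>Cutoff families of the two maximal operators\<close>

definition inner_cutoff :: "real \<Rightarrow> real \<Rightarrow> (real ^ 'n \<Rightarrow> real) \<Rightarrow> bool" where
  "inner_cutoff B e \<psi> \<longleftrightarrow> 0 < e \<and> (\<forall>w. 0 \<le> \<psi> w \<and> \<psi> w \<le> 1) \<and>
     (\<forall>w. norm w \<le> e / B \<longrightarrow> \<psi> w = 0) \<and> (\<forall>w. B * e \<le> norm w \<longrightarrow> \<psi> w = 1) \<and>
     (\<forall>w w'. \<bar>\<psi> w - \<psi> w'\<bar> \<le> B * norm (w - w') / e)"

text \<open>The second clause says that a truncation can be replaced, after moving the base point
  by at most \<open>L\<close>, by one that does not see distances below \<open>L / B\<close>.\<close>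

definition truncation_family :: "real \<Rightarrow> (real ^ 'n \<Rightarrow> real) set \<Rightarrow> bool" where
  "truncation_family B \<Phi> \<longleftrightarrow> 1 \<le> B \<and>
     (\<forall>\<phi>\<in>\<Phi>. continuous_on UNIV \<phi> \<and> (\<forall>w. \<bar>\<phi> w\<bar> \<le> 1) \<and>
        (\<exists>r>0. \<exists>R. \<forall>w. norm w \<le> r \<or> R \<le> norm w \<longrightarrow> \<phi> w = 0)) \<and>
     (\<forall>\<phi>\<in>\<Phi>. \<forall>L>0. \<exists>\<phi>'\<in>insert (\<lambda>_. 0) \<Phi>. (\<forall>w. norm w \<le> L / B \<longrightarrow> \<phi>' w = 0) \<and>
        (\<forall>w w'. norm (w - w') \<le> L \<longrightarrow> \<bar>\<phi> w - \<phi>' w'\<bar> * norm w \<le> B * L)) \<and>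
     (\<forall>a>0. \<forall>R. \<exists>\<phi>\<in>\<Phi>. \<forall>w. a \<le> norm w \<and> norm w \<le> R \<longrightarrow> \<phi> w = 1)"

text \<open>The derivative is bounded only on the compact interval. Clamping the argument to that
  interval leaves the value of g unchanged and does not increase distances, so the bound becomes
  global.\<close>

lemma smooth_real_lipschitz:
  assumes "smooth_real g" "a \<le> b" "\<And>t. t \<le> a \<Longrightarrow> g t = g a" "\<And>t. b \<le> t \<Longrightarrow> g t = g b"
  obtains B where "0 < B" "\<And>s t. \<bar>g s - g t\<bar> \<le> B * \<bar>s - t\<bar>"
proof -
  have d: "(g has_real_derivative deriv g t) (at t)" for t
    using assms(1)[unfolded smooth_real_def, rule_format, of 0]
    by (simp add: DERIV_deriv_iff_real_differentiable)
  have "deriv g differentiable (at t)" for t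
    using assms(1)[unfolded smooth_real_def, rule_format, of 1] by simp
  hence "continuous_on {a..b} (deriv g)"
    by (meson continuous_at_imp_continuous_on differentiable_imp_continuous_within)
  hence "bounded (deriv g ` {a..b})"
    by (intro compact_imp_bounded compact_continuous_image) auto
  then obtain M where M: "\<And>t. t \<in> {a..b} \<Longrightarrow> \<bar>deriv g t\<bar> \<le> M"
    unfolding bounded_iff by (metis imageI real_norm_def)
  define c where "c t = max a (min b t)" for t
  have c: "c t \<in> {a..b}" "g (c t) = g t" for t
    using assms(2) assms(3)[of t] assms(4)[of t] by (auto simp: c_def max_def min_def)
  have "\<bar>g s - g t\<bar> \<le> (\<bar>M\<bar> + 1) * \<bar>s - t\<bar>" for s t
  proof -
    have "norm (g (c s) - g (c t)) \<le> M * norm (c s - c t)"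
      by (rule field_differentiable_bound[where S="{a..b}" and f'="deriv g"])
        (use c M d in \<open>auto intro: has_field_derivative_at_within\<close>)
    also have "\<dots> \<le> (\<bar>M\<bar> + 1) * \<bar>s - t\<bar>"
      by (rule mult_mono) (auto simp: c_def max_def min_def)
    finally show ?thesis by (simp add: c)
  qed
  thus ?thesis using that[of "\<bar>M\<bar> + 1"] by auto
qed

lemma truncation_pair_lipschitz:
  assumes "truncation_pair \<zeta> \<eta>"
  obtains B where "2 \<le> B" "\<And>s t. \<bar>\<zeta> s - \<zeta> t\<bar> \<le> B * \<bar>s - t\<bar>" "\<And>s t. \<bar>\<eta> s - \<eta> t\<bar> \<le> B * \<bar>s - t\<bar>"
    "\<And>t. 0 \<le> \<zeta> t \<and> \<zeta> t \<le> 1" "\<And>t. 0 \<le> \<eta> t \<and> \<eta> t \<le> 1"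
proof -
  note T = assms[unfolded truncation_pair_def]
  obtain B1 where B1: "0 < B1" "\<And>s t. \<bar>\<zeta> s - \<zeta> t\<bar> \<le> B1 * \<bar>s - t\<bar>"
    by (rule smooth_real_lipschitz[of \<zeta> "1/2" 1]) (use T in auto)
  obtain B2 where B2: "0 < B2" "\<And>s t. \<bar>\<eta> s - \<eta> t\<bar> \<le> B2 * \<bar>s - t\<bar>"
    by (rule smooth_real_lipschitz[of \<eta> 1 2]) (use T in auto)
  have z: "0 \<le> \<zeta> t \<and> \<zeta> t \<le> 1" for t
    using T monoD[of \<zeta> "min t 0" t] monoD[of \<zeta> t "max t 1"] by auto
  have e: "0 \<le> \<eta> t \<and> \<eta> t \<le> 1" for t
    using T antimonoD[of \<eta> "min t 1" t] antimonoD[of \<eta> t "max t 2"] by auto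
  show ?thesis
  proof (rule that[of "2 + B1 + B2", OF _ _ _ z e])
    \<comment> \<open>A constant of at least 2 makes e / B at most e / 2, where \<zeta> still
      vanishes.\<close>
    show "2 \<le> 2 + B1 + B2" using B1 B2 by auto
    show "\<bar>\<zeta> s - \<zeta> t\<bar> \<le> (2 + B1 + B2) * \<bar>s - t\<bar>" for s t
      by (rule order_trans[OF B1(2)], rule mult_right_mono) (use B1 B2 in auto)
    show "\<bar>\<eta> s - \<eta> t\<bar> \<le> (2 + B1 + B2) * \<bar>s - t\<bar>" for s t
      by (rule order_trans[OF B2(2)], rule mult_right_mono) (use B1 B2 in auto)
  qed
qed

lemma abs_mult_diff_le:
  fixes a b c d :: real
  assumes "0 \<le> a" "a \<le> 1" "0 \<le> d" "d \<le> 1"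
  shows "\<bar>a * b - c * d\<bar> \<le> \<bar>a - c\<bar> + \<bar>b - d\<bar>"
proof -
  have "a * b - c * d = a * (b - d) + (a - c) * d" by (simp add: algebra_simps)
  also have "\<bar>\<dots>\<bar> \<le> \<bar>a\<bar> * \<bar>b - d\<bar> + \<bar>a - c\<bar> * \<bar>d\<bar>"
    using abs_triangle_ineq by (simp add: abs_mult[symmetric])
  also have "\<dots> \<le> 1 * \<bar>b - d\<bar> + \<bar>a - c\<bar> * 1"
    using assms by (intro add_mono mult_mono) auto
  finally show ?thesis by simp
qed

text \<open>A shift by L changes a cutoff only at distances comparable to its transition scale or to
  L itself, and there the change times the norm of w is of order L. In the constant, 8 B^2 pays for
  the inner cutoff and 4 B^2 for the outer one.\<close>

lemma truncation_familyI:
  fixes \<Phi> :: "(real ^ 'n \<Rightarrow> real) set"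
  assumes B: "1 \<le> B"
    and \<eta>: "\<And>s t. \<bar>\<eta> s - \<eta> t\<bar> \<le> B * \<bar>s - t\<bar>" "\<And>t. 0 \<le> \<eta> t \<and> \<eta> t \<le> 1"
      "\<And>t. t \<le> 1 \<Longrightarrow> \<eta> t = 1" "\<And>t. 2 \<le> t \<Longrightarrow> \<eta> t = 0"
    and \<Phi>: "\<And>\<phi>. \<phi> \<in> \<Phi> \<Longrightarrow> \<exists>\<psi> e R. inner_cutoff B e \<psi> \<and> e < R \<and> \<phi> = (\<lambda>w. \<psi> w * \<eta> (norm w / R))"
    and ex: "\<And>e R. 0 < e \<Longrightarrow> e < R \<Longrightarrow> \<exists>\<psi>. inner_cutoff B e \<psi> \<and> (\<lambda>w. \<psi> w * \<eta> (norm w / R)) \<in> \<Phi>"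
  shows "truncation_family (12 * B\<^sup>2) \<Phi>"
  unfolding truncation_family_def
proof (intro conjI ballI allI impI)
  have B1: "B \<le> B\<^sup>2" using B by (simp add: power2_eq_square)
  show "1 \<le> 12 * B\<^sup>2" using B B1 by simp
  fix \<phi> assume "\<phi> \<in> \<Phi>"
  then obtain \<psi> e R where I: "inner_cutoff B e \<psi>" and eR: "e < R"
    and \<phi>: "\<phi> = (\<lambda>w. \<psi> w * \<eta> (norm w / R))" using \<Phi> by blast
  note I' = I[unfolded inner_cutoff_def]
  have e0: "0 < e" using I' by simp
  hence R0: "0 < R" using eR by simp
  have \<psi>01: "0 \<le> \<psi> w" "\<psi> w \<le> 1" for w using I' by auto
  have \<psi>L: "\<bar>\<psi> w - \<psi> w'\<bar> \<le> B * norm (w - w') / e" for w w' using I' by auto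
  have \<psi>1: "B * e \<le> norm w \<Longrightarrow> \<psi> w = 1" for w using I' by auto
  have \<psi>0: "norm w \<le> e / B \<Longrightarrow> \<psi> w = 0" for w using I' by auto
  have "(B / e)-lipschitz_on UNIV \<psi>"
    by (rule lipschitz_onI) (use \<psi>L B e0 in \<open>auto simp: dist_norm\<close>)
  hence c\<psi>: "continuous_on UNIV \<psi>" by (rule lipschitz_on_continuous_on)
  have "B-lipschitz_on UNIV \<eta>"
    by (rule lipschitz_onI) (use \<eta> B in \<open>auto simp: dist_norm\<close>)
  hence c\<eta>: "continuous_on UNIV \<eta>" by (rule lipschitz_on_continuous_on)
  show "continuous_on UNIV \<phi>"
    unfolding \<phi>
    by (intro continuous_on_mult c\<psi> continuous_on_compose2[OF c\<eta>] continuous_intros) (use R0 in auto)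
  show "\<bar>\<phi> w\<bar> \<le> 1" for w
    unfolding \<phi> abs_mult using \<psi>01[of w] \<eta>(2)[of "norm w / R"] by (simp add: mult_le_one)
  show "\<exists>r>0. \<exists>R. \<forall>w. norm w \<le> r \<or> R \<le> norm w \<longrightarrow> \<phi> w = 0"
    by (rule exI[of _ "e / B"], intro conjI exI[of _ "2 * R"])
      (use e0 B R0 \<psi>0 in \<open>auto simp: \<phi> \<eta>(4) field_simps\<close>)
  fix L :: real assume L: "0 < L"
  \<comment> \<open>Up to 4 R the Lipschitz bound suffices. Beyond, \<eta> vanishes at w; if it does
    not vanish at w', then norm w' < 2 R < norm w / 2, which forces norm w \<le> 2 L.\<close>
  have \<eta>term: "\<bar>\<eta> (norm w / R) - \<eta> (norm w' / R)\<bar> * norm w \<le> 4 * B\<^sup>2 * L"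
    if w: "norm (w - w') \<le> L" for w w' :: "real ^ 'n"
  proof (cases "norm w \<le> 4 * R")
    case True
    have "\<bar>norm w / R - norm w' / R\<bar> = \<bar>norm w - norm w'\<bar> / R"
      using R0 by (simp add: diff_divide_distrib[symmetric])
    also have "\<dots> \<le> L / R"
      using R0 w norm_triangle_ineq3[of w w'] by (intro divide_right_mono) auto
    finally have "\<bar>\<eta> (norm w / R) - \<eta> (norm w' / R)\<bar> \<le> B * (L / R)"
      using \<eta>(1)[of "norm w / R" "norm w' / R"] B by (meson dual_order.trans mult_left_mono order_trans zero_le_one)
    hence "\<bar>\<eta> (norm w / R) - \<eta> (norm w' / R)\<bar> * norm w \<le> B * (L / R) * (4 * R)"
      using True by (intro mult_mono) (use B L R0 in auto)
    also have "\<dots> = 4 * B * L" using R0 by simp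
    also have "\<dots> \<le> 4 * B\<^sup>2 * L" using B1 L by simp
    finally show ?thesis .
  next
    case False
    hence \<eta>0: "\<eta> (norm w / R) = 0" using R0 by (intro \<eta>(4)) (simp add: field_simps)
    show ?thesis
    proof (cases "2 * R \<le> norm w'")
      case True
      hence "\<eta> (norm w' / R) = 0" using R0 by (intro \<eta>(4)) (simp add: field_simps)
      thus ?thesis using \<eta>0 L by simp
    next
      case F: False
      have "norm w \<le> norm w' + L" using w norm_triangle_sub[of w w'] by simp
      hence "norm w \<le> 2 * L" using F False by simp
      hence "\<bar>\<eta> (norm w / R) - \<eta> (norm w' / R)\<bar> * norm w \<le> 1 * (2 * L)"
        using \<eta>0 \<eta>(2)[of "norm w' / R"] by (intro mult_mono) auto
      also have "\<dots> \<le> 4 * B\<^sup>2 * L" using B1 B L by simp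
      finally show ?thesis .
    qed
  qed
  have small: "norm w \<le> L / (12 * B\<^sup>2) \<Longrightarrow> norm w \<le> L / B" for w :: "real ^ 'n"
    by (erule order_trans, rule divide_left_mono) (use B B1 L in \<open>auto intro: order_trans[of _ "B\<^sup>2"]\<close>)
  have combine: "\<bar>\<psi> w * \<eta> (norm w / R) - \<psi>' w' * \<eta> (norm w' / R)\<bar> * norm w \<le> 12 * B\<^sup>2 * L"
    if "\<bar>\<psi> w - \<psi>' w'\<bar> * norm w \<le> 8 * B\<^sup>2 * L" "norm (w - w') \<le> L" for \<psi>' and w w' :: "real ^ 'n"
  proof -
    have "\<bar>\<psi> w * \<eta> (norm w / R) - \<psi>' w' * \<eta> (norm w' / R)\<bar> * norm w
        \<le> (\<bar>\<psi> w - \<psi>' w'\<bar> + \<bar>\<eta> (norm w / R) - \<eta> (norm w' / R)\<bar>) * norm w"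
      by (intro mult_right_mono abs_mult_diff_le) (use \<psi>01 \<eta>(2) in auto)
    thus ?thesis using that(1) \<eta>term[OF that(2)] by (simp add: distrib_right)
  qed
  have tri: "norm w - L \<le> norm w'" if "norm (w - w') \<le> L" for w w' :: "real ^ 'n"
    using that norm_triangle_sub[of w w'] by simp
  \<comment> \<open>A shift small against e keeps the cutoff itself. A shift between e / 4 and R
    replaces the inner scale e by L: the two inner cutoffs differ only where norm w is of order L.
    If R \<le> L, all of \<phi> lives within 2 L and zero is close enough.\<close>
  consider "4 * L < e" | "e \<le> 4 * L" "L < R" | "R \<le> L" by linarith
  thus "\<exists>\<phi>'\<in>insert (\<lambda>_. 0) \<Phi>. (\<forall>w. norm w \<le> L / (12 * B\<^sup>2) \<longrightarrow> \<phi>' w = 0) \<and>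
          (\<forall>w w'. norm (w - w') \<le> L \<longrightarrow> \<bar>\<phi> w - \<phi>' w'\<bar> * norm w \<le> 12 * B\<^sup>2 * L)"
  proof cases
    case 1
    have "\<bar>\<psi> w - \<psi> w'\<bar> * norm w \<le> 8 * B\<^sup>2 * L" if w: "norm (w - w') \<le> L" for w w'
    proof (cases "norm w \<le> 2 * B * e")
      case True
      have "\<bar>\<psi> w - \<psi> w'\<bar> * norm w \<le> B * L / e * (2 * B * e)"
        by (intro mult_mono order_trans[OF \<psi>L] divide_right_mono mult_left_mono w True) (use e0 B L in auto)
      also have "\<dots> = 2 * B\<^sup>2 * L" using e0 by (simp add: power2_eq_square)
      finally show ?thesis using L B by (smt (verit) mult_right_mono zero_le_power2)
    next
      case False
      have "e \<le> B * e" using B e0 by simp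
      hence "B * e \<le> norm w" "B * e \<le> norm w'" using False tri[OF w] 1 e0 by linarith+
      thus ?thesis using L \<psi>1 by simp
    qed
    moreover have "norm w \<le> L / (12 * B\<^sup>2) \<Longrightarrow> \<psi> w = 0" for w
      using small[of w] 1 B L e0 by (intro \<psi>0) (smt (verit) divide_right_mono)
    ultimately show ?thesis
      using \<open>\<phi> \<in> \<Phi>\<close> combine[of _ \<psi>] by (intro bexI[of _ \<phi>]) (auto simp: \<phi>)
  next
    case 2
    obtain \<psi>' where \<psi>': "inner_cutoff B L \<psi>'" "(\<lambda>w. \<psi>' w * \<eta> (norm w / R)) \<in> \<Phi>"
      using ex[OF L 2(2)] by blast
    note J = \<psi>'(1)[unfolded inner_cutoff_def]
    have "\<bar>\<psi> w - \<psi>' w'\<bar> * norm w \<le> 8 * B\<^sup>2 * L" if w: "norm (w - w') \<le> L" for w w'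
    proof (cases "norm w \<le> 8 * B * L")
      case True
      have "0 \<le> \<psi>' w'" "\<psi>' w' \<le> 1" using J by auto
      hence "\<bar>\<psi> w - \<psi>' w'\<bar> \<le> 1" using \<psi>01[of w] by linarith
      hence "\<bar>\<psi> w - \<psi>' w'\<bar> * norm w \<le> 1 * (8 * B * L)" by (intro mult_mono True) auto
      also have "\<dots> \<le> 8 * B\<^sup>2 * L" using B1 L by simp
      finally show ?thesis .
    next
      case False
      have "L \<le> B * L" "B * e \<le> B * (4 * L)" using B L 2 by (auto simp: mult_left_mono)
      hence "B * e \<le> norm w" "B * L \<le> norm w'" using False tri[OF w] L by linarith+
      thus ?thesis using L \<psi>1 J by simp
    qed
    moreover have "norm w \<le> L / (12 * B\<^sup>2) \<Longrightarrow> \<psi>' w = 0" for w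
      using small[of w] J by auto
    ultimately show ?thesis
      using \<psi>'(2) combine[of _ \<psi>'] by (intro bexI[of _ "\<lambda>w. \<psi>' w * \<eta> (norm w / R)"]) (auto simp: \<phi>)
  next
    case 3
    have "\<bar>\<phi> w\<bar> * norm w \<le> 12 * B\<^sup>2 * L" for w
    proof (cases "2 * R \<le> norm w")
      case True
      hence "\<eta> (norm w / R) = 0" using R0 by (intro \<eta>(4)) (simp add: field_simps)
      thus ?thesis using L B by (simp add: \<phi>)
    next
      case False
      have "\<bar>\<phi> w\<bar> * norm w \<le> 1 * (2 * L)"
        using False 3 \<open>\<bar>\<phi> w\<bar> \<le> 1\<close> by (intro mult_mono) auto
      also have "\<dots> \<le> 12 * B\<^sup>2 * L" using mult_right_mono[of 2 "12 * B\<^sup>2" L] B1 B L by simp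
      finally show ?thesis by simp
    qed
    thus ?thesis by (intro bexI[of _ "\<lambda>_. 0"]) auto
  qed
next
  fix a R :: real assume a: "0 < a"
  have aB: "a / B \<le> a" using a B by (simp add: field_simps)
  \<comment> \<open>The inner scale a / B makes the inner cutoff one from radius a on; the outer
    radius is above R, and above a so that the scales are in the required order.\<close>
  obtain \<psi> where \<psi>: "inner_cutoff B (a / B) \<psi>" "(\<lambda>w. \<psi> w * \<eta> (norm w / (max R a + 1))) \<in> \<Phi>"
    using ex[of "a / B" "max R a + 1"] a B aB by force
  show "\<exists>\<phi>\<in>\<Phi>. \<forall>w. a \<le> norm w \<and> norm w \<le> R \<longrightarrow> \<phi> w = 1"
    by (rule bexI[OF _ \<psi>(2)]) (use a B \<psi>(1) in \<open>auto simp: inner_cutoff_def \<eta>(3)\<close>)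
qed

definition flat_truncations :: "(real \<Rightarrow> real) \<Rightarrow> (real \<Rightarrow> real) \<Rightarrow> (real ^ 'n \<Rightarrow> real) set" where
  "flat_truncations \<zeta> \<eta> = (\<lambda>(\<epsilon>, R) w. \<zeta> (norm w / \<epsilon>) * \<eta> (norm w / R)) ` {(\<epsilon>, R). 0 < \<epsilon> \<and> \<epsilon> < R}"

definition strong_truncations :: "(real \<Rightarrow> real) \<Rightarrow> (real \<Rightarrow> real) \<Rightarrow> (real ^ 'n \<Rightarrow> real) set" where
  "strong_truncations \<zeta> \<eta> = (\<lambda>(\<epsilon>, R) w. zeta_strong \<zeta> \<epsilon> w * \<eta> (norm w / R)) `
     {(\<epsilon>, R). (\<forall>i. 0 < \<epsilon> i \<and> \<epsilon> i < R) \<and> (\<forall>i j. 1/4 \<le> \<epsilon> i / \<epsilon> j \<and> \<epsilon> i / \<epsilon> j \<le> 4)}"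

definition trunc_max :: "(real ^ 'n \<Rightarrow> real) set \<Rightarrow> (real ^ 'n \<Rightarrow> real ^ 'n \<Rightarrow> complex) \<Rightarrow>
   (real ^ 'n) measure \<Rightarrow> (real ^ 'n \<Rightarrow> complex) \<Rightarrow> real ^ 'n \<Rightarrow> ennreal" where
  "trunc_max \<Phi> K \<sigma> f x =
     (SUP \<phi>\<in>\<Phi>. ennreal (norm (\<integral>y. K x y * of_real (\<phi> (x - y)) * f y \<partial>\<sigma>)))"

lemma T_flat_eq_trunc_max: "T_flat \<zeta> \<eta> K \<sigma> = trunc_max (flat_truncations \<zeta> \<eta>) K \<sigma>"
  by (intro ext) (simp add: T_flat_def trunc_max_def flat_truncations_def image_image case_prod_unfold)

lemma T_strong_eq_trunc_max: "T_strong \<zeta> \<eta> K \<sigma> = trunc_max (strong_truncations \<zeta> \<eta>) K \<sigma>"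
  by (intro ext) (simp add: T_strong_def trunc_max_def strong_truncations_def image_image case_prod_unfold)

lemma truncation_family_flat:
  assumes "truncation_pair \<zeta> \<eta>"
  shows "\<exists>B. truncation_family B (flat_truncations \<zeta> \<eta> :: (real ^ 'n \<Rightarrow> real) set)"
proof -
  note T = assms[unfolded truncation_pair_def]
  obtain B where B: "2 \<le> B" and \<zeta>L: "\<And>s t. \<bar>\<zeta> s - \<zeta> t\<bar> \<le> B * \<bar>s - t\<bar>"
    and \<eta>L: "\<And>s t. \<bar>\<eta> s - \<eta> t\<bar> \<le> B * \<bar>s - t\<bar>"
    and \<zeta>01: "\<And>t. 0 \<le> \<zeta> t \<and> \<zeta> t \<le> 1" and \<eta>01: "\<And>t. 0 \<le> \<eta> t \<and> \<eta> t \<le> 1"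
    by (rule truncation_pair_lipschitz[OF assms], rule that)
  have in_cut: "inner_cutoff B \<epsilon> (\<lambda>w::real ^ 'n. \<zeta> (norm w / \<epsilon>))" if \<epsilon>: "0 < \<epsilon>" for \<epsilon>
    unfolding inner_cutoff_def
  proof (intro conjI allI impI \<epsilon>)
    fix w w' :: "real ^ 'n"
    show "0 \<le> \<zeta> (norm w / \<epsilon>)" "\<zeta> (norm w / \<epsilon>) \<le> 1" using \<zeta>01 by auto
    have "\<bar>norm w / \<epsilon> - norm w' / \<epsilon>\<bar> \<le> norm (w - w') / \<epsilon>"
      using \<epsilon> norm_triangle_ineq3[of w w'] by (simp add: diff_divide_distrib[symmetric] divide_right_mono)
    thus "\<bar>\<zeta> (norm w / \<epsilon>) - \<zeta> (norm w' / \<epsilon>)\<bar> \<le> B * norm (w - w') / \<epsilon>"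
      using \<zeta>L[of "norm w / \<epsilon>" "norm w' / \<epsilon>"] B
      by (smt (verit) mult_left_mono times_divide_eq_right)
  next
    fix w :: "real ^ 'n" assume "norm w \<le> \<epsilon> / B"
    moreover have "\<epsilon> / B \<le> \<epsilon> / 2" using \<epsilon> B by (intro divide_left_mono) auto
    ultimately have "norm w \<le> \<epsilon> / 2" by linarith
    hence "norm w / \<epsilon> \<le> 1 / 2" using \<epsilon> by (simp add: pos_divide_le_eq)
    thus "\<zeta> (norm w / \<epsilon>) = 0" using T by blast
  next
    fix w :: "real ^ 'n" assume "B * \<epsilon> \<le> norm w"
    moreover have "1 * \<epsilon> \<le> B * \<epsilon>" using \<epsilon> B by (intro mult_right_mono) auto
    ultimately have "\<epsilon> \<le> norm w" by linarith
    hence "1 \<le> norm w / \<epsilon>" using \<epsilon> by (simp add: pos_le_divide_eq)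
    thus "\<zeta> (norm w / \<epsilon>) = 1" using T by blast
  qed
  have "truncation_family (12 * B\<^sup>2) (flat_truncations \<zeta> \<eta> :: (real ^ 'n \<Rightarrow> real) set)"
  proof (rule truncation_familyI[where \<eta>=\<eta>])
    fix \<phi> assume "\<phi> \<in> (flat_truncations \<zeta> \<eta> :: (real ^ 'n \<Rightarrow> real) set)"
    then obtain \<epsilon> R where "0 < \<epsilon>" "\<epsilon> < R" "\<phi> = (\<lambda>w. \<zeta> (norm w / \<epsilon>) * \<eta> (norm w / R))"
      by (auto simp: flat_truncations_def)
    thus "\<exists>\<psi> e R. inner_cutoff B e \<psi> \<and> e < R \<and> \<phi> = (\<lambda>w. \<psi> w * \<eta> (norm w / R))"
      using in_cut by blast
  next
    fix e R :: real assume "0 < e" "e < R"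
    thus "\<exists>\<psi>::real ^ 'n \<Rightarrow> real. inner_cutoff B e \<psi> \<and> (\<lambda>w. \<psi> w * \<eta> (norm w / R)) \<in> flat_truncations \<zeta> \<eta>"
      using in_cut by (intro exI[of _ "\<lambda>w. \<zeta> (norm w / e)"]) (auto simp: flat_truncations_def)
  qed (use B \<eta>L \<eta>01 T in auto)
  thus ?thesis by blast
qed

text \<open>All \<epsilon> i are within a factor 4 of each other, so the factors of the product vary
  at one common scale. The cutoff is one as soon as a single factor vanishes.\<close>

lemma truncation_family_strong:
  assumes "truncation_pair \<zeta> \<eta>"
  shows "\<exists>B. truncation_family B (strong_truncations \<zeta> \<eta> :: (real ^ 'n \<Rightarrow> real) set)"
proof -
  note T = assms[unfolded truncation_pair_def]
  obtain B where B: "2 \<le> B" and \<zeta>L: "\<And>s t. \<bar>\<zeta> s - \<zeta> t\<bar> \<le> B * \<bar>s - t\<bar>"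
    and \<eta>L: "\<And>s t. \<bar>\<eta> s - \<eta> t\<bar> \<le> B * \<bar>s - t\<bar>"
    and \<zeta>01: "\<And>t. 0 \<le> \<zeta> t \<and> \<zeta> t \<le> 1" and \<eta>01: "\<And>t. 0 \<le> \<eta> t \<and> \<eta> t \<le> 1"
    by (rule truncation_pair_lipschitz[OF assms], rule that)
  define n where "n = real CARD('n)"
  have n: "1 \<le> n" by (simp add: n_def Suc_leI)
  \<comment> \<open>The factor n comes from telescoping a difference of products of n factors, 8 B
    from the two \<zeta> terms of each factor, whose scales may be as small as e / 4.\<close>
  define B' where "B' = 8 * n * B"
  have nB: "2 \<le> n * B" using mult_mono[of 1 n 2 B] n B by auto
  have B': "8 \<le> B'" "B \<le> B'" "4 * n \<le> B'" using nB n B mult_mono[of 1 "8 * n" B B] mult_left_mono[of 2 B "8 * n"]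
    by (auto simp: B'_def)
  \<comment> \<open>The parameters are mutually comparable, so any one of them can be the scale of
    the cutoff.\<close>
  let ?i = "Inl undefined :: 'n + 'n"
  have in_cut: "inner_cutoff B' (\<epsilon> ?i) (zeta_strong \<zeta> \<epsilon> :: real ^ 'n \<Rightarrow> real)"
    if \<epsilon>: "\<And>i. 0 < \<epsilon> i" and r: "\<And>i j. 1/4 \<le> \<epsilon> i / \<epsilon> j \<and> \<epsilon> i / \<epsilon> j \<le> 4" for \<epsilon> :: "'n + 'n \<Rightarrow> real"
  proof -
    define e where "e = \<epsilon> ?i"
    have e: "0 < e" "\<epsilon> i \<le> 4 * e" "e \<le> 4 * \<epsilon> i" for i
      using \<epsilon>[of i] \<epsilon>[of ?i] r[of i ?i] by (auto simp: e_def field_simps)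
    define g where "g k w = 1 - (\<zeta> (w $ k / \<epsilon> (Inl k)) + \<zeta> (- w $ k / \<epsilon> (Inr k)))" for k and w :: "real ^ 'n"
    have zs: "zeta_strong \<zeta> \<epsilon> w = 1 - (\<Prod>k\<in>UNIV. g k w)" for w
      by (simp add: zeta_strong_def g_def)
    \<comment> \<open>The two arguments have opposite signs and \<zeta> vanishes up to 1 / 2, so at
      most one term is nonzero. Hence every factor stays between 0 and 1.\<close>
    have one0: "\<zeta> (t / \<epsilon> i) = 0 \<or> \<zeta> (- t / \<epsilon> j) = 0" for t i j
      using T \<epsilon>[of i] \<epsilon>[of j]
      by (cases "t \<le> 0") (auto simp: field_simps intro: order_trans[of _ 0])
    have g01: "0 \<le> g k w" "g k w \<le> 1" for k w
      using one0[of "w $ k" "Inl k" "Inr k"] \<zeta>01[of "w $ k / \<epsilon> (Inl k)"] \<zeta>01[of "- w $ k / \<epsilon> (Inr k)"]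
      by (auto simp: g_def)
    have zL: "\<bar>\<zeta> (s / \<epsilon> i) - \<zeta> (t / \<epsilon> i)\<bar> \<le> 4 * B * \<bar>s - t\<bar> / e" for s t i
    proof -
      have "\<bar>s / \<epsilon> i - t / \<epsilon> i\<bar> = \<bar>s - t\<bar> / \<epsilon> i"
        using \<epsilon>[of i] by (simp add: diff_divide_distrib[symmetric])
      also have "\<dots> \<le> \<bar>s - t\<bar> / (e / 4)"
        using e(1) e(3)[of i] \<epsilon>[of i] by (intro divide_left_mono) auto
      finally have "B * \<bar>s / \<epsilon> i - t / \<epsilon> i\<bar> \<le> B * (\<bar>s - t\<bar> / (e / 4))"
        using B by (intro mult_left_mono) auto
      thus ?thesis using \<zeta>L[of "s / \<epsilon> i" "t / \<epsilon> i"] by (simp add: mult.commute mult.left_commute)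
    qed
    have gL: "\<bar>g k w - g k w'\<bar> \<le> 8 * B * norm (w - w') / e" for k w w'
    proof -
      have "\<bar>g k w - g k w'\<bar> \<le> 4 * B * \<bar>w $ k - w' $ k\<bar> / e + 4 * B * \<bar>(- w $ k) - (- w' $ k)\<bar> / e"
        using zL[of "w $ k" "Inl k" "w' $ k"] zL[of "- w $ k" "Inr k" "- w' $ k"] unfolding g_def by linarith
      also have "\<bar>(- w $ k) - (- w' $ k)\<bar> = \<bar>w $ k - w' $ k\<bar>" by simp
      also have "4 * B * \<bar>w $ k - w' $ k\<bar> / e + 4 * B * \<bar>w $ k - w' $ k\<bar> / e = 8 * B * \<bar>w $ k - w' $ k\<bar> / e"
        by (simp add: field_simps)
      also have "\<dots> \<le> 8 * B * norm (w - w') / e"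
        using component_le_norm_cart[of "w - w'" k] e(1) B
        by (intro divide_right_mono mult_left_mono) auto
      finally show ?thesis .
    qed
    have "inner_cutoff B' e (\<lambda>w. 1 - (\<Prod>k\<in>UNIV. g k w))"
      unfolding inner_cutoff_def
    proof (intro conjI allI impI e(1))
      fix w w' :: "real ^ 'n"
      show "0 \<le> 1 - (\<Prod>k\<in>UNIV. g k w)" using g01 by (simp add: prod_le_1)
      show "1 - (\<Prod>k\<in>UNIV. g k w) \<le> 1" using g01 by (simp add: prod_nonneg)
      have "\<bar>(\<Prod>k\<in>UNIV. g k w) - (\<Prod>k\<in>UNIV. g k w')\<bar> \<le> (\<Sum>k\<in>UNIV. \<bar>g k w - g k w'\<bar>)"
        using norm_prod_diff[of UNIV "\<lambda>k. g k w" "\<lambda>k. g k w'"] g01 by auto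
      also have "\<dots> \<le> (\<Sum>k\<in>(UNIV::'n set). 8 * B * norm (w - w') / e)"
        by (intro sum_mono gL)
      also have "\<dots> = B' * norm (w - w') / e" by (simp add: n_def B'_def)
      finally show "\<bar>1 - (\<Prod>k\<in>UNIV. g k w) - (1 - (\<Prod>k\<in>UNIV. g k w'))\<bar> \<le> B' * norm (w - w') / e"
        by simp
    next
      fix w :: "real ^ 'n" assume w: "norm w \<le> e / B'"
      have "e / B' \<le> e / 8" using e(1) B' by (intro divide_left_mono) auto
      hence wk: "\<bar>w $ k\<bar> \<le> e / 8" for k using w component_le_norm_cart[of w k] by linarith
      have wk: "\<bar>w $ k\<bar> \<le> \<epsilon> i / 2" for k i using e(3)[of i] wk[of k] by linarith
      have "g k w = 1" for k
        using T wk[of k "Inl k"] wk[of k "Inr k"] \<epsilon>[of "Inl k"] \<epsilon>[of "Inr k"]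
        by (auto simp: g_def field_simps)
      thus "1 - (\<Prod>k\<in>UNIV. g k w) = 0" by simp
    next
      fix w :: "real ^ 'n" assume w: "B' * e \<le> norm w"
      \<comment> \<open>By the l1 bound on the norm some coordinate reaches 4 e, hence every
        \<epsilon> i; there one \<zeta> term is one and the factor vanishes.\<close>
      have "\<exists>k. 4 * e \<le> \<bar>w $ k\<bar>"
      proof (rule ccontr)
        assume "\<not> ?thesis"
        hence "(\<Sum>k\<in>UNIV. \<bar>w $ k\<bar>) < (\<Sum>k\<in>(UNIV::'n set). 4 * e)"
          by (intro sum_strict_mono) (auto simp: not_le)
        hence "norm w < n * (4 * e)" using norm_le_l1_cart[of w] by (simp add: n_def)
        moreover have "4 * n * e \<le> B' * e" using B' e(1) by (intro mult_right_mono) auto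
        ultimately show False using w by simp
      qed
      then obtain k where k: "4 * e \<le> \<bar>w $ k\<bar>" by blast
      have "g k w = 0"
        using k one0[of "w $ k" "Inl k" "Inr k"] T e(2)[of "Inl k"] e(2)[of "Inr k"]
          \<epsilon>[of "Inl k"] \<epsilon>[of "Inr k"] \<zeta>01[of "w $ k / \<epsilon> (Inl k)"] g01(1)[of k w]
        by (cases "0 \<le> w $ k") (auto simp: g_def field_simps)
      thus "1 - (\<Prod>k\<in>UNIV. g k w) = 1" by (simp add: prod_zero[of UNIV]) (metis)
    qed
    thus ?thesis by (simp add: e_def zs[abs_def])
  qed
  have "truncation_family (12 * B'\<^sup>2) (strong_truncations \<zeta> \<eta> :: (real ^ 'n \<Rightarrow> real) set)"
  proof (rule truncation_familyI[where \<eta>=\<eta>])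
    show "\<bar>\<eta> s - \<eta> t\<bar> \<le> B' * \<bar>s - t\<bar>" for s t
      by (rule order_trans[OF \<eta>L]) (use B' in \<open>auto intro: mult_right_mono\<close>)
    fix \<phi> assume "\<phi> \<in> (strong_truncations \<zeta> \<eta> :: (real ^ 'n \<Rightarrow> real) set)"
    then obtain \<epsilon> R where "\<forall>i. 0 < \<epsilon> i \<and> \<epsilon> i < R" "\<forall>i j. 1/4 \<le> \<epsilon> i / \<epsilon> j \<and> \<epsilon> i / \<epsilon> j \<le> 4"
      "\<phi> = (\<lambda>w. zeta_strong \<zeta> \<epsilon> w * \<eta> (norm w / R))"
      by (auto simp: strong_truncations_def)
    thus "\<exists>\<psi> e R. inner_cutoff B' e \<psi> \<and> e < R \<and> \<phi> = (\<lambda>w. \<psi> w * \<eta> (norm w / R))"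
      using in_cut[of \<epsilon>] by blast
  next
    fix e R :: real assume "0 < e" "e < R"
    thus "\<exists>\<psi>::real ^ 'n \<Rightarrow> real. inner_cutoff B' e \<psi> \<and> (\<lambda>w. \<psi> w * \<eta> (norm w / R)) \<in> strong_truncations \<zeta> \<eta>"
      using in_cut[of "\<lambda>_. e"]
      by (intro exI[of _ "zeta_strong \<zeta> (\<lambda>_. e)"]) (auto simp: strong_truncations_def)
  qed (use B' \<eta>01 T in auto)
  thus ?thesis by blast
qed

section \<open>Local mass and bounds by the maximal function\<close>

definition abs_mass :: "(real ^ 'n) measure \<Rightarrow> (real ^ 'n \<Rightarrow> complex) \<Rightarrow> (real ^ 'n) set \<Rightarrow> ennreal" where
  "abs_mass \<sigma> f A = (\<integral>\<^sup>+y\<in>A. ennreal (norm (f y)) \<partial>\<sigma>)"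

text \<open>In other words, f \<sigma> is a locally finite complex measure.\<close>

definition loc_integrable :: "(real ^ 'n) measure \<Rightarrow> (real ^ 'n \<Rightarrow> complex) \<Rightarrow> bool" where
  "loc_integrable \<sigma> f \<longleftrightarrow> f \<in> borel_measurable borel \<and> (\<forall>r. abs_mass \<sigma> f (cball 0 r) < \<infinity>)"

lemma sets_lf: "locally_finite_borel \<sigma> \<Longrightarrow> sets \<sigma> = sets borel"
  and space_lf: "locally_finite_borel \<sigma> \<Longrightarrow> space \<sigma> = UNIV"
  by (auto simp: locally_finite_borel_def dest: sets_eq_imp_space_eq)

lemma measurable_lf: "locally_finite_borel \<sigma> \<Longrightarrow> measurable \<sigma> M = measurable borel M"
  by (rule measurable_cong_sets) (auto simp: sets_lf)

lemma cball_in_borel [measurable, simp]: "cball (x :: 'a :: real_normed_vector) r \<in> sets borel"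
  by (simp add: borel_closed)

lemma emeasure_bounded_lf:
  assumes "locally_finite_borel \<sigma>" "bounded A"
  shows "emeasure \<sigma> A < \<infinity>"
proof -
  have "emeasure \<sigma> A \<le> emeasure \<sigma> (closure A)"
    by (rule emeasure_mono) (auto simp: closure_subset sets_lf assms)
  also have "\<dots> < \<infinity>" using assms by (auto simp: locally_finite_borel_def compact_closure)
  finally show ?thesis .
qed

lemma abs_mass_mono: "A \<subseteq> B \<Longrightarrow> abs_mass \<sigma> f A \<le> abs_mass \<sigma> f B"
  unfolding abs_mass_def by (rule nn_integral_mono) (auto split: split_indicator)

lemma loc_integrable_bounded:
  assumes "loc_integrable \<sigma> f" "bounded A"
  shows "abs_mass \<sigma> f A < \<infinity>"
proof -
  obtain r where "A \<subseteq> cball 0 r" using assms(2) by (auto simp: bounded_iff subset_iff)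
  hence "abs_mass \<sigma> f A \<le> abs_mass \<sigma> f (cball 0 r)" by (rule abs_mass_mono)
  thus ?thesis using assms(1) by (auto simp: loc_integrable_def intro: order.strict_trans1)
qed

lemma loc_integrable_indicator:
  assumes "loc_integrable \<sigma> f" "S \<in> sets borel"
  shows "loc_integrable \<sigma> (\<lambda>y. indicator S y * f y)"
proof -
  have "abs_mass \<sigma> (\<lambda>y. indicator S y * f y) A \<le> abs_mass \<sigma> f A" for A
    unfolding abs_mass_def by (rule nn_integral_mono) (auto split: split_indicator)
  thus ?thesis using assms by (auto simp: loc_integrable_def intro: order.strict_trans1)
qed

text \<open>Pointwise |f| \<le> 1 + |f|^p, and \<sigma> is finite on balls.\<close>

lemma loc_integrable_Lp:
  assumes \<sigma>: "locally_finite_borel \<sigma>" and "1 \<le> p" and f: "f \<in> Lp_fun p \<sigma>"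
  shows "loc_integrable \<sigma> f"
  unfolding loc_integrable_def
proof (intro conjI allI)
  show m: "f \<in> borel_measurable borel" using f by (simp add: Lp_fun_def measurable_lf[OF \<sigma>])
  fix r
  have "norm (f y) \<le> 1 + norm (f y) powr p" for y
  proof (cases "norm (f y) \<le> 1")
    case False
    hence "norm (f y) powr 1 \<le> norm (f y) powr p" using \<open>1 \<le> p\<close> by (intro powr_mono) auto
    thus ?thesis using False by (auto simp: powr_one)
  qed (simp add: add_increasing2)
  hence "ennreal (norm (f y)) \<le> 1 + ennreal (norm (f y) powr p)" for y
    using ennreal_leI[of "norm (f y)" "1 + norm (f y) powr p"] by simp
  hence "abs_mass \<sigma> f (cball 0 r) \<le> (\<integral>\<^sup>+y. indicator (cball 0 r) y + ennreal (norm (f y) powr p) \<partial>\<sigma>)"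
    unfolding abs_mass_def by (intro nn_integral_mono) (auto split: split_indicator)
  also have "\<dots> = emeasure \<sigma> (cball 0 r) + (\<integral>\<^sup>+y. ennreal (norm (f y) powr p) \<partial>\<sigma>)"
    by (subst nn_integral_add) (use m \<sigma> in \<open>auto simp: measurable_lf sets_lf\<close>)
  also have "\<dots> < \<infinity>"
    using f emeasure_bounded_lf[OF \<sigma>, of "cball 0 r"]
    by (auto simp: Lp_fun_def integrable_iff_bounded)
  finally show "abs_mass \<sigma> f (cball 0 r) < \<infinity>" .
qed

lemma bounded_kernel_integral:
  fixes f g :: "real ^ 'n \<Rightarrow> complex"
  assumes \<sigma>: "locally_finite_borel \<sigma>" and f: "loc_integrable \<sigma> f"
    and g: "g \<in> borel_measurable borel" "\<And>y. norm (g y) \<le> M" "bounded A" "\<And>y. y \<notin> A \<Longrightarrow> g y = 0"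
  shows "integrable \<sigma> (\<lambda>y. g y * f y)"
proof -
  have "(\<integral>\<^sup>+y. ennreal (norm (g y * f y)) \<partial>\<sigma>) \<le> (\<integral>\<^sup>+y. ennreal M * (ennreal (norm (f y)) * indicator A y) \<partial>\<sigma>)"
  proof (rule nn_integral_mono)
    fix y
    have "0 \<le> M" using g(2)[of y] norm_ge_zero order_trans by blast
    thus "ennreal (norm (g y * f y)) \<le> ennreal M * (ennreal (norm (f y)) * indicator A y)"
      using g(2)[of y] g(4)[of y]
      by (auto split: split_indicator simp: norm_mult ennreal_mult[symmetric] intro!: ennreal_leI mult_right_mono)
  qed
  \<comment> \<open>The set A may fail to be measurable; its closure is measurable and still
    bounded.\<close>
  also have "\<dots> \<le> (\<integral>\<^sup>+y. ennreal M * (ennreal (norm (f y)) * indicator (closure A) y) \<partial>\<sigma>)"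
    using closure_subset[of A] by (intro nn_integral_mono mult_left_mono) (auto split: split_indicator)
  also have "\<dots> = ennreal M * abs_mass \<sigma> f (closure A)"
    unfolding abs_mass_def
    by (rule nn_integral_cmult) (use f in \<open>auto simp: measurable_lf[OF \<sigma>] loc_integrable_def\<close>)
  also have "\<dots> < \<infinity>"
    using loc_integrable_bounded[OF f, of "closure A"] g(3) by (simp add: ennreal_mult_less_top bounded_closure)
  finally show ?thesis
    using f g(1) by (intro integrableI_bounded) (auto simp: loc_integrable_def measurable_lf[OF \<sigma>])
qed

lemma norm_integral_le_nn_integral:
  fixes h :: "'a \<Rightarrow> complex"
  shows "ennreal (norm (integral\<^sup>L M h)) \<le> (\<integral>\<^sup>+y. ennreal (norm (h y)) \<partial>M)"
proof (cases "integrable M h")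
  case True
  thus ?thesis by (subst nn_integral_eq_integral) (auto intro!: ennreal_leI integral_norm_bound)
qed (simp add: not_integrable_integral_eq)

lemma lborel_cube:
  fixes a :: "real ^ 'n"
  assumes "0 \<le> l"
  shows "emeasure lborel (cbox a (\<chi> i. a $ i + l)) = ennreal (l ^ CARD('n))"
    "measure lborel (cbox a (\<chi> i. a $ i + l)) = l ^ CARD('n)"
proof -
  have ne: "cbox a (\<chi> i. a $ i + l) \<noteq> {}" using assms by (simp add: interval_ne_empty_cart)
  show "measure lborel (cbox a (\<chi> i. a $ i + l)) = l ^ CARD('n)"
    using content_cbox_cart[OF ne] by (simp add: measure_completion)
  thus "emeasure lborel (cbox a (\<chi> i. a $ i + l)) = ennreal (l ^ CARD('n))"
    using emeasure_lborel_cbox_finite[of a "\<chi> i. a $ i + l"] by (subst emeasure_eq_ennreal_measure) auto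
qed

abbreviation centered_cube :: "real ^ 'n \<Rightarrow> real \<Rightarrow> (real ^ 'n) set" where
  "centered_cube x r \<equiv> cbox (\<chi> i. x $ i - r) (\<chi> i. x $ i + r)"

lemma centered_cube_eq: "centered_cube x r = cbox (\<chi> i. x $ i - r) (\<chi> i. (\<chi> i. x $ i - r) $ i + 2 * r)"
  by (simp add: algebra_simps)

lemma centered_cube_cubes: "0 < r \<Longrightarrow> centered_cube x r \<in> cubes"
  unfolding cubes_def mem_Collect_eq
  by (rule exI[of _ "\<chi> i. x $ i - r"], rule exI[of _ "2 * r"], rule conjI[OF centered_cube_eq]) simp

lemma cball_subset_centered_cube: "cball x r \<subseteq> centered_cube x r"
proof
  fix y assume "y \<in> cball x r"
  hence "\<bar>(x - y) $ i\<bar> \<le> r" for i using component_le_norm_cart[of "x - y" i] by (simp add: dist_norm)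
  thus "y \<in> centered_cube x r" by (simp add: mem_box_cart abs_le_iff) (smt (verit))
qed

lemma centered_cube_subset_cball:
  fixes x :: "real ^ 'n"
  shows "centered_cube x r \<subseteq> cball x (real CARD('n) * r)"
proof
  fix y assume "y \<in> centered_cube x r"
  hence "\<bar>(x - y) $ i\<bar> \<le> r" for i by (simp add: mem_box_cart abs_le_iff) (smt (verit))
  hence "(\<Sum>i\<in>UNIV. \<bar>(x - y) $ i\<bar>) \<le> (\<Sum>i\<in>(UNIV :: 'n set). r)" by (intro sum_mono)
  thus "y \<in> cball x (real CARD('n) * r)" using norm_le_l1_cart[of "x - y"] by (simp add: dist_norm)
qed

lemma maximal_op_alt:
  assumes \<sigma>: "locally_finite_borel \<sigma>" and f: "f \<in> borel_measurable borel"
  shows "maximal_op \<sigma> f x = (SUP Q\<in>{Q \<in> cubes. x \<in> Q}. abs_mass \<sigma> f Q / emeasure lborel Q)"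
  unfolding maximal_op_def abs_mass_def
  by (intro SUP_cong refl arg_cong2[where f="(/)"] emeasure_density)
    (use f in \<open>auto simp: cubes_def measurable_lf[OF \<sigma>] sets_lf[OF \<sigma>]\<close>)

lemma abs_mass_cube_le_maximal:
  fixes x :: "real ^ 'n"
  assumes \<sigma>: "locally_finite_borel \<sigma>" and f: "f \<in> borel_measurable borel"
    and "0 < l" "x \<in> cbox a (\<chi> i. a $ i + l)"
  shows "abs_mass \<sigma> f (cbox a (\<chi> i. a $ i + l)) \<le> ennreal (l ^ CARD('n)) * maximal_op \<sigma> f x"
proof -
  let ?Q = "cbox a (\<chi> i. a $ i + l)"
  have "abs_mass \<sigma> f ?Q / emeasure lborel ?Q \<le> maximal_op \<sigma> f x"
    unfolding maximal_op_alt[OF \<sigma> f]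
    by (rule SUP_upper) (use assms(3,4) in \<open>auto simp: cubes_def\<close>)
  hence "abs_mass \<sigma> f ?Q / ennreal (l ^ CARD('n)) \<le> maximal_op \<sigma> f x"
    using assms(3) by (simp add: lborel_cube)
  hence "abs_mass \<sigma> f ?Q / ennreal (l ^ CARD('n)) * ennreal (l ^ CARD('n)) \<le> maximal_op \<sigma> f x * ennreal (l ^ CARD('n))"
    by (rule mult_right_mono) simp
  moreover have "abs_mass \<sigma> f ?Q / ennreal (l ^ CARD('n)) * ennreal (l ^ CARD('n)) = abs_mass \<sigma> f ?Q"
    using assms(3) by (simp add: ennreal_divide_times ennreal_divide_self)
  ultimately show ?thesis by (simp add: mult.commute)
qed

lemma abs_mass_cball_le_maximal:
  fixes x :: "real ^ 'n"
  assumes \<sigma>: "locally_finite_borel \<sigma>" and f: "f \<in> borel_measurable borel" and r: "0 < r"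
  shows "abs_mass \<sigma> f (cball x r) \<le> ennreal ((2 * r) ^ CARD('n)) * maximal_op \<sigma> f x"
proof -
  have "x \<in> centered_cube x r" using r by (simp add: mem_box_cart)
  hence "abs_mass \<sigma> f (centered_cube x r) \<le> ennreal ((2 * r) ^ CARD('n)) * maximal_op \<sigma> f x"
    unfolding centered_cube_eq by (intro abs_mass_cube_le_maximal[OF \<sigma> f]) (use r in auto)
  thus ?thesis using abs_mass_mono[OF cball_subset_centered_cube] order_trans by blast
qed

text \<open>The ball of radius 2 * 2^k L about x has |f| \<sigma> mass at most (4 * 2^k L)^n M f(x),
  so the k-th term contributes at most 4^n a k M f(x). This is how a kernel difference that decays
  over dyadic annuli is controlled by the maximal function.\<close>

lemma maximal_tail_bound:
  fixes x :: "real ^ 'n"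
  assumes \<sigma>: "locally_finite_borel \<sigma>" and f: "f \<in> borel_measurable borel" and L: "0 < L"
    and a: "\<And>k. 0 \<le> a k" "summable a"
  shows "(\<integral>\<^sup>+y. (\<Sum>k. ennreal (a k / (2 ^ k * L) ^ CARD('n)) * indicator (cball x (2 ^ Suc k * L)) y) * ennreal (norm (f y)) \<partial>\<sigma>)
    \<le> ennreal (4 ^ CARD('n) * suminf a) * maximal_op \<sigma> f x"
proof -
  have "(\<integral>\<^sup>+y. (\<Sum>k. ennreal (a k / (2 ^ k * L) ^ CARD('n)) * indicator (cball x (2 ^ Suc k * L)) y) * ennreal (norm (f y)) \<partial>\<sigma>)
     = (\<integral>\<^sup>+y. (\<Sum>k. ennreal (a k / (2 ^ k * L) ^ CARD('n)) * (ennreal (norm (f y)) * indicator (cball x (2 ^ Suc k * L)) y)) \<partial>\<sigma>)"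
    by (simp add: ennreal_suminf_multc[symmetric] mult_ac)
  also have "\<dots> = (\<Sum>k. ennreal (a k / (2 ^ k * L) ^ CARD('n)) * abs_mass \<sigma> f (cball x (2 ^ Suc k * L)))"
  proof -
    note [measurable] = f
    show ?thesis unfolding abs_mass_def
      by (subst nn_integral_suminf, simp only: measurable_lf[OF \<sigma>], measurable)
        (intro suminf_cong nn_integral_cmult, simp only: measurable_lf[OF \<sigma>], measurable)
  qed
  also have "\<dots> \<le> (\<Sum>k. ennreal (4 ^ CARD('n) * a k) * maximal_op \<sigma> f x)"
  proof (intro suminf_le summableI)
    fix k
    have "ennreal (a k / (2 ^ k * L) ^ CARD('n)) * abs_mass \<sigma> f (cball x (2 ^ Suc k * L))
       \<le> ennreal (a k / (2 ^ k * L) ^ CARD('n)) * (ennreal ((2 * (2 ^ Suc k * L)) ^ CARD('n)) * maximal_op \<sigma> f x)"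
      by (intro mult_left_mono abs_mass_cball_le_maximal[OF \<sigma> f]) (use L in auto)
    also have "\<dots> = ennreal (a k / (2 ^ k * L) ^ CARD('n) * (2 * (2 ^ Suc k * L)) ^ CARD('n)) * maximal_op \<sigma> f x"
      unfolding mult.assoc[symmetric] by (subst ennreal_mult[symmetric]) (use L a in auto)
    also have "a k / (2 ^ k * L) ^ CARD('n) * (2 * (2 ^ Suc k * L)) ^ CARD('n) = 4 ^ CARD('n) * a k"
    proof -
      have "(2 * (2 ^ Suc k * L)) ^ CARD('n) = 4 ^ CARD('n) * (2 ^ k * L) ^ CARD('n)"
      proof -
        have "2 * (2 ^ Suc k * L) = 4 * (2 ^ k * L)" by simp
        thus ?thesis by (simp only: power_mult_distrib)
      qed
      thus ?thesis using L by simp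
    qed
    finally show "ennreal (a k / (2 ^ k * L) ^ CARD('n)) * abs_mass \<sigma> f (cball x (2 ^ Suc k * L))
       \<le> ennreal (4 ^ CARD('n) * a k) * maximal_op \<sigma> f x" .
  qed
  also have "\<dots> = (\<Sum>k. ennreal (4 ^ CARD('n) * a k)) * maximal_op \<sigma> f x"
    by (simp add: ennreal_suminf_multc)
  also have "(\<Sum>k. ennreal (4 ^ CARD('n) * a k)) = ennreal (4 ^ CARD('n) * suminf a)"
    using a by (subst suminf_ennreal2) (auto simp: suminf_mult summable_mult)
  finally show ?thesis .
qed

text \<open>Only the values of the modulus at the scales \<open>2 ^ -k\<close> matter; there the Dini
  condition becomes summability.\<close>

definition dini_kernel :: "real \<Rightarrow> (nat \<Rightarrow> real) \<Rightarrow> (real ^ 'n \<Rightarrow> real ^ 'n \<Rightarrow> complex) \<Rightarrow> bool" where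
  "dini_kernel C d K \<longleftrightarrow> 0 \<le> C \<and> (\<forall>k. 0 \<le> d k) \<and> summable d \<and> (\<forall>x. K x \<in> borel_measurable borel) \<and>
     (\<forall>x y. x \<noteq> y \<longrightarrow> norm (K x y) \<le> C / norm (x - y) ^ CARD('n)) \<and>
     (\<forall>k\<ge>1. \<forall>x x' y. x \<noteq> y \<longrightarrow> norm (x - x') * 2 ^ k \<le> norm (x - y) \<longrightarrow>
        norm (K x y - K x' y) \<le> d k / norm (x - y) ^ CARD('n))"

lemma set_integral_const_Ioc:
  fixes a b c :: real
  assumes "a \<le> b"
  shows "(LINT s:{a<..b}|lborel. c) = (b - a) * c"
proof -
  have "integrable lborel (indicat_real {a<..b})"
    using assms by (intro integrable_real_indicator) auto
  thus ?thesis using assms by (simp add: set_lebesgue_integral_def)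
qed

text \<open>Between 2^-(k+1) and 2^-k, monotonicity gives \<delta>(s) / s \<ge> 2^k
  \<delta>(2^-(k+1)). The interval has length 2^-(k+1), so this piece of the Dini integral is at
  least half a term of the series.\<close>

lemma dini_modulus_summable:
  assumes "dini_modulus \<delta>"
  shows "summable (\<lambda>k. \<delta> (1 / 2 ^ k))" "\<And>k. 0 \<le> \<delta> (1 / 2 ^ k)"
proof -
  have m: "mono_on {0..1} \<delta>" and z: "\<delta> 0 = 0" and i: "set_integrable lborel {0<..1} (\<lambda>s. \<delta> s / s)"
    using assms by (auto simp: dini_modulus_def)
  show pos: "0 \<le> \<delta> (1 / 2 ^ k)" for k
    using mono_onD[OF m, of 0 "1 / 2 ^ k"] z by simp
  have dpos: "0 \<le> \<delta> s" if "0 < s" "s \<le> 1" for s using mono_onD[OF m, of 0 s] z that by simp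
  let ?g = "\<lambda>s. \<delta> s / s" and ?I = "\<lambda>N. {1 / 2 ^ N<..1::real}"
  have I: "set_integrable lborel {a<..b} ?g" if "0 \<le> a" "b \<le> 1" for a b :: real
    by (rule set_integrable_subset[OF i]) (use that in auto)
  have *: "(\<Sum>k<N. \<delta> (1 / 2 ^ Suc k) / 2) \<le> (LINT s:?I N|lborel. ?g s)" for N
  proof (induction N)
    case (Suc N)
    let ?J = "{1 / 2 ^ Suc N<..1 / 2 ^ N::real}"
    have le: "1 / 2 ^ Suc N \<le> (1::real) / 2 ^ N" "(1::real) / 2 ^ N \<le> 1" by (auto simp: field_simps)
    have un: "?I (Suc N) = ?J \<union> ?I N"
      using le by (intro ivl_disj_un_two(6)[symmetric])
    have J: "set_integrable lborel ?J ?g" by (rule I) (use le in auto)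
    have "(LINT s:?J|lborel. \<delta> (1 / 2 ^ Suc N) * 2 ^ N) \<le> (LINT s:?J|lborel. ?g s)"
    proof (rule set_integral_mono[OF _ J])
      show "set_integrable lborel ?J (\<lambda>s. \<delta> (1 / 2 ^ Suc N) * 2 ^ N)"
        unfolding set_integrable_def using le
        by (intro integrable_scaleR_left integrable_real_indicator) auto
      fix s assume s: "s \<in> ?J"
      have s0: "0 < s" using s by (auto intro: less_trans[of 0 "1 / 2 ^ Suc N"])
      have s1: "s \<le> 1" "1 / 2 ^ Suc N \<le> s" using s le(2) by (meson greaterThanAtMost_iff order_trans less_imp_le)+
      have "\<delta> (1 / 2 ^ Suc N) \<le> \<delta> s"
        using s0 s1 one_le_power[of "2::real" "Suc N"] by (intro mono_onD[OF m]) auto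
      moreover have "2 ^ N \<le> 1 / s" using s s0 by (auto simp: field_simps)
      ultimately have "\<delta> (1 / 2 ^ Suc N) * 2 ^ N \<le> \<delta> s * (1 / s)"
        using s0 s1 dpos[of s] by (intro mult_mono) auto
      thus "\<delta> (1 / 2 ^ Suc N) * 2 ^ N \<le> \<delta> s / s" by simp
    qed
    moreover have "(LINT s:?J|lborel. \<delta> (1 / 2 ^ Suc N) * 2 ^ N) = \<delta> (1 / 2 ^ Suc N) / 2"
      by (rule trans[OF set_integral_const_Ioc[OF le(1)]]) (simp add: field_simps)
    moreover have "(LINT s:?I (Suc N)|lborel. ?g s) = (LINT s:?J|lborel. ?g s) + (LINT s:?I N|lborel. ?g s)"
      unfolding un by (rule set_integral_Un[OF _ J I]) auto
    ultimately show ?case using Suc unfolding sum.lessThan_Suc by linarith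
  qed (simp add: set_lebesgue_integral_def)
  have "(LINT s:?I N|lborel. ?g s) \<le> (LINT s:{0<..1}|lborel. ?g s)" for N
  proof -
    have le: "(1::real) / 2 ^ N \<le> 1" by simp
    have "{0<..1} = {0<..1 / 2 ^ N} \<union> ?I N"
      using le by (intro ivl_disj_un_two(6)[symmetric]) auto
    hence "(LINT s:{0<..1}|lborel. ?g s) = (LINT s:{0<..1 / 2 ^ N}|lborel. ?g s) + (LINT s:?I N|lborel. ?g s)"
      using le by (simp only:) (intro set_integral_Un I, auto)
    moreover have "0 \<le> (LINT s:{0<..1 / 2 ^ N}|lborel. ?g s)"
      unfolding set_lebesgue_integral_def
      by (rule Bochner_Integration.integral_nonneg)
        (use le dpos order_trans[OF _ le] in \<open>auto split: split_indicator intro!: divide_nonneg_pos\<close>)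
    ultimately show ?thesis by simp
  qed
  from order_trans[OF * this] have "(\<Sum>k<N. \<delta> (1 / 2 ^ Suc k)) \<le> 2 * (LINT s:{0<..1}|lborel. ?g s)" for N
    unfolding sum_divide_distrib[symmetric] by (simp add: field_simps)
  hence "summable (\<lambda>k. \<delta> (1 / 2 ^ Suc k))"
    using pos[of "Suc _"] by (intro bounded_imp_summable[where B="2 * (LINT s:{0<..1}|lborel. ?g s)"])
      (metis, metis lessThan_Suc_atMost)
  thus "summable (\<lambda>k. \<delta> (1 / 2 ^ k))" by (subst summable_Suc_iff[symmetric])
qed

text \<open>The ratio of |x - x'| to |x - y| is rounded up to 2^-k by monotonicity of the modulus; k
  \<ge> 1 matches the restriction to ratios at most 1/2.\<close>

lemma size_smooth_dini_kernel:
  assumes "size_smooth_kernel K"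
  obtains C d where "dini_kernel C d K"
proof -
  obtain C \<delta> where \<delta>: "dini_modulus \<delta>"
    and s: "\<And>x y. x \<noteq> y \<Longrightarrow> norm (K x y) \<le> C / norm (x - y) ^ CARD('a)"
    and r: "\<And>x x' y. x \<noteq> y \<Longrightarrow> norm (x - x') / norm (x - y) \<le> 1 / 2 \<Longrightarrow>
        norm (K x y - K x' y) \<le> C * \<delta> (norm (x - x') / norm (x - y)) / norm (x - y) ^ CARD('a)"
    and K: "\<And>x. K x \<in> borel_measurable borel"
    using assms unfolding size_smooth_kernel_def by auto
  have m: "mono_on {0..1} \<delta>" "\<delta> 0 = 0" using \<delta> by (auto simp: dini_modulus_def)
  have "dini_kernel \<bar>C\<bar> (\<lambda>k. \<bar>C\<bar> * \<delta> (1 / 2 ^ k)) K"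
    unfolding dini_kernel_def
  proof (intro conjI allI impI K)
    show "summable (\<lambda>k. \<bar>C\<bar> * \<delta> (1 / 2 ^ k))" "0 \<le> \<bar>C\<bar> * \<delta> (1 / 2 ^ k)" for k
      using dini_modulus_summable[OF \<delta>] by (auto intro: summable_mult)
    fix x y :: "real ^ 'a" assume "x \<noteq> y"
    show "norm (K x y) \<le> \<bar>C\<bar> / norm (x - y) ^ CARD('a)"
      by (rule order_trans[OF s[OF \<open>x \<noteq> y\<close>]]) (simp add: divide_right_mono)
  next
    fix k :: nat and x x' y :: "real ^ 'a"
    assume k: "1 \<le> k" and xy: "x \<noteq> y" and xx: "norm (x - x') * 2 ^ k \<le> norm (x - y)"
    let ?t = "norm (x - x') / norm (x - y)"
    have t: "?t \<le> 1 / 2 ^ k" using xx xy by (simp add: field_simps)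
    have k2: "(2::real) \<le> 2 ^ k" using power_increasing[OF k, of "2::real"] by simp
    hence "1 / 2 ^ k \<le> (1::real) / 2" by (intro divide_left_mono) auto
    hence t2: "?t \<le> 1 / 2" using t by linarith
    have t01: "?t \<in> {0..1}" "(0::real) \<in> {0..1}" "1 / 2 ^ k \<in> {0..1::real}"
      using order_trans[OF t2, of 1] by (auto simp del: divide_le_eq_1)
    have \<delta>t: "0 \<le> \<delta> ?t" "\<delta> ?t \<le> \<delta> (1 / 2 ^ k)"
      using mono_onD[OF m(1) t01(2,1)] mono_onD[OF m(1) t01(1,3) t] m(2) by auto
    have "C * \<delta> ?t \<le> \<bar>C\<bar> * \<delta> (1 / 2 ^ k)" using \<delta>t by (intro mult_mono) auto
    thus "norm (K x y - K x' y) \<le> \<bar>C\<bar> * \<delta> (1 / 2 ^ k) / norm (x - y) ^ CARD('a)"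
      using r[OF xy t2] by (meson divide_right_mono dual_order.trans norm_ge_zero zero_le_power)
  qed auto
  thus ?thesis by (rule that)
qed

lemma dyadic_scale:
  fixes t :: real
  assumes "1 \<le> t"
  obtains k :: nat where "2 ^ k \<le> t" "t < 2 ^ Suc k"
proof -
  obtain m where "t < 2 ^ m" using real_arch_pow[of 2 t] by auto
  hence ex: "\<exists>m. t < 2 ^ m" by blast
  define m where "m = (LEAST m. t < 2 ^ m)"
  have m: "t < 2 ^ m" unfolding m_def by (rule LeastI_ex[OF ex])
  with assms have "m \<noteq> 0" by (intro notI) simp
  then obtain k where k: "m = Suc k" by (cases m) auto
  have "\<not> t < 2 ^ k" unfolding m_def using k m_def not_less_Least[of k "\<lambda>m. t < 2 ^ m"] by simp
  thus ?thesis using that[of k] m k by simp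
qed

lemma term_le_suminf_ennreal: "(f k :: ennreal) \<le> suminf f"
  using sum_le_suminf[of f "{k}"] by (simp add: summableI)

section \<open>Maximum principle and semicontinuity of the truncated operators\<close>

text \<open>The measure is a parameter because the setting is instantiated a second time, with
  Lebesgue measure, when singular integrals are treated.\<close>

locale trunc_setting =
  fixes \<sigma> :: "(real ^ 'n) measure" and K :: "real ^ 'n \<Rightarrow> real ^ 'n \<Rightarrow> complex"
    and C :: real and d :: "nat \<Rightarrow> real" and \<Phi> :: "(real ^ 'n \<Rightarrow> real) set" and B :: real
  assumes \<sigma>: "locally_finite_borel \<sigma>" and K: "dini_kernel C d K" and \<Phi>: "truncation_family B \<Phi>"
begin

abbreviation "T \<equiv> trunc_max \<Phi> K \<sigma>"
abbreviation "M \<equiv> maximal_op \<sigma>"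

lemma C0: "0 \<le> C" and d0: "0 \<le> d k" and sd: "summable d"
  and Km [measurable]: "K x \<in> borel_measurable borel"
  and Ksize: "x \<noteq> y \<Longrightarrow> norm (K x y) \<le> C / norm (x - y) ^ CARD('n)"
  and Ksmooth: "1 \<le> k \<Longrightarrow> x \<noteq> y \<Longrightarrow> norm (x - x') * 2 ^ k \<le> norm (x - y) \<Longrightarrow>
        norm (K x y - K x' y) \<le> d k / norm (x - y) ^ CARD('n)"
  using K by (auto simp: dini_kernel_def)

lemma B1: "1 \<le> B" using \<Phi> by (simp add: truncation_family_def)

text \<open>Zero is adjoined to the family because comparing truncations at two base points may
  leave no truncation at all.\<close>

lemma trunc_props:
  assumes "\<phi> \<in> insert (\<lambda>_. 0) \<Phi>"
  shows "continuous_on UNIV \<phi>" "\<bar>\<phi> w\<bar> \<le> 1" "\<exists>r>0. \<exists>R. \<forall>w. norm w \<le> r \<or> R \<le> norm w \<longrightarrow> \<phi> w = 0"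
proof -
  have "\<phi> \<in> \<Phi> \<Longrightarrow> continuous_on UNIV \<phi> \<and> (\<forall>w. \<bar>\<phi> w\<bar> \<le> 1) \<and>
        (\<exists>r>0. \<exists>R. \<forall>w. norm w \<le> r \<or> R \<le> norm w \<longrightarrow> \<phi> w = 0)"
    using \<Phi> unfolding truncation_family_def by blast
  moreover have "(\<exists>r>0. \<exists>R. \<forall>w::real^'n. norm w \<le> r \<or> R \<le> norm w \<longrightarrow> (0::real) = 0)"
    by (intro exI[of _ 1]) auto
  ultimately show "continuous_on UNIV \<phi>" "\<bar>\<phi> w\<bar> \<le> 1"
    "\<exists>r>0. \<exists>R. \<forall>w. norm w \<le> r \<or> R \<le> norm w \<longrightarrow> \<phi> w = 0"
    using assms by auto
qed

lemma trunc_measurable [measurable]: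
  assumes "\<phi> \<in> insert (\<lambda>_. 0) \<Phi>"
  shows "(\<lambda>y. complex_of_real (\<phi> (x - y))) \<in> borel_measurable borel"
proof -
  have "continuous_on UNIV (\<lambda>y. complex_of_real (\<phi> (x - y)))"
    by (intro continuous_on_of_real continuous_on_compose2[OF trunc_props(1)[OF assms]] continuous_intros) auto
  thus ?thesis by (rule borel_measurable_continuous_onI)
qed

lemma trunc_kernel_bound:
  assumes "\<phi> \<in> insert (\<lambda>_. 0) \<Phi>" "0 < r" "\<And>w. norm w \<le> r \<Longrightarrow> \<phi> w = 0"
  shows "norm (K x y * of_real (\<phi> (x - y))) \<le> C / r ^ CARD('n)"
proof (cases "norm (x - y) \<le> r")
  case True
  thus ?thesis using assms(2,3) C0 by simp
next
  case False
  hence ne: "0 < norm (x - y)" "x \<noteq> y" using assms(2) by auto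
  have "norm (K x y * of_real (\<phi> (x - y))) \<le> C / norm (x - y) ^ CARD('n) * 1"
    unfolding norm_mult using False assms(2) trunc_props(2)[OF assms(1), of "x - y"] C0
    by (intro mult_mono Ksize) auto
  also have "\<dots> \<le> C / r ^ CARD('n)"
    using False assms(2) C0 ne unfolding mult_1_right
    by (intro divide_left_mono power_mono mult_pos_pos zero_less_power) auto
  finally show ?thesis .
qed

lemma trunc_integrable:
  assumes f: "loc_integrable \<sigma> f" and \<phi>: "\<phi> \<in> insert (\<lambda>_. 0) \<Phi>"
  shows "integrable \<sigma> (\<lambda>y. K x y * of_real (\<phi> (x - y)) * f y)"
proof -
  obtain r R where r: "0 < r" "\<And>w. norm w \<le> r \<or> R \<le> norm w \<Longrightarrow> \<phi> w = 0"
    using trunc_props(3)[OF \<phi>] by blast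
  show ?thesis
  proof (rule bounded_kernel_integral[OF \<sigma> f])
    show "(\<lambda>y. K x y * of_real (\<phi> (x - y))) \<in> borel_measurable borel"
      using trunc_measurable[OF \<phi>, of x] by measurable
    show "norm (K x y * of_real (\<phi> (x - y))) \<le> C / r ^ CARD('n)" for y
      by (rule trunc_kernel_bound[OF \<phi> r(1)]) (use r in auto)
    show "bounded (ball x R)" by simp
    show "K x y * of_real (\<phi> (x - y)) = 0" if "y \<notin> ball x R" for y
      using that r(2)[of "x - y"] by (simp add: dist_norm)
  qed
qed

lemma trunc_le_T:
  assumes "\<phi> \<in> insert (\<lambda>_. 0) \<Phi>"
  shows "ennreal (norm (\<integral>y. K x y * of_real (\<phi> (x - y)) * f y \<partial>\<sigma>)) \<le> T f x"
  using assms by (auto simp: trunc_max_def intro: SUP_upper)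

text \<open>Between the two base points the integrands differ by a tail that the maximal function controls;
  near \<open>x\<close> there is no cancellation, and both are bounded by size alone.\<close>

lemma maximum_principle:
  assumes \<kappa>: "0 < \<kappa>"
  shows "\<exists>A\<ge>0. \<forall>f x z L S. loc_integrable \<sigma> f \<and> 0 < L \<and> norm (x - z) \<le> L \<and> S \<in> sets borel \<and>
      (\<forall>y\<in>S. \<kappa> * L \<le> norm (x - y)) \<and> - S \<subseteq> cball x L \<longrightarrow>
      T (\<lambda>y. indicator S y * f y) x \<le> T f z + ennreal A * M f x"
proof -
  \<comment> \<open>Weights of the dyadic annuli: d k for moving the kernel, a multiple of 2^-k for
    changing the cutoff, and at k = 0 the sizes of both kernels in the near zone.\<close>
  define a where "a k = d k + 2 ^ CARD('n) * C * B * (1 / 2) ^ k + (if k = 0 then C / \<kappa> ^ CARD('n) + C * B ^ CARD('n) else 0)" for k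
  have a0: "0 \<le> a k" for k using d0[of k] C0 B1 \<kappa> by (simp add: a_def)
  have sa: "summable a" unfolding a_def
    by (intro summable_add sd summable_mult summable_geometric) (auto intro: summable_finite[of "{0}"])
  let ?A = "4 ^ CARD('n) * suminf a"
  have main: "T (\<lambda>y. indicator S y * f y) x \<le> T f z + ennreal ?A * M f x"
    if f: "loc_integrable \<sigma> f" and L: "0 < L" and xz: "norm (x - z) \<le> L" and S: "S \<in> sets borel"
      and far: "\<And>y. y \<in> S \<Longrightarrow> \<kappa> * L \<le> norm (x - y)" and near: "- S \<subseteq> cball x L" for f x z L S
    unfolding trunc_max_def[of \<Phi> K \<sigma> "\<lambda>y. indicator S y * f y"]
  proof (rule SUP_least)
    fix \<phi> assume \<phi>: "\<phi> \<in> \<Phi>"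
    obtain \<phi>' where \<phi>': "\<phi>' \<in> insert (\<lambda>_. 0) \<Phi>" and v: "\<And>w. norm w \<le> L / B \<Longrightarrow> \<phi>' w = 0"
      and diff: "\<And>w w'. norm (w - w') \<le> L \<Longrightarrow> \<bar>\<phi> w - \<phi>' w'\<bar> * norm w \<le> B * L"
      using \<Phi> \<phi> L unfolding truncation_family_def by metis
    define h where "h y = K x y * of_real (\<phi> (x - y)) * indicator S y - K z y * of_real (\<phi>' (z - y))" for y
    let ?w = "\<lambda>y. \<Sum>k. ennreal (a k / (2 ^ k * L) ^ CARD('n)) * indicator (cball x (2 ^ Suc k * L)) y"
    have one_term: "ennreal (norm (h y)) \<le> ?w y"
      if "norm (h y) \<le> a k / (2 ^ k * L) ^ CARD('n)" "norm (x - y) \<le> 2 ^ Suc k * L" for y k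
    proof -
      have "ennreal (norm (h y)) \<le> ennreal (a k / (2 ^ k * L) ^ CARD('n)) * indicator (cball x (2 ^ Suc k * L)) y"
        using that by (simp add: dist_norm ennreal_leI)
      also have "\<dots> \<le> ?w y"
        by (rule term_le_suminf_ennreal)
      finally show ?thesis .
    qed
    have hw: "ennreal (norm (h y)) \<le> ?w y" for y
    proof (cases "norm (x - y) < 2 * L")
      case True
      \<comment> \<open>Near zone: points of S are at least \<kappa> L from x, and \<phi>' removes
        distances below L / B from z, so both kernels are of size L^-n.\<close>
      have "norm (K x y * of_real (\<phi> (x - y)) * indicator S y) \<le> C / (\<kappa> * L) ^ CARD('n)"
      proof (cases "y \<in> S")
        case yS: True
        hence xy: "\<kappa> * L \<le> norm (x - y)" by (rule far)
        hence ne: "x \<noteq> y" using \<kappa> L by (metis linorder_not_less mult_pos_pos norm_zero right_minus_eq)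
        have "norm (K x y * of_real (\<phi> (x - y))) \<le> C / norm (x - y) ^ CARD('n) * 1"
          unfolding norm_mult using trunc_props(2)[of \<phi> "x - y"] \<phi> C0
          by (intro mult_mono Ksize ne) auto
        also have "\<dots> \<le> C / (\<kappa> * L) ^ CARD('n)"
          using xy \<kappa> L C0 ne by (auto intro!: divide_left_mono power_mono mult_pos_pos)
        finally show ?thesis using yS by simp
      qed (use \<kappa> L C0 in simp)
      moreover have "norm (K z y * of_real (\<phi>' (z - y))) \<le> C / (L / B) ^ CARD('n)"
        by (rule trunc_kernel_bound[OF \<phi>' _ v]) (use L B1 in auto)
      ultimately have "norm (h y) \<le> C / (\<kappa> * L) ^ CARD('n) + C / (L / B) ^ CARD('n)"
        unfolding h_def by (intro order_trans[OF norm_triangle_ineq4] add_mono)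
      also have "\<dots> = (C / \<kappa> ^ CARD('n) + C * B ^ CARD('n)) / L ^ CARD('n)"
        using B1 L \<kappa> by (simp add: power_mult_distrib power_divide add_divide_distrib)
      also have "\<dots> \<le> a 0 / L ^ CARD('n)"
        using d0[of 0] C0 B1 L by (intro divide_right_mono) (auto simp: a_def)
      finally show ?thesis using True by (intro one_term[of _ 0]) auto
    next
      case False
      hence xyL: "2 * L \<le> norm (x - y)" by simp
      \<comment> \<open>The complement of S lies within L of x, so the indicator is one throughout
        the far zone.\<close>
      have yS: "y \<in> S" using near xyL L by (force simp: dist_norm)
      have ne: "x \<noteq> y" using xyL L by auto
      obtain k where k: "2 ^ k \<le> norm (x - y) / L" "norm (x - y) / L < 2 ^ Suc k"
        by (rule dyadic_scale[of "norm (x - y) / L"]) (use xyL L in \<open>auto simp: field_simps\<close>)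
      have k1: "1 \<le> k"
      proof (rule ccontr)
        assume "\<not> 1 \<le> k"
        hence "k = 0" by simp
        thus False using k(2) xyL L by (simp add: pos_divide_less_eq)
      qed
      have kL: "2 ^ k * L \<le> norm (x - y)" "norm (x - y) < 2 ^ Suc k * L"
        using k L by (auto simp: pos_divide_less_eq pos_le_divide_eq)
      have kL0: "0 < 2 ^ k * L" using L by simp
      have zy: "norm (x - y) / 2 \<le> norm (z - y)"
        using norm_triangle_ineq[of "x - z" "z - y"] xz xyL by simp
      hence zne: "z \<noteq> y" using ne by auto
      have "norm (x - z) * 2 ^ k \<le> norm (x - y)"
        by (rule order_trans[OF mult_right_mono[OF xz]]) (use kL(1) in \<open>simp_all add: mult.commute\<close>)
      hence 1: "norm (K x y - K z y) \<le> d k / norm (x - y) ^ CARD('n)" by (rule Ksmooth[OF k1 ne])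
      also have "\<dots> \<le> d k / (2 ^ k * L) ^ CARD('n)"
        using kL kL0 d0 ne by (auto intro!: divide_left_mono power_mono mult_pos_pos)
      finally have 1: "norm (K x y - K z y) \<le> d k / (2 ^ k * L) ^ CARD('n)" .
      have "norm (K z y) \<le> C / norm (z - y) ^ CARD('n)" by (rule Ksize[OF zne])
      also have "\<dots> \<le> C / (2 ^ k * L / 2) ^ CARD('n)"
        using kL kL0 zy zne C0 by (intro divide_left_mono power_mono mult_pos_pos) auto
      also have "\<dots> = 2 ^ CARD('n) * C / (2 ^ k * L) ^ CARD('n)" by (simp add: power_divide)
      finally have 2: "norm (K z y) \<le> 2 ^ CARD('n) * C / (2 ^ k * L) ^ CARD('n)" .
      have "\<bar>\<phi> (x - y) - \<phi>' (z - y)\<bar> * norm (x - y) \<le> B * L"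
        by (rule diff) (use xz in simp)
      hence "\<bar>\<phi> (x - y) - \<phi>' (z - y)\<bar> \<le> B * L / norm (x - y)"
        using ne by (simp add: pos_le_divide_eq)
      also have "\<dots> \<le> B * L / (2 ^ k * L)"
        using kL kL0 B1 L ne by (intro divide_left_mono) auto
      also have "\<dots> = B * (1 / 2) ^ k" using L by (simp add: power_divide)
      finally have 3: "\<bar>\<phi> (x - y) - \<phi>' (z - y)\<bar> \<le> B * (1 / 2) ^ k" .
      \<comment> \<open>First the kernel moves while the cutoff stays at x, then the cutoff changes
        while the kernel stays at z.\<close>
      have "h y = (K x y - K z y) * of_real (\<phi> (x - y)) + K z y * of_real (\<phi> (x - y) - \<phi>' (z - y))"
        using yS by (simp add: h_def algebra_simps)
      hence "norm (h y) \<le> norm (K x y - K z y) * \<bar>\<phi> (x - y)\<bar> + norm (K z y) * \<bar>\<phi> (x - y) - \<phi>' (z - y)\<bar>"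
        by (metis norm_mult norm_of_real norm_triangle_ineq)
      also have "\<dots> \<le> d k / (2 ^ k * L) ^ CARD('n) * 1 + 2 ^ CARD('n) * C / (2 ^ k * L) ^ CARD('n) * (B * (1 / 2) ^ k)"
        using trunc_props(2)[of \<phi> "x - y"] \<phi> d0 C0 kL0 by (intro add_mono mult_mono 1 2 3) auto
      also have "\<dots> = a k / (2 ^ k * L) ^ CARD('n)"
        using k1 by (simp add: a_def add_divide_distrib)
      finally show ?thesis using kL by (intro one_term[of _ k]) auto
    qed
    note fS = loc_integrable_indicator[OF f S]
    have i1: "integrable \<sigma> (\<lambda>y. K x y * of_real (\<phi> (x - y)) * (indicator S y * f y))"
      by (rule trunc_integrable[OF fS]) (use \<phi> in simp)
    note i2 = trunc_integrable[OF f \<phi>', of z]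
    have "(\<integral>y. K x y * of_real (\<phi> (x - y)) * (indicator S y * f y) \<partial>\<sigma>)
        = (\<integral>y. K z y * of_real (\<phi>' (z - y)) * f y \<partial>\<sigma>) + (\<integral>y. h y * f y \<partial>\<sigma>)"
    proof -
      have "(\<integral>y. h y * f y \<partial>\<sigma>) = (\<integral>y. K x y * of_real (\<phi> (x - y)) * (indicator S y * f y)
          - K z y * of_real (\<phi>' (z - y)) * f y \<partial>\<sigma>)"
        by (rule Bochner_Integration.integral_cong) (simp_all only: h_def left_diff_distrib mult.assoc)
      thus ?thesis by (simp only: Bochner_Integration.integral_diff[OF i1 i2]) simp
    qed
    hence "ennreal (norm (\<integral>y. K x y * of_real (\<phi> (x - y)) * (indicator S y * f y) \<partial>\<sigma>))
       \<le> ennreal (norm (\<integral>y. K z y * of_real (\<phi>' (z - y)) * f y \<partial>\<sigma>)) + ennreal (norm (\<integral>y. h y * f y \<partial>\<sigma>))"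
      by (simp only: ennreal_plus[OF norm_ge_zero norm_ge_zero, symmetric] ennreal_leI norm_triangle_ineq)
    also have "\<dots> \<le> T f z + ennreal ?A * M f x"
    proof (rule add_mono[OF trunc_le_T[OF \<phi>']])
      have "ennreal (norm (\<integral>y. h y * f y \<partial>\<sigma>)) \<le> (\<integral>\<^sup>+y. ennreal (norm (h y * f y)) \<partial>\<sigma>)"
        by (rule norm_integral_le_nn_integral)
      also have "\<dots> \<le> (\<integral>\<^sup>+y. ?w y * ennreal (norm (f y)) \<partial>\<sigma>)"
        by (rule nn_integral_mono) (simp only: norm_mult ennreal_mult norm_ge_zero mult_right_mono hw zero_le)
      also have "\<dots> \<le> ennreal ?A * M f x"
        by (rule maximal_tail_bound[OF \<sigma> _ L a0 sa]) (use f in \<open>simp add: loc_integrable_def\<close>)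
      finally show "ennreal (norm (\<integral>y. h y * f y \<partial>\<sigma>)) \<le> ennreal ?A * M f x" .
    qed
    finally show "ennreal (norm (\<integral>y. K x y * of_real (\<phi> (x - y)) * (indicator S y * f y) \<partial>\<sigma>))
       \<le> T f z + ennreal ?A * M f x" .
  qed
  show ?thesis
    by (rule exI[of _ ?A], intro conjI allI impI, use suminf_nonneg[OF sa a0] in simp, rule main) auto
qed

text \<open>Near the diagonal the cutoff makes the product locally zero. Away from it, d k tends to
  0, and the smoothness condition becomes continuity in the first variable.\<close>

lemma trunc_kernel_continuous:
  assumes \<phi>: "\<phi> \<in> insert (\<lambda>_. 0) \<Phi>"
  shows "continuous (at x) (\<lambda>x. K x y * of_real (\<phi> (x - y)))"
proof -
  obtain r R where r: "0 < r" "\<And>w. norm w \<le> r \<or> R \<le> norm w \<Longrightarrow> \<phi> w = 0"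
    using trunc_props(3)[OF \<phi>] by blast
  show ?thesis
  proof (cases "norm (x - y) < r")
    case True
    have "eventually (\<lambda>x. x \<in> ball y r) (nhds x)"
      by (rule eventually_nhds_in_open) (use True in \<open>auto simp: dist_norm norm_minus_commute\<close>)
    hence ev: "eventually (\<lambda>x. K x y * of_real (\<phi> (x - y)) = 0) (nhds x)"
      by eventually_elim (use r(2) in \<open>auto simp: dist_norm norm_minus_commute\<close>)
    show ?thesis by (subst isCont_cong[OF ev]) simp
  next
    case False
    hence ne: "x \<noteq> y" using r by auto
    have "((\<lambda>x'. K x y - K x' y) \<longlongrightarrow> 0) (at x)"
    proof (rule tendstoI)
      fix e :: real assume e: "0 < e"
      have "(\<lambda>k. d k / norm (x - y) ^ CARD('n)) \<longlonglongrightarrow> 0 / norm (x - y) ^ CARD('n)"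
        by (intro tendsto_divide summable_LIMSEQ_zero[OF sd] tendsto_const) (use ne in auto)
      hence "eventually (\<lambda>k. d k / norm (x - y) ^ CARD('n) < e) sequentially"
        using e by (intro order_tendstoD(2)) auto
      hence "eventually (\<lambda>k. d k / norm (x - y) ^ CARD('n) < e \<and> 1 \<le> k) sequentially"
        using eventually_ge_at_top[of 1] by eventually_elim auto
      then obtain k where k: "d k / norm (x - y) ^ CARD('n) < e" "1 \<le> k"
        by (metis (mono_tags, lifting) eventually_happens trivial_limit_sequentially)
      have "eventually (\<lambda>x'. x' \<in> ball x (norm (x - y) / 2 ^ k)) (at x)"
        by (intro eventually_at_in_open') (use ne in auto)
      thus "eventually (\<lambda>x'. dist (K x y - K x' y) 0 < e) (at x)"
      proof eventually_elim
        case (elim x')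
        hence "norm (x - x') * 2 ^ k \<le> norm (x - y)" by (simp add: dist_norm pos_less_divide_eq)
        from Ksmooth[OF k(2) ne this] k(1) show ?case by simp
      qed
    qed
    hence "((\<lambda>x'. K x y - (K x y - K x' y)) \<longlongrightarrow> K x y - 0) (at x)" by (intro tendsto_diff tendsto_const)
    hence "isCont (\<lambda>x. K x y) x" by (simp add: isCont_def)
    moreover have "continuous_on UNIV (\<lambda>x. complex_of_real (\<phi> (x - y)))"
      by (intro continuous_on_of_real continuous_on_compose2[OF trunc_props(1)[OF \<phi>]] continuous_intros) auto
    ultimately show ?thesis by (intro continuous_mult) (auto simp: continuous_on_eq_continuous_at)
  qed
qed

text \<open>Dominated convergence: a convergent sequence of base points is bounded, so one ball
  contains the supports of all the truncated kernels, and one constant bounds them there.\<close>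

lemma trunc_integral_continuous:
  assumes f: "loc_integrable \<sigma> f" and \<phi>: "\<phi> \<in> insert (\<lambda>_. 0) \<Phi>"
  shows "continuous_on UNIV (\<lambda>x. \<integral>y. K x y * of_real (\<phi> (x - y)) * f y \<partial>\<sigma>)"
proof (rule continuous_at_imp_continuous_on, rule ballI, rule continuous_at_sequentiallyI)
  fix x :: "real ^ 'n" and u assume u: "u \<longlonglongrightarrow> x"
  obtain r R where r: "0 < r" "\<And>w. norm w \<le> r \<or> R \<le> norm w \<Longrightarrow> \<phi> w = 0"
    using trunc_props(3)[OF \<phi>] by blast
  obtain m where m: "\<And>i. norm (u i) \<le> m"
    using convergent_imp_Bseq[of u] u by (auto simp: convergent_def Bseq_def)
  have fm: "f \<in> borel_measurable \<sigma>" using f by (simp add: loc_integrable_def measurable_lf[OF \<sigma>])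
  show "(\<lambda>i. \<integral>y. K (u i) y * of_real (\<phi> (u i - y)) * f y \<partial>\<sigma>)
      \<longlonglongrightarrow> (\<integral>y. K x y * of_real (\<phi> (x - y)) * f y \<partial>\<sigma>)"
  proof (rule integral_dominated_convergence)
    show "(\<lambda>y. K x y * of_real (\<phi> (x - y)) * f y) \<in> borel_measurable \<sigma>"
      by (rule borel_measurable_integrable[OF trunc_integrable[OF f \<phi>]])
    show "(\<lambda>y. K (u i) y * of_real (\<phi> (u i - y)) * f y) \<in> borel_measurable \<sigma>" for i
      by (rule borel_measurable_integrable[OF trunc_integrable[OF f \<phi>]])
    show "integrable \<sigma> (\<lambda>y. norm (of_real (C / r ^ CARD('n)) * indicator (cball 0 (m + R)) y * f y))"
      by (intro integrable_norm bounded_kernel_integral[OF \<sigma> f, where M="C / r ^ CARD('n)" and A="cball 0 (m + R)"])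
        (use C0 r(1) in \<open>auto split: split_indicator simp: norm_divide norm_power\<close>)
    show "AE y in \<sigma>. (\<lambda>i. K (u i) y * of_real (\<phi> (u i - y)) * f y) \<longlonglongrightarrow> K x y * of_real (\<phi> (x - y)) * f y"
      using trunc_kernel_continuous[OF \<phi>] u
      by (intro AE_I2 tendsto_mult_right) (auto intro: isCont_tendsto_compose[where g="\<lambda>x. K x _ * of_real (\<phi> (x - _))"])
    show "AE y in \<sigma>. norm (K (u i) y * of_real (\<phi> (u i - y)) * f y)
        \<le> norm (of_real (C / r ^ CARD('n)) * indicator (cball 0 (m + R)) y * f y)" for i
    proof (rule AE_I2)
      fix y
      have "norm (K (u i) y * of_real (\<phi> (u i - y))) \<le> norm (complex_of_real (C / r ^ CARD('n)) * indicator (cball 0 (m + R)) y)"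
      proof (cases "norm y \<le> m + R")
        case True
        have "norm (K (u i) y * of_real (\<phi> (u i - y))) \<le> C / r ^ CARD('n)"
          by (rule trunc_kernel_bound[OF \<phi> r(1)]) (use r in auto)
        thus ?thesis using True C0 r(1) by (simp add: norm_divide norm_power)
      next
        case False
        have "norm y \<le> norm (u i) + norm (u i - y)" by (metis norm_minus_commute norm_triangle_sub)
        hence "\<phi> (u i - y) = 0" using False m[of i] by (intro r(2)) auto
        thus ?thesis by simp
      qed
      thus "norm (K (u i) y * of_real (\<phi> (u i - y)) * f y)
        \<le> norm (of_real (C / r ^ CARD('n)) * indicator (cball 0 (m + R)) y * f y)"
        by (simp only: norm_mult[of _ "f y"] mult_right_mono norm_ge_zero)
    qed
  qed
qed

text \<open>A supremum of continuous functions is lower semicontinuous. Openness, beyond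
  measurability, is what later makes the distance to the complement positive at every point of the
  set.\<close>

lemma open_T_superlevel:
  assumes "loc_integrable \<sigma> f"
  shows "open {x. t < T f x}"
proof -
  have "{x. t < T f x} = (\<Union>\<phi>\<in>\<Phi>. {x. t < ennreal (norm (\<integral>y. K x y * of_real (\<phi> (x - y)) * f y \<partial>\<sigma>))})"
    by (auto simp: trunc_max_def less_SUP_iff)
  also have "open \<dots>"
    by (intro open_UN ballI open_Collect_less continuous_on_const continuous_on_ennreal continuous_on_norm
        trunc_integral_continuous assms) auto
  finally show ?thesis .
qed

lemma T_measurable [measurable]:
  assumes "loc_integrable \<sigma> f"
  shows "T f \<in> borel_measurable borel"
  by (rule borel_measurableI_greater) (use open_T_superlevel[OF assms] in auto)

text \<open>For y in the support, |x - y| \<ge> |x| / 2. The first bound makes superlevel sets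
  bounded. The second holds because the ball of radius 2 |x| about x contains the support; it
  provides the finiteness that absorption requires.\<close>

lemma T_far:
  assumes f: "loc_integrable \<sigma> f" and \<rho>: "0 < \<rho>" and supp: "\<And>y. y \<notin> cball 0 \<rho> \<Longrightarrow> f y = 0"
    and x: "2 * \<rho> \<le> norm x"
  shows "T f x \<le> ennreal (2 ^ CARD('n) * C / norm x ^ CARD('n)) * abs_mass \<sigma> f (cball 0 \<rho>)"
    "T f x \<le> ennreal (8 ^ CARD('n) * C) * M f x"
proof -
  have x0: "0 < norm x" using x \<rho> by linarith
  show 1: "T f x \<le> ennreal (2 ^ CARD('n) * C / norm x ^ CARD('n)) * abs_mass \<sigma> f (cball 0 \<rho>)"
    unfolding trunc_max_def
  proof (rule SUP_least)
    fix \<phi> assume \<phi>: "\<phi> \<in> \<Phi>"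
    have "ennreal (norm (\<integral>y. K x y * of_real (\<phi> (x - y)) * f y \<partial>\<sigma>))
       \<le> (\<integral>\<^sup>+y. ennreal (norm (K x y * of_real (\<phi> (x - y)) * f y)) \<partial>\<sigma>)"
      by (rule norm_integral_le_nn_integral)
    also have "\<dots> \<le> (\<integral>\<^sup>+y. ennreal (2 ^ CARD('n) * C / norm x ^ CARD('n)) * (ennreal (norm (f y)) * indicator (cball 0 \<rho>) y) \<partial>\<sigma>)"
    proof (rule nn_integral_mono)
      fix y
      show "ennreal (norm (K x y * of_real (\<phi> (x - y)) * f y))
         \<le> ennreal (2 ^ CARD('n) * C / norm x ^ CARD('n)) * (ennreal (norm (f y)) * indicator (cball 0 \<rho>) y)"
      proof (cases "y \<in> cball 0 \<rho>")
        case True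
        have xy: "norm x / 2 \<le> norm (x - y)" using True x norm_triangle_sub[of x y] by simp
        hence ne: "x \<noteq> y" using x0 by auto
        have "norm (K x y * of_real (\<phi> (x - y))) \<le> C / norm (x - y) ^ CARD('n) * 1"
          unfolding norm_mult using trunc_props(2)[of \<phi> "x - y"] \<phi> C0 by (intro mult_mono Ksize ne) auto
        also have "\<dots> \<le> C / (norm x / 2) ^ CARD('n)"
          using xy x0 C0 ne by (auto intro!: divide_left_mono power_mono mult_pos_pos)
        also have "\<dots> = 2 ^ CARD('n) * C / norm x ^ CARD('n)" by (simp add: power_divide)
        finally have "norm (K x y * of_real (\<phi> (x - y)) * f y) \<le> 2 ^ CARD('n) * C / norm x ^ CARD('n) * norm (f y)"
          unfolding norm_mult[of _ "f y"] by (intro mult_right_mono) auto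
        hence "ennreal (norm (K x y * of_real (\<phi> (x - y)) * f y))
            \<le> ennreal (2 ^ CARD('n) * C / norm x ^ CARD('n)) * ennreal (norm (f y))"
          by (subst ennreal_mult[symmetric]) (use C0 in \<open>auto intro: ennreal_leI\<close>)
        thus ?thesis using True by simp
      qed (simp add: supp)
    qed
    also have "\<dots> = ennreal (2 ^ CARD('n) * C / norm x ^ CARD('n)) * abs_mass \<sigma> f (cball 0 \<rho>)"
      unfolding abs_mass_def
      by (rule nn_integral_cmult) (use f in \<open>auto simp: loc_integrable_def measurable_lf[OF \<sigma>]\<close>)
    finally show "ennreal (norm (\<integral>y. K x y * of_real (\<phi> (x - y)) * f y \<partial>\<sigma>))
       \<le> ennreal (2 ^ CARD('n) * C / norm x ^ CARD('n)) * abs_mass \<sigma> f (cball 0 \<rho>)" .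
  qed
  have "cball 0 \<rho> \<subseteq> cball x (2 * norm x)"
  proof
    fix y :: "real ^ 'n" assume "y \<in> cball 0 \<rho>"
    thus "y \<in> cball x (2 * norm x)" using x \<rho> norm_triangle_ineq4[of x y] by (simp add: dist_norm)
  qed
  hence "abs_mass \<sigma> f (cball 0 \<rho>) \<le> ennreal ((2 * (2 * norm x)) ^ CARD('n)) * M f x"
    using f x0 by (intro order_trans[OF abs_mass_mono abs_mass_cball_le_maximal[OF \<sigma>]])
      (auto simp: loc_integrable_def)
  hence "T f x \<le> ennreal (2 ^ CARD('n) * C / norm x ^ CARD('n)) * (ennreal ((2 * (2 * norm x)) ^ CARD('n)) * M f x)"
    using 1 by (meson mult_left_mono order_trans zero_le)
  also have "\<dots> = ennreal (2 ^ CARD('n) * C / norm x ^ CARD('n) * (2 * (2 * norm x)) ^ CARD('n)) * M f x"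
    unfolding mult.assoc[symmetric] by (subst ennreal_mult[symmetric]) (use C0 in auto)
  also have "2 ^ CARD('n) * C / norm x ^ CARD('n) * (2 * (2 * norm x)) ^ CARD('n) = 8 ^ CARD('n) * C"
  proof -
    have "(2 * (2 * norm x)) ^ CARD('n) = 4 ^ CARD('n) * norm x ^ CARD('n)"
      by (subst power_mult_distrib[symmetric]) simp
    moreover have "(8::real) ^ CARD('n) = 2 ^ CARD('n) * 4 ^ CARD('n)"
      by (subst power_mult_distrib[symmetric]) simp
    ultimately show ?thesis using x0 by simp
  qed
  finally show "T f x \<le> ennreal (8 ^ CARD('n) * C) * M f x" .
qed

end

section \<open>Semicontinuity of the maximal function\<close>

lemma ennreal_less_divide_iff:
  assumes "0 \<le> t" "0 < c"
  shows "ennreal t < m / ennreal c \<longleftrightarrow> ennreal (t * c) < m"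
proof (cases m)
  case (real r)
  thus ?thesis using assms by (simp add: divide_ennreal ennreal_less_iff pos_less_divide_eq)
next
  case top
  thus ?thesis using assms by (simp add: ennreal_top_divide)
qed

lemma less_maximal_op_iff:
  fixes x :: "real ^ 'n"
  assumes \<sigma>: "locally_finite_borel \<sigma>" and f: "f \<in> borel_measurable borel" and t: "0 \<le> t"
  shows "ennreal t < maximal_op \<sigma> f x \<longleftrightarrow> (\<exists>a l. 0 < l \<and> x \<in> cbox a (\<chi> i. a $ i + l) \<and>
    ennreal (t * l ^ CARD('n)) < abs_mass \<sigma> f (cbox a (\<chi> i. a $ i + l)))"
proof -
  have "ennreal t < abs_mass \<sigma> f (cbox a (\<chi> i. a $ i + l)) / emeasure lborel (cbox a (\<chi> i. a $ i + l))
      \<longleftrightarrow> ennreal (t * l ^ CARD('n)) < abs_mass \<sigma> f (cbox a (\<chi> i. a $ i + l))" if "0 < l" for l and a :: "real ^ 'n"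
    using that by (simp only: lborel_cube less_imp_le ennreal_less_divide_iff[OF t zero_less_power])
  thus ?thesis
    by (auto simp: maximal_op_alt[OF \<sigma> f] less_SUP_iff cubes_def)
qed

text \<open>The inequality for the cube is strict, so it survives a slight dilation, and the dilated
  cube contains a neighbourhood of x. The bound m on the side serves a later Vitali covering, which
  asks for bounded radii.\<close>

lemma open_cube_average_superlevel:
  fixes \<sigma> :: "(real ^ 'n) measure"
  shows "open {x. \<exists>a l. 0 < l \<and> l < m \<and> x \<in> cbox a (\<chi> i. a $ i + l) \<and>
    ennreal (t * l ^ CARD('n)) < abs_mass \<sigma> f (cbox a (\<chi> i. a $ i + l))}" (is "open ?U")
  unfolding open_contains_ball
proof
  fix x assume "x \<in> ?U"
  then obtain a l where l: "0 < l" "l < m" and x: "x \<in> cbox a (\<chi> i. a $ i + l)"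
    and t: "ennreal (t * l ^ CARD('n)) < abs_mass \<sigma> f (cbox a (\<chi> i. a $ i + l))" by blast
  have "((\<lambda>h. ennreal (t * (l + 2 * h) ^ CARD('n))) \<longlongrightarrow> ennreal (t * (l + 2 * 0) ^ CARD('n))) (at_right 0)"
    by (intro tendsto_intros tendsto_ennrealI)
  hence "\<forall>\<^sub>F h in at_right 0. ennreal (t * (l + 2 * h) ^ CARD('n)) < abs_mass \<sigma> f (cbox a (\<chi> i. a $ i + l))"
    using t by (intro order_tendstoD(2)) auto
  moreover have "\<forall>\<^sub>F h in at_right (0::real). h \<in> {0<..<(m - l) / 2}"
    using l by (intro eventually_at_right_real) auto
  ultimately have "\<forall>\<^sub>F h in at_right (0::real). 0 < h \<and> l + 2 * h < m \<and>
      ennreal (t * (l + 2 * h) ^ CARD('n)) < abs_mass \<sigma> f (cbox a (\<chi> i. a $ i + l))"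
    by eventually_elim auto
  then obtain h where h: "0 < h" "l + 2 * h < m"
    "ennreal (t * (l + 2 * h) ^ CARD('n)) < abs_mass \<sigma> f (cbox a (\<chi> i. a $ i + l))"
    using eventually_happens[of _ "at_right (0::real)"] by (auto simp: trivial_limit_at_right_real)
  define a' where "a' = (\<chi> i. a $ i - h)"
  let ?Q = "cbox a' (\<chi> i. a' $ i + (l + 2 * h))"
  have sub: "cbox a (\<chi> i. a $ i + l) \<subseteq> ?Q"
    using h(1) by (auto simp: mem_box_cart a'_def) (smt (verit))+
  have "ball x h \<subseteq> ?Q"
  proof
    fix y assume "y \<in> ball x h"
    hence "\<bar>(x - y) $ i\<bar> < h" for i using component_le_norm_cart[of "x - y" i] by (simp add: dist_norm)
    hence "a $ i - h \<le> y $ i \<and> y $ i \<le> a $ i - h + (l + 2 * h)" for i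
      using x[unfolded mem_box_cart, rule_format, of i] by (simp add: abs_less_iff) (smt (verit))
    thus "y \<in> ?Q" by (simp add: mem_box_cart a'_def)
  qed
  moreover have "ennreal (t * (l + 2 * h) ^ CARD('n)) < abs_mass \<sigma> f ?Q"
    using h(3) abs_mass_mono[OF sub] by (rule less_le_trans)
  ultimately have "ball x h \<subseteq> ?U" using h l by (auto intro!: exI[of _ a'] exI[of _ "l + 2 * h"])
  thus "\<exists>e>0. ball x e \<subseteq> ?U" using h(1) by blast
qed

lemma open_maximal_superlevel:
  fixes \<sigma> :: "(real ^ 'n) measure"
  assumes \<sigma>: "locally_finite_borel \<sigma>" and f: "f \<in> borel_measurable borel" and t: "0 \<le> t"
  shows "open {x. ennreal t < maximal_op \<sigma> f x}"
proof -
  have "{x. ennreal t < maximal_op \<sigma> f x} = (\<Union>m. {x. \<exists>a l. 0 < l \<and> l < m \<and> x \<in> cbox a (\<chi> i. a $ i + l) \<and>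
    ennreal (t * l ^ CARD('n)) < abs_mass \<sigma> f (cbox a (\<chi> i. a $ i + l))})"
    unfolding less_maximal_op_iff[OF assms] using gt_ex by (auto; blast)
  thus ?thesis by (simp only:) (intro open_UN ballI open_cube_average_superlevel)
qed

lemma maximal_op_measurable [measurable]:
  assumes "locally_finite_borel \<sigma>" "f \<in> borel_measurable borel"
  shows "maximal_op \<sigma> f \<in> borel_measurable borel"
proof (rule borel_measurableI_greater)
  fix y :: ennreal
  show "{x \<in> space borel. y < maximal_op \<sigma> f x} \<in> sets borel"
  proof (cases y)
    case (real r)
    thus ?thesis using open_maximal_superlevel[OF assms, of r] by simp
  qed simp
qed

subsection \<open>Weak type bounds and testing\<close>

text \<open>The weak type inequality raised to the power p: linear in the measure of the superlevel
  set, and free of roots of possibly infinite values.\<close>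

definition weak_bound :: "real \<Rightarrow> (real ^ 'n) measure \<Rightarrow> (real ^ 'n) measure \<Rightarrow>
   ((real ^ 'n \<Rightarrow> complex) \<Rightarrow> real ^ 'n \<Rightarrow> ennreal) \<Rightarrow> real \<Rightarrow> bool" where
  "weak_bound p \<sigma> \<omega> S D \<longleftrightarrow> 0 \<le> D \<and> (\<forall>f\<in>Lp_fun p \<sigma>. \<forall>t>0. ennreal (t powr p) * emeasure \<omega> {x. ennreal t < S f x}
      \<le> ennreal (D * (\<integral>x. norm (f x) powr p \<partial>\<sigma>)))"

lemma testing_condition_mono:
  assumes "testing_condition p p' \<sigma> \<omega> S C" "C \<le> C'"
  shows "testing_condition p p' \<sigma> \<omega> S C'"
  unfolding testing_condition_def
proof (intro ballI)
  fix Q :: "(real ^ 'a) set" and f :: "real ^ 'a \<Rightarrow> complex" assume "Q \<in> cubes" "f \<in> Lp_fun p \<sigma>"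
  hence "(\<integral>\<^sup>+x\<in>Q. S (\<lambda>y. indicator Q y * f y) x \<partial>\<omega>)
      \<le> ennreal (C * (LINT x:Q|\<sigma>. norm (f x) powr p) powr (1 / p) * measure \<omega> Q powr (1 / p'))"
    using assms(1) by (auto simp: testing_condition_def)
  also have "\<dots> \<le> ennreal (C' * (LINT x:Q|\<sigma>. norm (f x) powr p) powr (1 / p) * measure \<omega> Q powr (1 / p'))"
    using assms(2) by (intro ennreal_leI mult_right_mono) auto
  finally show "(\<integral>\<^sup>+x\<in>Q. S (\<lambda>y. indicator Q y * f y) x \<partial>\<omega>)
      \<le> ennreal (C' * (LINT x:Q|\<sigma>. norm (f x) powr p) powr (1 / p) * measure \<omega> Q powr (1 / p'))" .
qed

lemma weak_Lp_norm_le_iff: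
  assumes p: "0 < p" and A: "0 \<le> A"
  shows "weak_Lp_norm p \<omega> h \<le> ennreal A \<longleftrightarrow>
    (\<forall>t>0. ennreal (t powr p) * emeasure \<omega> {x. ennreal t < h x} \<le> ennreal (A powr p))"
proof -
  have "ennreal t * ennreal_powr e (1 / p) \<le> ennreal A \<longleftrightarrow> ennreal (t powr p) * e \<le> ennreal (A powr p)"
    if t: "0 < t" for t e
  proof (cases e)
    case (real r)
    have "t * r powr (1 / p) \<le> A \<longleftrightarrow> (t * r powr (1 / p)) powr p \<le> A powr p"
      using p t A real by (metis less_eq_real_def mult_nonneg_nonneg powr_ge_zero powr_less_mono2 powr_mono2 linorder_not_le)
    also have "(t * r powr (1 / p)) powr p = t powr p * r"
      using t real p by (simp add: powr_mult powr_powr)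
    finally show ?thesis using real A t by (simp add: ennreal_powr_def ennreal_mult[symmetric])
  next
    case top
    thus ?thesis using t A p by (simp add: ennreal_powr_def ennreal_mult_top neq_top_trans top_unique)
  qed
  thus ?thesis by (auto simp: weak_Lp_norm_def SUP_le_iff)
qed

lemma weak_type_iff_weak_bound:
  assumes p: "0 < p"
  shows "(\<exists>C. weak_type p \<sigma> \<omega> S C) \<longleftrightarrow> (\<exists>D. weak_bound p \<sigma> \<omega> S D)"
proof
  have eq: "(C * Lp_norm p \<sigma> f) powr p = C powr p * (\<integral>x. norm (f x) powr p \<partial>\<sigma>)" if "0 \<le> C" for C and f :: "real^'a \<Rightarrow> complex"
  proof -
    have "0 \<le> (\<integral>x. norm (f x) powr p \<partial>\<sigma>)" by (rule Bochner_Integration.integral_nonneg) simp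
    thus ?thesis using that p by (simp add: Lp_norm_def powr_mult powr_powr)
  qed
  {
    assume "\<exists>C. weak_type p \<sigma> \<omega> S C"
    then obtain C where C: "weak_type p \<sigma> \<omega> S C" by blast
    have "weak_Lp_norm p \<omega> (S f) \<le> ennreal (\<bar>C\<bar> * Lp_norm p \<sigma> f)" if "f \<in> Lp_fun p \<sigma>" for f
    proof -
      have "weak_Lp_norm p \<omega> (S f) \<le> ennreal (C * Lp_norm p \<sigma> f)" using C that by (simp add: weak_type_def)
      also have "\<dots> \<le> ennreal (\<bar>C\<bar> * Lp_norm p \<sigma> f)"
        by (intro ennreal_leI mult_right_mono) (auto simp: Lp_norm_def)
      finally show ?thesis .
    qed
    hence "weak_bound p \<sigma> \<omega> S (\<bar>C\<bar> powr p)"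
      unfolding weak_bound_def
      by (subst (asm) weak_Lp_norm_le_iff[OF p]) (auto simp flip: eq simp: Lp_norm_def[of p \<sigma>])
    thus "\<exists>D. weak_bound p \<sigma> \<omega> S D" ..
  }
  {
    assume "\<exists>D. weak_bound p \<sigma> \<omega> S D"
    then obtain D where D: "weak_bound p \<sigma> \<omega> S D" by blast
    hence "0 \<le> D" by (simp add: weak_bound_def)
    hence "(D powr (1 / p)) powr p = D" using p by (simp add: powr_powr)
    hence "weak_type p \<sigma> \<omega> S (D powr (1 / p))"
      unfolding weak_type_def
      using D
    proof (intro ballI, subst weak_Lp_norm_le_iff[OF p])
      fix f :: "real ^ 'a \<Rightarrow> complex" assume "f \<in> Lp_fun p \<sigma>"
      thus "\<forall>t>0. ennreal (t powr p) * emeasure \<omega> {x. ennreal t < S f x} \<le> ennreal ((D powr (1 / p) * Lp_norm p \<sigma> f) powr p)"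
        using D \<open>(D powr (1 / p)) powr p = D\<close> by (simp only: eq powr_ge_zero weak_bound_def) simp
    qed (simp add: Lp_norm_def)
    thus "\<exists>C. weak_type p \<sigma> \<omega> S C" ..
  }
qed

text \<open>Kolmogorov's inequality: h is at most s plus the sum over k of 2^(k+1) s on the set
  where h > 2^k s, and the weak type bound turns the sum into a geometric series of ratio 2^(1 - p)
  < 1.\<close>

lemma layer_cake_bound:
  fixes h :: "'a \<Rightarrow> ennreal"
  assumes p: "1 < p" and h: "h \<in> borel_measurable M" and Q: "Q \<in> sets M" and s: "0 < s" and a: "0 \<le> a"
    and w: "\<And>t. 0 < t \<Longrightarrow> ennreal (t powr p) * emeasure M {x \<in> space M. ennreal t < h x} \<le> ennreal a"
  shows "(\<integral>\<^sup>+x\<in>Q. h x \<partial>M) \<le> ennreal s * emeasure M Q + ennreal (2 / (1 - 2 powr (1 - p)) * s powr (1 - p) * a)"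
proof -
  let ?g = "\<lambda>k x. ennreal (2 ^ Suc k * s) * indicator {x \<in> space M. ennreal (2 ^ k * s) < h x} x"
  have le: "h x \<le> ennreal s + (\<Sum>k. ?g k x)" if x: "x \<in> space M" for x
  \<comment> \<open>The value h x may be infinite, so it is approached by finite numbers r below
    it.\<close>
  proof (rule dense_le)
    fix r assume r: "r < h x"
    then obtain r' where r': "r = ennreal r'" "0 \<le> r'" by (cases r) auto
    show "r \<le> ennreal s + (\<Sum>k. ?g k x)"
    proof (cases "r' \<le> s")
      case True
      have "r \<le> ennreal s" unfolding r'(1) by (rule ennreal_leI[OF True])
      thus ?thesis by (rule order_trans) simp
    next
      case False
      obtain k where k: "2 ^ k \<le> r' / s" "r' / s < 2 ^ Suc k"
        by (rule dyadic_scale[of "r' / s"]) (use False s in \<open>auto simp: field_simps\<close>)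
      have "ennreal (2 ^ k * s) \<le> r" using k(1) s r' by (auto intro: ennreal_leI simp: field_simps)
      hence "ennreal (2 ^ k * s) < h x" using r by simp
      hence "ennreal (2 ^ Suc k * s) = ?g k x" using x by simp
      also have "\<dots> \<le> (\<Sum>k. ?g k x)" by (rule term_le_suminf_ennreal)
      finally have "ennreal (2 ^ Suc k * s) \<le> (\<Sum>k. ?g k x)" .
      moreover have "r \<le> ennreal (2 ^ Suc k * s)" using k(2) s r' by (auto intro!: ennreal_leI simp: field_simps)
      ultimately show ?thesis by (meson add_increasing order_trans zero_le)
    qed
  qed
  define q where "q = 2 powr (1 - p)"
  have q: "0 < q" "q < 1" using p by (auto simp: q_def powr_less_one)
  have one_term: "ennreal (2 ^ Suc k * s) * emeasure M {x \<in> space M. ennreal (2 ^ k * s) < h x}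
      \<le> ennreal (2 * s powr (1 - p) * a * q ^ k)" for k
  proof -
    define t where "t = 2 ^ k * s"
    have t: "0 < t" using s by (simp add: t_def)
    have tp: "2 * t = 2 * t powr (1 - p) * t powr p" using t by (simp add: powr_add[symmetric])
    have "t powr (1 - p) = s powr (1 - p) * q ^ k"
      using s by (simp add: t_def powr_mult q_def powr_realpow[symmetric] powr_powr mult.commute)
    moreover have "ennreal (2 * t) * emeasure M {x \<in> space M. ennreal t < h x}
       = ennreal (2 * t powr (1 - p)) * (ennreal (t powr p) * emeasure M {x \<in> space M. ennreal t < h x})"
      by (subst tp, subst ennreal_mult) (auto simp: mult.assoc)
    moreover have "\<dots> \<le> ennreal (2 * t powr (1 - p)) * ennreal a"
      by (intro mult_left_mono w t) auto
    moreover have "\<dots> = ennreal (2 * t powr (1 - p) * a)" using a by (simp add: ennreal_mult)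
    ultimately show ?thesis by (simp add: t_def mult_ac)
  qed
  have hm: "{x \<in> space M. ennreal t < h x} \<in> sets M" for t using h by measurable
  have "(\<integral>\<^sup>+x\<in>Q. h x \<partial>M) \<le> (\<integral>\<^sup>+x. ennreal s * indicator Q x + (\<Sum>k. ?g k x) \<partial>M)"
    using le by (intro nn_integral_mono) (auto split: split_indicator)
  also have "\<dots> = ennreal s * emeasure M Q + (\<integral>\<^sup>+x. (\<Sum>k. ?g k x) \<partial>M)"
    using hm Q by (subst nn_integral_add) (auto simp: nn_integral_cmult_indicator)
  also have "(\<integral>\<^sup>+x. (\<Sum>k. ?g k x) \<partial>M) = (\<Sum>k. ennreal (2 ^ Suc k * s) * emeasure M {x \<in> space M. ennreal (2 ^ k * s) < h x})"
    using hm by (subst nn_integral_suminf) (auto simp: nn_integral_cmult_indicator)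
  also have "\<dots> \<le> (\<Sum>k. ennreal (2 * s powr (1 - p) * a * q ^ k))"
    by (intro suminf_le summableI one_term)
  also have "\<dots> = ennreal (\<Sum>k. 2 * s powr (1 - p) * a * q ^ k)"
    using q a by (intro suminf_ennreal2 summable_mult summable_geometric) auto
  also have "(\<Sum>k. 2 * s powr (1 - p) * a * q ^ k) = 2 / (1 - q) * s powr (1 - p) * a"
    using q by (subst suminf_mult) (auto simp: suminf_geometric summable_geometric)
  finally show ?thesis by (simp add: q_def add_left_mono)
qed

lemma Lp_fun_indicator:
  assumes "f \<in> Lp_fun p \<sigma>" "S \<in> sets \<sigma>"
  shows "(\<lambda>y. indicator S y * f y) \<in> Lp_fun p \<sigma>"
    "(\<integral>x. norm (indicator S x * f x) powr p \<partial>\<sigma>) = (LINT x:S|\<sigma>. norm (f x) powr p)"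
proof -
  have eq: "norm (indicator S x * f x) powr p = indicator S x *\<^sub>R (norm (f x) powr p)" for x
    by (auto split: split_indicator)
  show "(\<lambda>y. indicator S y * f y) \<in> Lp_fun p \<sigma>"
    using assms integrable_mult_indicator[of S \<sigma> "\<lambda>x. norm (f x) powr p"]
    by (simp add: Lp_fun_def eq borel_measurable_times)
  show "(\<integral>x. norm (indicator S x * f x) powr p \<partial>\<sigma>) = (LINT x:S|\<sigma>. norm (f x) powr p)"
    by (simp only: eq set_lebesgue_integral_def)
qed

lemma cubes_borel: "Q \<in> cubes \<Longrightarrow> Q \<in> sets borel" and cubes_compact: "Q \<in> cubes \<Longrightarrow> compact Q"
  by (auto simp: cubes_def)

text \<open>Splitting the integral over Q at a level s costs s \<omega>(Q) plus a multiple of s^(1 -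
  p) D I, where I is the integral of |f|^p over Q. The level that balances the two terms produces
  the exponents 1 / p and 1 / p'.\<close>

lemma weak_bound_imp_testing:
  fixes \<sigma> \<omega> :: "(real ^ 'n) measure"
  assumes \<omega>: "locally_finite_borel \<omega>" and \<sigma>: "locally_finite_borel \<sigma>" and p: "1 < p" "1 / p + 1 / p' = 1"
    and S: "\<And>f. f \<in> Lp_fun p \<sigma> \<Longrightarrow> S f \<in> borel_measurable borel" and D: "weak_bound p \<sigma> \<omega> S D"
  shows "\<exists>C. testing_condition p p' \<sigma> \<omega> S C"
proof -
  define c where "c = 2 / (1 - 2 powr (1 - p))"
  have c: "0 \<le> c" using p powr_less_one[of 2 "1 - p"] by (auto simp: c_def)
  have D0: "0 \<le> D" using D by (simp add: weak_bound_def)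
  have p': "1 / p' = 1 - 1 / p" using p(2) by simp
  have "testing_condition p p' \<sigma> \<omega> S ((1 + c) * D powr (1 / p))"
    unfolding testing_condition_def
  proof (intro ballI)
    fix Q :: "(real ^ 'n) set" and f :: "real ^ 'n \<Rightarrow> complex" assume Q: "Q \<in> cubes" and f: "f \<in> Lp_fun p \<sigma>"
    define I where "I = (LINT x:Q|\<sigma>. norm (f x) powr p)"
    define m where "m = measure \<omega> Q"
    let ?h = "S (\<lambda>y. indicator Q y * f y)"
    have "Q \<in> sets \<sigma>" using cubes_borel[OF Q] by (simp add: sets_lf[OF \<sigma>])
    note fQ = Lp_fun_indicator[OF f this]
    have I0: "0 \<le> I" unfolding I_def set_lebesgue_integral_def by (rule Bochner_Integration.integral_nonneg) auto
    have m: "emeasure \<omega> Q = ennreal m" unfolding m_def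
      using emeasure_bounded_lf[OF \<omega>, of Q] cubes_compact[OF Q]
      by (intro emeasure_eq_ennreal_measure) (auto dest: compact_imp_bounded)
    have m0: "0 \<le> m" by (simp add: m_def)
    have lc: "(\<integral>\<^sup>+x\<in>Q. ?h x \<partial>\<omega>) \<le> ennreal (s * m + c * s powr (1 - p) * (D * I))" if s: "0 < s" for s
    proof -
      have "(\<integral>\<^sup>+x\<in>Q. ?h x \<partial>\<omega>) \<le> ennreal s * emeasure \<omega> Q + ennreal (2 / (1 - 2 powr (1 - p)) * s powr (1 - p) * (D * I))"
      proof (rule layer_cake_bound[OF p(1) _ _ s])
        show "?h \<in> borel_measurable \<omega>" using S[OF fQ(1)] by (simp add: measurable_lf[OF \<omega>])
        show "Q \<in> sets \<omega>" using cubes_borel[OF Q] by (simp add: sets_lf[OF \<omega>])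
        show "0 \<le> D * I" using D0 I0 by simp
        show "ennreal (t powr p) * emeasure \<omega> {x \<in> space \<omega>. ennreal t < ?h x} \<le> ennreal (D * I)" if "0 < t" for t
          using D fQ that unfolding weak_bound_def I_def space_lf[OF \<omega>] by auto
      qed
      also have "\<dots> = ennreal (s * m + c * s powr (1 - p) * (D * I))"
        using s m0 D0 I0 c by (simp add: m c_def[symmetric] ennreal_mult ennreal_plus)
      finally show ?thesis .
    qed
    have "(\<integral>\<^sup>+x\<in>Q. ?h x \<partial>\<omega>) \<le> ennreal ((1 + c) * D powr (1 / p) * I powr (1 / p) * m powr (1 / p'))"
    proof (cases "m = 0")
      case True
      have "(\<integral>\<^sup>+x\<in>Q. ?h x \<partial>\<omega>) = 0"
      proof (rule nn_integral_0_iff_AE[THEN iffD2])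
        show "(\<lambda>x. ?h x * indicator Q x) \<in> borel_measurable \<omega>"
          using S[OF fQ(1)] cubes_borel[OF Q] by (auto simp: measurable_lf[OF \<omega>])
        have "Q \<in> null_sets \<omega>" using True m cubes_borel[OF Q] by (auto simp: null_sets_def sets_lf[OF \<omega>])
        thus "AE x in \<omega>. ?h x * indicator Q x = 0" by (rule AE_I') (auto split: split_indicator)
      qed
      thus ?thesis by simp
    next
      case False
      hence m0: "0 < m" using m0 by simp
      show ?thesis
      proof (cases "D * I = 0")
        \<comment> \<open>Only the term s m is left, and s can be taken arbitrarily small.\<close>
        case True
        have "(\<integral>\<^sup>+x\<in>Q. ?h x \<partial>\<omega>) \<le> ennreal e" if e: "0 < e" for e
          using lc[of "e / m"] True m0 e by simp
        hence "(\<integral>\<^sup>+x\<in>Q. ?h x \<partial>\<omega>) \<le> 0"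
          using ennreal_le_epsilon[of 0] by (simp del: le_zero_eq)
        thus ?thesis by simp
      next
        case False
        hence DI: "0 < D" "0 < I" using D0 I0 by (auto simp: less_le)
        \<comment> \<open>The balancing level: s^p m = D I.\<close>
        define s where "s = (D * I / m) powr (1 / p)"
        have s: "0 < s" using DI m0 by (simp add: s_def)
        have "s powr p * m = D * I" using DI m0 p by (simp add: s_def powr_powr)
        hence "s powr (1 - p) * (D * I) = s powr (1 - p) * s powr p * m" by simp
        also have "\<dots> = s * m" using s by (simp add: powr_add[symmetric])
        finally have 1: "s * m + c * s powr (1 - p) * (D * I) = (1 + c) * (s * m)" by (simp add: algebra_simps)
        have "s * m = (D * I) powr (1 / p) * (m powr 1 / m powr (1 / p))"
          using DI m0 by (simp add: s_def powr_divide powr_one)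
        also have "m powr 1 / m powr (1 / p) = m powr (1 / p')" unfolding p' by (simp only: powr_diff)
        also have "(D * I) powr (1 / p) = D powr (1 / p) * I powr (1 / p)" using D0 I0 by (simp add: powr_mult)
        finally show ?thesis using lc[OF s] unfolding 1 by (simp add: mult_ac)
      qed
    qed
    thus "(\<integral>\<^sup>+x\<in>Q. S (\<lambda>y. indicator Q y * f y) x \<partial>\<omega>)
       \<le> ennreal ((1 + c) * D powr (1 / p) * (LINT x:Q|\<sigma>. norm (f x) powr p) powr (1 / p) * measure \<omega> Q powr (1 / p'))"
      by (simp add: I_def m_def)
  qed
  thus ?thesis ..
qed

subsection \<open>Overlap of covering families\<close>

text \<open>A volume count: shrunk to the common radius r, the balls remain disjoint and fit into
  one ball of radius R.\<close>

lemma card_disjoint_cballs: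
  fixes a :: "'i \<Rightarrow> 'b :: euclidean_space"
  assumes "0 < r" "0 \<le> R"
    and disj: "pairwise (\<lambda>i j. disjnt (cball (a i) (\<rho> i)) (cball (a j) (\<rho> j))) I"
    and \<rho>: "\<And>i. i \<in> I \<Longrightarrow> r \<le> \<rho> i" and sub: "\<And>i. i \<in> I \<Longrightarrow> cball (a i) r \<subseteq> cball x R"
  shows "finite I" "real (card I) \<le> (R / r) ^ DIM('b)"
proof -
  have fin: "real (card F) \<le> (R / r) ^ DIM('b)" if F: "finite F" "F \<subseteq> I" for F
  proof -
    have "(\<Sum>i\<in>F. measure lborel (cball (a i) r)) = measure lborel (\<Union>i\<in>F. cball (a i) r)"
    proof (rule measure_finite_Union[OF F(1), symmetric])
      show "disjoint_family_on (\<lambda>i. cball (a i) r) F"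
        unfolding disjoint_family_on_def
      proof (intro ballI impI)
        fix i j assume ij: "i \<in> F" "j \<in> F" "i \<noteq> j"
        hence "cball (a i) (\<rho> i) \<inter> cball (a j) (\<rho> j) = {}"
          using disj F(2) by (auto simp: pairwise_def disjnt_def)
        moreover have "r \<le> \<rho> i" "r \<le> \<rho> j" using \<rho> ij F(2) by auto
        ultimately show "cball (a i) r \<inter> cball (a j) r = {}" by (meson disjoint_iff subset_cball subsetD)
      qed
      show "emeasure lborel (cball (a i) r) \<noteq> \<infinity>" for i
        using emeasure_bounded_finite[of "cball (a i) r"] by simp
    qed auto
    also have "\<dots> \<le> measure lborel (cball x R)"
      using sub F emeasure_bounded_finite[of "cball x R"]
      by (intro measure_mono_fmeasurable fmeasurableI) auto
    finally have "real (card F) * (unit_ball_vol DIM('b) * r ^ DIM('b)) \<le> unit_ball_vol DIM('b) * R ^ DIM('b)"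
      using assms(1,2) by (simp add: content_cball)
    hence "real (card F) * r ^ DIM('b) \<le> R ^ DIM('b)"
      by (simp add: mult.left_commute[of "real (card F)"])
    thus ?thesis using assms(1) by (simp add: power_divide pos_le_divide_eq)
  qed
  show "finite I"
  proof (rule finite_if_finite_subsets_card_bdd[THEN conjunct1])
    show "card F \<le> nat \<lfloor>(R / r) ^ DIM('b)\<rfloor>" if "F \<subseteq> I" "finite F" for F
      using fin[OF that(2,1)] by linarith
  qed
  thus "real (card I) \<le> (R / r) ^ DIM('b)" by (intro fin) auto
qed

text \<open>Sums over a countable index set are written as integrals over
  \<open>count_space\<close>, which makes exchanging a sum with an integral a case of Tonelli's
  theorem.\<close>

lemma emeasure_UN_le_nn_integral:
  assumes "countable I" "\<And>i. i \<in> I \<Longrightarrow> X i \<in> sets M"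
  shows "emeasure M (\<Union>i\<in>I. X i) \<le> (\<integral>\<^sup>+i. emeasure M (X i) \<partial>count_space I)"
proof -
  have "emeasure M (\<Union>i\<in>I. X i) = (\<integral>\<^sup>+x. indicator (\<Union>i\<in>I. X i) x \<partial>M)"
    using assms by (intro nn_integral_indicator[symmetric] sets.countable_UN') auto
  also have "\<dots> \<le> (\<integral>\<^sup>+x. \<integral>\<^sup>+i. indicator (X i) x \<partial>count_space I \<partial>M)"
  proof (rule nn_integral_mono)
    fix x
    show "indicator (\<Union>i\<in>I. X i) x \<le> (\<integral>\<^sup>+i. indicator (X i) x \<partial>count_space I :: ennreal)"
    proof (cases "x \<in> (\<Union>i\<in>I. X i)")
      case True
      then obtain j where j: "j \<in> I" "x \<in> X j" by blast
      have "(1::ennreal) = (\<integral>\<^sup>+i. indicator {j} i \<partial>count_space I)"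
        using j by (simp add: nn_integral_indicator)
      also have "\<dots> \<le> (\<integral>\<^sup>+i. indicator (X i) x \<partial>count_space I)"
        using j by (intro nn_integral_mono) (auto split: split_indicator)
      finally show ?thesis using True by simp
    qed simp
  qed
  also have "\<dots> = (\<integral>\<^sup>+i. \<integral>\<^sup>+x. indicator (X i) x \<partial>M \<partial>count_space I)"
    using assms by (intro nn_integral_count_space_nn_integral) auto
  also have "\<dots> = (\<integral>\<^sup>+i. emeasure M (X i) \<partial>count_space I)"
    using assms by (intro nn_integral_cong) auto
  finally show ?thesis .
qed

lemma nn_integral_bounded_overlap:
  fixes g :: "'a \<Rightarrow> ennreal"
  assumes I: "countable I" and g: "g \<in> borel_measurable M" and X: "\<And>i. i \<in> I \<Longrightarrow> X i \<in> sets M"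
    and ov: "\<And>x. x \<in> space M \<Longrightarrow> finite {i \<in> I. x \<in> X i} \<and> real (card {i \<in> I. x \<in> X i}) \<le> m"
    and Y: "Y \<in> sets M" "\<And>i. i \<in> I \<Longrightarrow> X i \<subseteq> Y"
  shows "(\<integral>\<^sup>+i. (\<integral>\<^sup>+x\<in>X i. g x \<partial>M) \<partial>count_space I) \<le> ennreal m * (\<integral>\<^sup>+x\<in>Y. g x \<partial>M)"
proof -
  have "(\<integral>\<^sup>+i. (\<integral>\<^sup>+x\<in>X i. g x \<partial>M) \<partial>count_space I) = (\<integral>\<^sup>+x. \<integral>\<^sup>+i. g x * indicator (X i) x \<partial>count_space I \<partial>M)"
    using I g X by (intro nn_integral_count_space_nn_integral[symmetric]) auto
  also have "\<dots> \<le> (\<integral>\<^sup>+x. ennreal m * (g x * indicator Y x) \<partial>M)"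
  proof (rule nn_integral_mono)
    fix x assume x: "x \<in> space M"
    have fin: "finite {i \<in> I. x \<in> X i}" using ov[OF x] by blast
    have "(\<integral>\<^sup>+i. g x * indicator (X i) x \<partial>count_space I) = (\<integral>\<^sup>+i. g x * indicator Y x * indicator {i \<in> I. x \<in> X i} i \<partial>count_space I)"
      using Y(2) by (intro nn_integral_cong) (auto split: split_indicator)
    also have "\<dots> = g x * indicator Y x * ennreal (real (card {i \<in> I. x \<in> X i}))"
      using fin by (subst nn_integral_cmult_indicator) (auto simp: emeasure_count_space_finite ennreal_of_nat_eq_real_of_nat)
    also have "\<dots> \<le> g x * indicator Y x * ennreal m"
      using ov[OF x] by (intro mult_left_mono ennreal_leI) auto
    finally show "(\<integral>\<^sup>+i. g x * indicator (X i) x \<partial>count_space I) \<le> ennreal m * (g x * indicator Y x)"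
      by (simp add: mult_ac)
  qed
  also have "\<dots> = ennreal m * (\<integral>\<^sup>+x\<in>Y. g x \<partial>M)" using g Y by (intro nn_integral_cmult) auto
  finally show ?thesis .
qed

subsection \<open>Testing implies the weak type inequality\<close>

text \<open>If the product exceeds \<tau> b, then b \<le> \<tau>^(-p) a, and this bounds the factor
  containing b. The free weight lets the term in b be made small, for absorption, at the expense of
  the term in a.\<close>

lemma weighted_young:
  fixes a b :: real
  assumes p: "1 < p" "1 / p + 1 / p' = 1" and ab: "0 \<le> a" "0 \<le> b" and \<tau>: "0 < \<tau>"
  shows "a powr (1 / p) * b powr (1 / p') \<le> \<tau> powr (1 - p) * a + \<tau> * b"
proof -
  let ?X = "a powr (1 / p) * b powr (1 / p')"
  have p': "1 / p' = 1 - 1 / p" using p(2) by simp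
  consider "a = 0 \<or> b = 0" | "?X \<le> \<tau> * b" | "0 < a" "0 < b" "\<tau> * b < ?X" using ab by linarith
  thus ?thesis
  proof cases
    case 1
    thus ?thesis using ab \<tau> by auto
  next
    case 2
    thus ?thesis using ab by (intro order_trans[OF 2]) simp
  next
    case 3
    have "b = b powr (1 / p) * b powr (1 / p')" using 3 unfolding p' powr_add[symmetric] by simp
    hence "\<tau> * b powr (1 / p) * b powr (1 / p') < a powr (1 / p) * b powr (1 / p')"
      using 3(3) by (simp add: mult.assoc)
    hence "\<tau> * b powr (1 / p) < a powr (1 / p)" using 3 by simp
    hence "(\<tau> * b powr (1 / p)) powr p < (a powr (1 / p)) powr p"
      using p \<tau> by (intro powr_less_mono2) auto
    hence "\<tau> powr p * b < a" using p \<tau> 3 by (simp add: powr_mult powr_powr)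
    hence "b \<le> a * \<tau> powr (- p)" using \<tau> by (simp add: powr_minus field_simps)
    hence "b powr (1 / p') \<le> (a * \<tau> powr (- p)) powr (1 / p')"
      using 3 p by (intro powr_mono2) (auto simp: p' field_simps)
    also have "\<dots> = a powr (1 / p') * \<tau> powr (1 - p)"
    proof -
      have "- p * (1 / p') = 1 - p" unfolding p' using p by (simp add: field_simps)
      thus ?thesis using 3 by (simp add: powr_mult powr_powr)
    qed
    finally have "?X \<le> a powr (1 / p) * (a powr (1 / p') * \<tau> powr (1 - p))"
      by (rule mult_left_mono) simp
    also have "\<dots> = \<tau> powr (1 - p) * a"
      using 3 p by (simp add: mult.assoc[symmetric] powr_add[symmetric] p')
    finally show ?thesis by (rule order_trans) (use ab \<tau> in simp)
  qed
qed

locale two_weight = trunc_setting \<sigma> K C d \<Phi> B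
  for \<sigma> :: "(real ^ 'n) measure" and K C d \<Phi> B +
  fixes \<omega> :: "(real ^ 'n) measure" and p p' :: real
  assumes \<omega>: "locally_finite_borel \<omega>" and p: "1 < p" "1 / p + 1 / p' = 1"
begin

lemma Lp_loc_integrable: "f \<in> Lp_fun p \<sigma> \<Longrightarrow> loc_integrable \<sigma> f"
  by (rule loc_integrable_Lp[OF \<sigma>]) (use p in auto)

lemma T_split:
  assumes f: "loc_integrable \<sigma> f" and S: "S \<in> sets borel"
  shows "T f x \<le> T (\<lambda>y. indicator S y * f y) x + T (\<lambda>y. indicator (- S) y * f y) x"
  unfolding trunc_max_def[of \<Phi> K \<sigma> f]
proof (rule SUP_least)
  fix \<phi> assume "\<phi> \<in> \<Phi>"
  hence \<phi>: "\<phi> \<in> insert (\<lambda>_. 0) \<Phi>" by simp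
  let ?i = "\<lambda>g. \<integral>y. K x y * of_real (\<phi> (x - y)) * g y \<partial>\<sigma>"
  have fS: "loc_integrable \<sigma> (\<lambda>y. indicator S y * f y)" "loc_integrable \<sigma> (\<lambda>y. indicator (- S) y * f y)"
    using S by (auto intro!: loc_integrable_indicator f)
  have "?i f = (\<integral>y. K x y * of_real (\<phi> (x - y)) * (indicator S y * f y) + K x y * of_real (\<phi> (x - y)) * (indicator (- S) y * f y) \<partial>\<sigma>)"
    by (rule Bochner_Integration.integral_cong) (auto split: split_indicator)
  also have "\<dots> = ?i (\<lambda>y. indicator S y * f y) + ?i (\<lambda>y. indicator (- S) y * f y)"
    by (rule Bochner_Integration.integral_add[OF trunc_integrable[OF fS(1) \<phi>] trunc_integrable[OF fS(2) \<phi>]])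
  finally have "ennreal (norm (?i f)) \<le> ennreal (norm (?i (\<lambda>y. indicator S y * f y))) + ennreal (norm (?i (\<lambda>y. indicator (- S) y * f y)))"
    by (simp only: ennreal_plus[OF norm_ge_zero norm_ge_zero, symmetric] ennreal_leI norm_triangle_ineq)
  also have "\<dots> \<le> T (\<lambda>y. indicator S y * f y) x + T (\<lambda>y. indicator (- S) y * f y) x"
    by (intro add_mono trunc_le_T[OF \<phi>])
  finally show "ennreal (norm (?i f)) \<le> T (\<lambda>y. indicator S y * f y) x + T (\<lambda>y. indicator (- S) y * f y) x" .
qed

text \<open>Off the support T f decays like |x|^-n. The threshold is at least 1 so that |x| \<le>
  |x|^n.\<close>

lemma T_compact_support_bounded_superlevel:
  assumes f: "loc_integrable \<sigma> f" and \<rho>: "0 < \<rho>" and supp: "\<And>y. y \<notin> cball 0 \<rho> \<Longrightarrow> f y = 0" and t: "0 < t"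
  shows "bounded {x. ennreal t < T f x}"
proof -
  define m where "m = enn2real (abs_mass \<sigma> f (cball 0 \<rho>))"
  have m: "abs_mass \<sigma> f (cball 0 \<rho>) = ennreal m" "0 \<le> m"
    using loc_integrable_bounded[OF f, of "cball 0 \<rho>"] by (auto simp: m_def)
  define R where "R = max (max (2 * \<rho>) 1) (2 ^ CARD('n) * C * m / t)"
  have "norm x \<le> R" if x: "ennreal t < T f x" for x
  proof (rule ccontr)
    assume "\<not> norm x \<le> R"
    hence R: "2 * \<rho> \<le> norm x" "1 \<le> norm x" "2 ^ CARD('n) * C * m / t \<le> norm x" by (auto simp: R_def)
    have "norm x ^ 1 \<le> norm x ^ CARD('n)" using R by (intro power_increasing) (auto simp: Suc_leI)
    hence "2 ^ CARD('n) * C * m / t \<le> norm x ^ CARD('n)" using R by simp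
    hence "2 ^ CARD('n) * C * m \<le> t * norm x ^ CARD('n)" using t by (simp add: pos_divide_le_eq mult.commute)
    moreover have "0 < norm x ^ CARD('n)" using R by (intro zero_less_power) linarith
    ultimately have "2 ^ CARD('n) * C * m / norm x ^ CARD('n) \<le> t" by (simp only: pos_divide_le_eq)
    hence "2 ^ CARD('n) * C / norm x ^ CARD('n) * m \<le> t" by simp
    hence "ennreal (2 ^ CARD('n) * C / norm x ^ CARD('n)) * ennreal m \<le> ennreal t"
      using m(2) C0 by (subst ennreal_mult[symmetric]) (auto intro: ennreal_leI)
    hence "T f x \<le> ennreal t" using T_far(1)[OF f \<rho> supp R(1)] m by simp
    thus False using x by simp
  qed
  thus ?thesis unfolding bounded_iff by blast
qed

text \<open>The last term concerns the superlevel set at level \<alpha>, the left side the one at 3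
  \<alpha>; a small \<tau> makes it absorbable. It arises from the sum of \<omega>(Q i), which
  returns to \<omega>(\<Omega>) because the cubes stay inside \<Omega> and overlap
  boundedly.\<close>

lemma good_lambda:
  assumes test: "testing_condition p p' \<sigma> \<omega> T C\<^sub>2" and C2: "0 \<le> C\<^sub>2"
  shows "\<exists>\<beta> m. 0 < \<beta> \<and> 0 \<le> m \<and> (\<forall>f \<rho> \<alpha> \<tau>. f \<in> Lp_fun p \<sigma> \<and> 0 < \<rho> \<and> (\<forall>y. y \<notin> cball 0 \<rho> \<longrightarrow> f y = 0) \<and> 0 < \<alpha> \<and> 0 < \<tau> \<longrightarrow>
      ennreal (\<alpha> powr p) * emeasure \<omega> {x. ennreal (3 * \<alpha>) < T f x} \<le>
      ennreal (\<alpha> powr p) * emeasure \<omega> {x. ennreal (\<beta> * \<alpha>) < M f x}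
      + ennreal (m * \<tau> powr (1 - p) * (\<integral>x. norm (f x) powr p \<partial>\<sigma>))
      + ennreal (m * \<tau>) * (ennreal (\<alpha> powr p) * emeasure \<omega> {x. ennreal \<alpha> < T f x}))"
proof -
  define nn where "nn = real CARD('n)"
  have nn: "1 \<le> nn" by (simp add: nn_def Suc_leI)
  \<comment> \<open>With r = d / k, the cube of half side 10 r lies in the ball of radius 10 n r = d
    / 2, hence in \<Omega>.\<close>
  define k where "k = 20 * nn"
  have k: "20 \<le> k" using nn by (simp add: k_def)
  \<comment> \<open>For L = (k + 5) r this gives \<kappa> L = 5 r. A point within 5 r of the centre
    is at most L from the point of the complement of \<Omega> nearest to that centre, and at least 5
    r from the complement of the cube of half side 10 r.\<close>
  define \<kappa> where "\<kappa> = 5 / (k + 5)"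
  have \<kappa>: "0 < \<kappa>" using k by (simp add: \<kappa>_def)
  obtain A where A: "0 \<le> A" and max: "\<And>f x z L S. loc_integrable \<sigma> f \<and> 0 < L \<and> norm (x - z) \<le> L \<and> S \<in> sets borel \<and>
      (\<forall>y\<in>S. \<kappa> * L \<le> norm (x - y)) \<and> - S \<subseteq> cball x L \<Longrightarrow>
      T (\<lambda>y. indicator S y * f y) x \<le> T f z + ennreal A * M f x"
    using maximum_principle[OF \<kappa>] by blast
  \<comment> \<open>Chosen so that A M f \<le> \<alpha> wherever M f \<le> \<beta> \<alpha>.\<close>
  define \<beta> where "\<beta> = 1 / (A + 1)"
  have \<beta>: "0 < \<beta>" "A * \<beta> \<le> 1" using A by (auto simp: \<beta>_def field_simps)
  define m where "m = C\<^sub>2 * (3 * k) ^ CARD('n)"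
  have m0: "0 \<le> m" using C2 k by (simp add: m_def)
  have main: "ennreal (\<alpha> powr p) * emeasure \<omega> {x. ennreal (3 * \<alpha>) < T f x} \<le>
      ennreal (\<alpha> powr p) * emeasure \<omega> {x. ennreal (\<beta> * \<alpha>) < M f x}
      + ennreal (m * \<tau> powr (1 - p) * (\<integral>x. norm (f x) powr p \<partial>\<sigma>))
      + ennreal (m * \<tau>) * (ennreal (\<alpha> powr p) * emeasure \<omega> {x. ennreal \<alpha> < T f x})"
    if f: "f \<in> Lp_fun p \<sigma>" and \<rho>: "0 < \<rho>" and supp: "\<And>y. y \<notin> cball 0 \<rho> \<Longrightarrow> f y = 0" and \<alpha>: "0 < \<alpha>" and \<tau>: "0 < \<tau>"
    for f \<rho> \<alpha> \<tau>
  proof -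
    note fl = Lp_loc_integrable[OF f]
    have fm [measurable]: "f \<in> borel_measurable borel" using fl by (simp add: loc_integrable_def)
    define \<Omega> where "\<Omega> = {x. ennreal \<alpha> < T f x}"
    have op: "open \<Omega>" unfolding \<Omega>_def by (rule open_T_superlevel[OF fl])
    have \<Omega>b: "\<Omega> \<in> sets borel" using op by simp
    have bd: "bounded \<Omega>" unfolding \<Omega>_def by (rule T_compact_support_bounded_superlevel[OF fl \<rho> supp \<alpha>])
    \<comment> \<open>Boundedness of \<Omega> makes its complement nonempty, so that the distance to
      it is attained.\<close>
    have cne: "- \<Omega> \<noteq> {}" using bd not_bounded_UNIV by (metis Compl_empty_eq double_compl)
    have ccl: "closed (- \<Omega>)" using op by (simp add: closed_Compl)
    define d where "d x = infdist x (- \<Omega>)" for x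
    have dpos: "0 < d x" if "x \<in> \<Omega>" for x
      using that ccl cne in_closed_iff_infdist_zero[of "- \<Omega>" x] infdist_nonneg[of x "- \<Omega>"] by (force simp: d_def)
    have dtri: "d x \<le> d y + dist x y" for x y unfolding d_def by (rule infdist_triangle)
    have din: "y \<in> \<Omega>" if "dist x y < d x" for x y
    proof (rule ccontr)
      assume "y \<notin> \<Omega>"
      hence "d x \<le> dist x y" unfolding d_def by (intro infdist_le) auto
      thus False using that by simp
    qed
    define r where "r x = d x / k" for x
    have rpos: "0 < r x" if "x \<in> \<Omega>" for x using dpos[OF that] k by (simp add: r_def)
    obtain z0 b where z0: "z0 \<in> - \<Omega>" and b: "\<And>x. x \<in> \<Omega> \<Longrightarrow> norm x \<le> b"
      using cne bd unfolding bounded_iff by blast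
    have rle: "r x \<le> (b + norm z0) / k" if "x \<in> \<Omega>" for x
    proof -
      have "d x \<le> dist x z0" unfolding d_def by (rule infdist_le[OF z0])
      also have "\<dots> \<le> b + norm z0" using b[OF that] norm_triangle_ineq4[of x z0] by (simp add: dist_norm)
      finally show ?thesis using k by (simp add: r_def divide_right_mono)
    qed
    obtain I where I: "countable I" "I \<subseteq> \<Omega>"
      and disj: "pairwise (\<lambda>i j. disjnt (cball i (r i)) (cball j (r j))) I"
      and cov: "\<Omega> \<subseteq> (\<Union>i\<in>I. cball i (5 * r i))"
    proof (rule Vitali_covering_lemma_cballs[where S="\<Omega>" and K="\<Omega>" and a="\<lambda>x. x" and r=r and B="(b + norm z0) / k"])
      show "\<Omega> \<subseteq> (\<Union>i\<in>\<Omega>. cball i (r i))" using rpos by (force intro: less_imp_le)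
    qed (use rpos rle in auto)
    define Q where "Q i = centered_cube i (10 * r i)" for i
    have Qcube: "Q i \<in> cubes" if "i \<in> I" for i
      unfolding Q_def using rpos I that by (intro centered_cube_cubes) auto
    have Qsub: "Q i \<subseteq> cball i (d i / 2)" if "i \<in> I" for i
      using centered_cube_subset_cball[of i "10 * r i"] k by (simp add: Q_def r_def k_def nn_def)
    have Q\<Omega>: "Q i \<subseteq> \<Omega>" if "i \<in> I" for i
      using Qsub[OF that] dpos[of i] I(2) that by (force intro: din[of i])
    \<comment> \<open>If y lies in Q i, then d i and d y are comparable. The disjoint balls, shrunk
      to radius 2 d y / (3 k), lie in the ball of radius 2 d y about y; the ratio of the radii is 3
      k.\<close>
    have overlap: "finite {i \<in> I. y \<in> Q i} \<and> real (card {i \<in> I. y \<in> Q i}) \<le> (3 * k) ^ CARD('n)" for y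
    proof (cases "y \<in> \<Omega>")
      case True
      have dy: "0 < d y" using dpos[OF True] .
      have near: "dist y i \<le> d i / 2" "2 * d y / 3 \<le> d i" "d i \<le> 2 * d y" if "i \<in> {i \<in> I. y \<in> Q i}" for i
      proof -
        show "dist y i \<le> d i / 2" using Qsub[of i] that by (auto simp: dist_commute subset_iff)
        thus "2 * d y / 3 \<le> d i" "d i \<le> 2 * d y" using dtri[of y i] dtri[of i y] by (auto simp: dist_commute)
      qed
      have *: "0 < 2 * d y / (3 * k)" "0 \<le> 2 * d y" using dy k by auto
      have disj': "pairwise (\<lambda>i j. disjnt (cball i (r i)) (cball j (r j))) {i \<in> I. y \<in> Q i}"
        by (rule pairwise_subset[OF disj]) auto
      have rr: "2 * d y / (3 * k) \<le> r i" if "i \<in> {i \<in> I. y \<in> Q i}" for i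
        using near(2)[OF that] k by (simp add: r_def field_simps)
      have sub: "cball i (2 * d y / (3 * k)) \<subseteq> cball y (2 * d y)" if "i \<in> {i \<in> I. y \<in> Q i}" for i
      proof
        fix w assume "w \<in> cball i (2 * d y / (3 * k))"
        hence "dist i w \<le> 2 * d y / (3 * k)" by simp
        also have "\<dots> \<le> 2 * d y / 2" using k dy by (intro divide_left_mono) auto
        finally show "w \<in> cball y (2 * d y)"
          using near(1,3)[OF that] dist_triangle[of y w i] by simp
      qed
      have "2 * d y / (2 * d y / (3 * k)) = 3 * k" using dy k by (simp add: field_simps)
      thus ?thesis using card_disjoint_cballs[OF * disj' rr sub] by simp
    next
      case False
      hence e: "{i \<in> I. y \<in> Q i} = {}" using Q\<Omega> by blast
      show ?thesis unfolding e using k by simp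
    qed
    define E where "E i = {x \<in> cball i (5 * r i). ennreal (3 * \<alpha>) < T f x \<and> M f x \<le> ennreal (\<beta> * \<alpha>)}" for i
    have Tm: "T f \<in> borel_measurable borel" by (rule T_measurable[OF fl])
    have Mm: "M f \<in> borel_measurable borel" by (rule maximal_op_measurable[OF \<sigma> fm])
    have Em: "E i \<in> sets borel" for i
    proof -
      note [measurable] = Tm Mm
      show ?thesis unfolding E_def by measurable
    qed
    \<comment> \<open>At the nearest point z of the complement T f \<le> \<alpha>. Since M f is
      small at x, the part of f off Q i contributes at most 2 \<alpha> at x, so a value above 3
      \<alpha> leaves at least \<alpha> for the part on Q i.\<close>
    have low: "ennreal \<alpha> \<le> T (\<lambda>y. indicator (Q i) y * f y) x" if i: "i \<in> I" and x: "x \<in> E i" for i x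
    proof -
      have i\<Omega>: "i \<in> \<Omega>" using i I by blast
      obtain z where z: "z \<in> - \<Omega>" "d i = dist i z"
        using infdist_attains_inf[OF ccl cne, of i] unfolding d_def by blast
      have dk: "d i = k * r i" using k by (simp add: r_def)
      define L where "L = (k + 5) * r i"
      have L: "0 < L" using k rpos[OF i\<Omega>] by (simp add: L_def)
      have xi: "dist i x \<le> 5 * r i" using x by (simp add: E_def)
      have "T (\<lambda>y. indicator (- Q i) y * f y) x \<le> T f z + ennreal A * M f x"
      proof (rule max[of f L x z "- Q i"], intro conjI ballI)
        show "loc_integrable \<sigma> f" "0 < L" by (fact fl L)+
        show "norm (x - z) \<le> L"
          using dist_triangle[of x z i] xi z(2) dk by (simp add: L_def dist_norm[symmetric] dist_commute algebra_simps)
        show "- Q i \<in> sets borel" by (simp add: Q_def)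
        show "\<kappa> * L \<le> norm (x - y)" if "y \<in> - Q i" for y
        proof -
          have "y \<notin> cball i (10 * r i)" using that cball_subset_centered_cube[of i "10 * r i"] by (auto simp: Q_def)
          moreover have "\<kappa> * L = 5 * r i" using k by (simp add: \<kappa>_def L_def)
          ultimately show ?thesis using dist_triangle[of i y x] xi by (simp add: dist_norm[symmetric])
        qed
        show "- (- Q i) \<subseteq> cball x L"
        proof
          fix y assume "y \<in> - (- Q i)"
          hence "dist i y \<le> d i / 2" using Qsub[OF i] by auto
          thus "y \<in> cball x L"
            using dist_triangle[of x y i] xi dk k rpos[OF i\<Omega>] by (simp add: L_def dist_commute algebra_simps)
              (smt (verit) mult_nonneg_nonneg)
        qed
      qed
      also have "\<dots> \<le> ennreal \<alpha> + ennreal A * ennreal (\<beta> * \<alpha>)"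
        using z(1) x by (intro add_mono mult_left_mono) (auto simp: \<Omega>_def E_def)
      also have "ennreal A * ennreal (\<beta> * \<alpha>) = ennreal (A * \<beta> * \<alpha>)"
        using A \<beta> \<alpha> by (simp add: ennreal_mult[symmetric] mult.assoc)
      also have "\<dots> \<le> ennreal \<alpha>" using \<beta> \<alpha> mult_right_mono[OF \<beta>(2), of \<alpha>] by (intro ennreal_leI) simp
      finally have 1: "T (\<lambda>y. indicator (- Q i) y * f y) x \<le> ennreal (2 * \<alpha>)"
        using \<alpha> by (simp add: ennreal_plus[symmetric] add_left_mono del: ennreal_plus)
      have "ennreal (3 * \<alpha>) < T f x" using x by (simp add: E_def)
      also have "\<dots> \<le> T (\<lambda>y. indicator (Q i) y * f y) x + T (\<lambda>y. indicator (- Q i) y * f y) x"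
        by (rule T_split[OF fl]) (simp add: Q_def)
      also have "\<dots> \<le> T (\<lambda>y. indicator (Q i) y * f y) x + ennreal (2 * \<alpha>)"
        using 1 by (rule add_left_mono)
      finally have 2: "ennreal (3 * \<alpha>) < T (\<lambda>y. indicator (Q i) y * f y) x + ennreal (2 * \<alpha>)" .
      show ?thesis
      proof (rule ccontr)
        assume "\<not> ?thesis"
        hence "T (\<lambda>y. indicator (Q i) y * f y) x + ennreal (2 * \<alpha>) \<le> ennreal \<alpha> + ennreal (2 * \<alpha>)"
          by (intro add_right_mono) simp
        also have "\<dots> = ennreal (3 * \<alpha>)" using \<alpha> by (subst ennreal_plus[symmetric]) auto
        finally show False using 2 by simp
      qed
    qed
    define a where "a i = (LINT x:Q i|\<sigma>. norm (f x) powr p)" for i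
    have ai: "ennreal (a i) = (\<integral>\<^sup>+x\<in>Q i. ennreal (norm (f x) powr p) \<partial>\<sigma>)" "0 \<le> a i" if "i \<in> I" for i
    proof -
      have Qm: "Q i \<in> sets \<sigma>" using Qcube[OF that] by (simp add: sets_lf[OF \<sigma>] cubes_borel)
      have int: "integrable \<sigma> (\<lambda>x. indicator (Q i) x *\<^sub>R norm (f x) powr p)"
        using f Qm by (intro integrable_mult_indicator) (auto simp: Lp_fun_def)
      show "0 \<le> a i" unfolding a_def set_lebesgue_integral_def by (rule Bochner_Integration.integral_nonneg) simp
      show "ennreal (a i) = (\<integral>\<^sup>+x\<in>Q i. ennreal (norm (f x) powr p) \<partial>\<sigma>)"
        unfolding a_def set_lebesgue_integral_def
        by (subst nn_integral_eq_integral[OF int, symmetric]) (auto intro!: nn_integral_cong split: split_indicator)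
    qed
    \<comment> \<open>Testing bounds \<alpha> \<omega>(E i). Multiplying by \<alpha>^(p - 1) =
      (\<alpha>^p)^(1/p') moves the level inside the second power, and \<open>weighted_young\<close>
      separates the two measures.\<close>
    have each: "ennreal (\<alpha> powr p) * emeasure \<omega> (E i) \<le> ennreal (C\<^sub>2 * \<tau> powr (1 - p)) * ennreal (a i)
        + ennreal (C\<^sub>2 * \<tau>) * (ennreal (\<alpha> powr p) * emeasure \<omega> (Q i))" if i: "i \<in> I" for i
    proof -
      have mQ: "emeasure \<omega> (Q i) = ennreal (measure \<omega> (Q i))"
        using emeasure_bounded_lf[OF \<omega>, of "Q i"] cubes_compact[OF Qcube[OF i]]
        by (intro emeasure_eq_ennreal_measure) (auto dest: compact_imp_bounded)
      have ES: "E i \<subseteq> Q i"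
        using cball_subset_centered_cube[of i "10 * r i"] rpos[of i] I(2) i by (auto simp: E_def Q_def subset_iff)
      have "ennreal \<alpha> * emeasure \<omega> (E i) = (\<integral>\<^sup>+x. ennreal \<alpha> * indicator (E i) x \<partial>\<omega>)"
        using Em by (subst nn_integral_cmult_indicator) (auto simp: sets_lf[OF \<omega>])
      also have "\<dots> \<le> (\<integral>\<^sup>+x\<in>Q i. T (\<lambda>y. indicator (Q i) y * f y) x \<partial>\<omega>)"
        using low[OF i] ES by (intro nn_integral_mono) (auto split: split_indicator)
      also have "\<dots> \<le> ennreal (C\<^sub>2 * a i powr (1 / p) * measure \<omega> (Q i) powr (1 / p'))"
        using test Qcube[OF i] f by (simp add: testing_condition_def a_def)
      finally have 1: "ennreal \<alpha> * emeasure \<omega> (E i) \<le> ennreal (C\<^sub>2 * a i powr (1 / p) * measure \<omega> (Q i) powr (1 / p'))" .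
      have lp: "\<alpha> powr p = \<alpha> powr (p - 1) * \<alpha>"
        using \<alpha> powr_add[of \<alpha> "p - 1" 1] by simp
      have "ennreal (\<alpha> powr p) * emeasure \<omega> (E i) = ennreal (\<alpha> powr (p - 1)) * (ennreal \<alpha> * emeasure \<omega> (E i))"
        using \<alpha> by (simp add: lp ennreal_mult mult.assoc)
      also have "\<dots> \<le> ennreal (\<alpha> powr (p - 1)) * ennreal (C\<^sub>2 * a i powr (1 / p) * measure \<omega> (Q i) powr (1 / p'))"
        by (intro mult_left_mono 1) simp
      also have "\<dots> = ennreal (C\<^sub>2 * (a i powr (1 / p) * (\<alpha> powr p * measure \<omega> (Q i)) powr (1 / p')))"
      proof -
        have "1 / p' = 1 - 1 / p" using p(2) by simp
        hence "p * (1 / p') = p - 1" using p(1) by (simp add: field_simps)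
        hence "(\<alpha> powr p * measure \<omega> (Q i)) powr (1 / p') = \<alpha> powr (p - 1) * measure \<omega> (Q i) powr (1 / p')"
          using \<alpha> by (simp only: powr_mult powr_powr)
        thus ?thesis using C2 by (subst ennreal_mult[symmetric]) (auto simp: mult_ac)
      qed
      also have "\<dots> \<le> ennreal (C\<^sub>2 * (\<tau> powr (1 - p) * a i + \<tau> * (\<alpha> powr p * measure \<omega> (Q i))))"
        by (intro ennreal_leI mult_left_mono weighted_young p ai(2)[OF i] \<tau> C2) simp
      also have "\<dots> = ennreal (C\<^sub>2 * \<tau> powr (1 - p)) * ennreal (a i) + ennreal (C\<^sub>2 * \<tau>) * (ennreal (\<alpha> powr p) * emeasure \<omega> (Q i))"
        using C2 \<tau> ai(2)[OF i] by (simp add: mQ ennreal_mult[symmetric] ennreal_plus[symmetric] distrib_left mult_ac del: ennreal_plus)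
      finally show ?thesis .
    qed
    have "{x. ennreal (3 * \<alpha>) < T f x} \<subseteq> {x. ennreal (\<beta> * \<alpha>) < M f x} \<union> (\<Union>i\<in>I. E i)"
    proof
      fix x assume x: "x \<in> {x. ennreal (3 * \<alpha>) < T f x}"
      have "ennreal \<alpha> \<le> ennreal (3 * \<alpha>)" using \<alpha> by (intro ennreal_leI) simp
      hence "x \<in> \<Omega>" using x by (auto simp: \<Omega>_def intro: order.strict_trans1)
      then obtain i where "i \<in> I" "x \<in> cball i (5 * r i)" using cov by blast
      thus "x \<in> {x. ennreal (\<beta> * \<alpha>) < M f x} \<union> (\<Union>i\<in>I. E i)" using x by (auto simp: E_def not_less)
    qed
    moreover have mM: "{x. ennreal (\<beta> * \<alpha>) < M f x} \<in> sets \<omega>"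
      using open_maximal_superlevel[OF \<sigma> fm, of "\<beta> * \<alpha>"] \<beta> \<alpha> by (simp add: sets_lf[OF \<omega>])
    moreover have mE: "(\<Union>i\<in>I. E i) \<in> sets \<omega>"
      using I(1) Em by (auto simp: sets_lf[OF \<omega>])
    ultimately have "emeasure \<omega> {x. ennreal (3 * \<alpha>) < T f x} \<le> emeasure \<omega> {x. ennreal (\<beta> * \<alpha>) < M f x} + emeasure \<omega> (\<Union>i\<in>I. E i)"
      by (meson emeasure_mono emeasure_subadditive order_trans sets.Un)
    hence "ennreal (\<alpha> powr p) * emeasure \<omega> {x. ennreal (3 * \<alpha>) < T f x} \<le> ennreal (\<alpha> powr p) * emeasure \<omega> {x. ennreal (\<beta> * \<alpha>) < M f x}
        + ennreal (\<alpha> powr p) * emeasure \<omega> (\<Union>i\<in>I. E i)"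
      by (simp only: distrib_left[symmetric] mult_left_mono zero_le)
    also have "ennreal (\<alpha> powr p) * emeasure \<omega> (\<Union>i\<in>I. E i) \<le> (\<integral>\<^sup>+i. ennreal (\<alpha> powr p) * emeasure \<omega> (E i) \<partial>count_space I)"
      using emeasure_UN_le_nn_integral[OF I(1), of E \<omega>] Em
      by (subst nn_integral_cmult) (auto simp: sets_lf[OF \<omega>] intro: mult_left_mono)
    also have "\<dots> \<le> (\<integral>\<^sup>+i. ennreal (C\<^sub>2 * \<tau> powr (1 - p)) * ennreal (a i)
        + ennreal (C\<^sub>2 * \<tau>) * (ennreal (\<alpha> powr p) * emeasure \<omega> (Q i)) \<partial>count_space I)"
      by (intro nn_integral_mono each) simp
    \<comment> \<open>From here bounded overlap is used twice: for |f|^p \<sigma> over the whole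
      space, and for \<omega> inside \<Omega>.\<close>
    also have "\<dots> = ennreal (C\<^sub>2 * \<tau> powr (1 - p)) * (\<integral>\<^sup>+i. ennreal (a i) \<partial>count_space I)
        + ennreal (C\<^sub>2 * \<tau>) * (ennreal (\<alpha> powr p) * (\<integral>\<^sup>+i. emeasure \<omega> (Q i) \<partial>count_space I))"
      by (simp add: nn_integral_add nn_integral_cmult)
    also have "(\<integral>\<^sup>+i. ennreal (a i) \<partial>count_space I) = (\<integral>\<^sup>+i. (\<integral>\<^sup>+x\<in>Q i. ennreal (norm (f x) powr p) \<partial>\<sigma>) \<partial>count_space I)"
      by (intro nn_integral_cong ai) simp
    also have "\<dots> \<le> ennreal ((3 * k) ^ CARD('n)) * (\<integral>\<^sup>+x\<in>UNIV. ennreal (norm (f x) powr p) \<partial>\<sigma>)"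
      by (rule nn_integral_bounded_overlap[OF I(1)])
        (use overlap f Qcube in \<open>auto simp: Lp_fun_def sets_lf[OF \<sigma>] cubes_borel\<close>)
    also have "(\<integral>\<^sup>+x\<in>UNIV. ennreal (norm (f x) powr p) \<partial>\<sigma>) = ennreal (\<integral>x. norm (f x) powr p \<partial>\<sigma>)"
      using f by (simp add: Lp_fun_def nn_integral_eq_integral)
    also have "(\<integral>\<^sup>+i. emeasure \<omega> (Q i) \<partial>count_space I) = (\<integral>\<^sup>+i. (\<integral>\<^sup>+x\<in>Q i. 1 \<partial>\<omega>) \<partial>count_space I)"
      using Qcube by (intro nn_integral_cong) (auto simp: sets_lf[OF \<omega>] cubes_borel)
    also have "\<dots> \<le> ennreal ((3 * k) ^ CARD('n)) * (\<integral>\<^sup>+x\<in>\<Omega>. 1 \<partial>\<omega>)"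
      by (rule nn_integral_bounded_overlap[OF I(1)])
        (use overlap f Qcube \<Omega>b Q\<Omega> in \<open>auto simp: sets_lf[OF \<omega>] cubes_borel\<close>)
    also have "(\<integral>\<^sup>+x\<in>\<Omega>. 1 \<partial>\<omega>) = emeasure \<omega> \<Omega>" using \<Omega>b by (simp add: sets_lf[OF \<omega>])
    finally have fin: "ennreal (\<alpha> powr p) * emeasure \<omega> {x. ennreal (3 * \<alpha>) < T f x} \<le>
      ennreal (\<alpha> powr p) * emeasure \<omega> {x. ennreal (\<beta> * \<alpha>) < M f x}
      + (ennreal (C\<^sub>2 * \<tau> powr (1 - p)) * (ennreal ((3 * k) ^ CARD('n)) * ennreal (\<integral>x. norm (f x) powr p \<partial>\<sigma>))
        + ennreal (C\<^sub>2 * \<tau>) * (ennreal (\<alpha> powr p) * (ennreal ((3 * k) ^ CARD('n)) * emeasure \<omega> \<Omega>)))"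
      by (simp add: add_mono mult_left_mono)
    have I0: "0 \<le> (\<integral>x. norm (f x) powr p \<partial>\<sigma>)" by (rule Bochner_Integration.integral_nonneg) simp
    have e1: "ennreal (C\<^sub>2 * \<tau> powr (1 - p)) * (ennreal ((3 * k) ^ CARD('n)) * ennreal (\<integral>x. norm (f x) powr p \<partial>\<sigma>))
       = ennreal (m * \<tau> powr (1 - p) * (\<integral>x. norm (f x) powr p \<partial>\<sigma>))"
      using C2 k I0 by (simp add: ennreal_mult[symmetric] m_def mult_ac)
    have e2: "ennreal (m * \<tau>) = ennreal (C\<^sub>2 * \<tau>) * ennreal ((3 * k) ^ CARD('n))"
      using C2 k \<tau> by (simp add: ennreal_mult[symmetric] m_def mult_ac)
    show ?thesis using fin unfolding e1 e2 \<Omega>_def by (simp add: mult_ac add_ac)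
  qed
  show ?thesis
    by (rule exI[of _ \<beta>], rule exI[of _ m], intro conjI allI impI \<beta>(1) m0, rule main) auto
qed

end

context two_weight
begin

lemma integral_powr_nonneg: "0 \<le> (\<integral>x. norm (f x :: complex) powr p \<partial>\<sigma>)"
  by (rule Bochner_Integration.integral_nonneg) simp

text \<open>For G t = t^p \<omega>(T f > t) the good lambda inequality becomes G (3 t) \<le> E I + G
  t / 2. The supremum of G over t \<le> \<alpha> is then at most 2 E I, provided that it is finite;
  compact support and the weak type of M guarantee this.\<close>

lemma testing_imp_weak_bound_compact:
  assumes test: "testing_condition p p' \<sigma> \<omega> T C\<^sub>2" and D: "weak_bound p \<sigma> \<omega> M D"
  shows "\<exists>E\<ge>0. \<forall>f \<rho> \<alpha>. f \<in> Lp_fun p \<sigma> \<and> 0 < \<rho> \<and> (\<forall>y. y \<notin> cball 0 \<rho> \<longrightarrow> f y = 0) \<and> 0 < \<alpha> \<longrightarrow>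
     ennreal (\<alpha> powr p) * emeasure \<omega> {x. ennreal \<alpha> < T f x} \<le> ennreal (E * (\<integral>x. norm (f x) powr p \<partial>\<sigma>))"
proof -
  have D0: "0 \<le> D" and D: "\<And>f t. f \<in> Lp_fun p \<sigma> \<Longrightarrow> 0 < t \<Longrightarrow>
      ennreal (t powr p) * emeasure \<omega> {x. ennreal t < M f x} \<le> ennreal (D * (\<integral>x. norm (f x) powr p \<partial>\<sigma>))"
    using D by (auto simp: weak_bound_def)
  have "testing_condition p p' \<sigma> \<omega> T \<bar>C\<^sub>2\<bar>"
    by (rule testing_condition_mono[OF test]) simp
  from good_lambda[OF this] obtain \<beta> m where \<beta>: "0 < \<beta>" and m: "0 \<le> m"
    and gl: "\<And>f \<rho> \<alpha> \<tau>. f \<in> Lp_fun p \<sigma> \<and> 0 < \<rho> \<and> (\<forall>y. y \<notin> cball 0 \<rho> \<longrightarrow> f y = 0) \<and> 0 < \<alpha> \<and> 0 < \<tau> \<Longrightarrow>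
      ennreal (\<alpha> powr p) * emeasure \<omega> {x. ennreal (3 * \<alpha>) < T f x} \<le>
      ennreal (\<alpha> powr p) * emeasure \<omega> {x. ennreal (\<beta> * \<alpha>) < M f x}
      + ennreal (m * \<tau> powr (1 - p) * (\<integral>x. norm (f x) powr p \<partial>\<sigma>))
      + ennreal (m * \<tau>) * (ennreal (\<alpha> powr p) * emeasure \<omega> {x. ennreal \<alpha> < T f x})" by auto
  \<comment> \<open>Makes the coefficient 3^p m \<tau> of the absorbed term at most 1 / 2.\<close>
  define \<tau> where "\<tau> = 1 / (2 * 3 powr p * (m + 1))"
  have \<tau>: "0 < \<tau>" "3 powr p * (m * \<tau>) \<le> 1 / 2"
  proof -
    show "0 < \<tau>" using m by (simp add: \<tau>_def)
    have eq: "3 powr p * (m * \<tau>) = m / (m + 1) / 2" by (simp add: \<tau>_def)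
    show "3 powr p * (m * \<tau>) \<le> 1 / 2" unfolding eq using m by simp
  qed
  define E where "E = 3 powr p * (\<beta> powr (- p) * D + m * \<tau> powr (1 - p))"
  have E0: "0 \<le> E" using D0 m by (simp add: E_def)
  have main: "ennreal (\<alpha> powr p) * emeasure \<omega> {x. ennreal \<alpha> < T f x} \<le> ennreal (2 * E * (\<integral>x. norm (f x) powr p \<partial>\<sigma>))"
    if f: "f \<in> Lp_fun p \<sigma>" and \<rho>: "0 < \<rho>" and supp: "\<forall>y. y \<notin> cball 0 \<rho> \<longrightarrow> f y = 0" and \<alpha>: "0 < \<alpha>" for f \<rho> \<alpha>
  proof -
    define I where "I = (\<integral>x. norm (f x) powr p \<partial>\<sigma>)"
    have I0: "0 \<le> I" unfolding I_def by (rule integral_powr_nonneg)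
    note fl = Lp_loc_integrable[OF f]
    have fm: "f \<in> borel_measurable borel" using fl by (simp add: loc_integrable_def)
    define G where "G t = ennreal (t powr p) * emeasure \<omega> {x. ennreal t < T f x}" for t
    have Msc: "ennreal (t powr p) * emeasure \<omega> {x. ennreal (c * t) < M f x} \<le> ennreal (c powr (- p) * (D * I))"
      if "0 < t" "0 < c" for t c
    proof -
      have "ennreal (t powr p) * emeasure \<omega> {x. ennreal (c * t) < M f x}
        = ennreal (c powr (- p)) * (ennreal ((c * t) powr p) * emeasure \<omega> {x. ennreal (c * t) < M f x})"
      proof -
        have "t powr p = c powr (- p) * (c * t) powr p"
          using that by (simp add: powr_mult powr_minus)
        thus ?thesis using that by (simp add: ennreal_mult mult.assoc)
      qed
      also have "\<dots> \<le> ennreal (c powr (- p)) * ennreal (D * I)"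
        unfolding I_def using that by (intro mult_left_mono D f) auto
      finally show ?thesis using D0 I0 by (simp add: ennreal_mult)
    qed
    have step: "G (3 * t) \<le> ennreal (E * I) + ennreal (1 / 2) * G t" if t: "0 < t" for t
    proof -
      have "G (3 * t) = ennreal (3 powr p) * (ennreal (t powr p) * emeasure \<omega> {x. ennreal (3 * t) < T f x})"
        using t by (simp add: G_def powr_mult ennreal_mult mult.assoc)
      also have "\<dots> \<le> ennreal (3 powr p) * (ennreal (\<beta> powr (- p) * (D * I)) + ennreal (m * \<tau> powr (1 - p) * I) + ennreal (m * \<tau>) * G t)"
      proof (intro mult_left_mono)
        have "ennreal (t powr p) * emeasure \<omega> {x. ennreal (3 * t) < T f x} \<le>
          ennreal (t powr p) * emeasure \<omega> {x. ennreal (\<beta> * t) < M f x}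
          + ennreal (m * \<tau> powr (1 - p) * I) + ennreal (m * \<tau>) * G t"
          unfolding I_def G_def using f \<rho> supp t \<tau> by (intro gl[of f \<rho>]) auto
        also have "\<dots> \<le> ennreal (\<beta> powr (- p) * (D * I)) + ennreal (m * \<tau> powr (1 - p) * I) + ennreal (m * \<tau>) * G t"
          by (intro add_right_mono Msc t \<beta>)
        finally show "ennreal (t powr p) * emeasure \<omega> {x. ennreal (3 * t) < T f x} \<le> \<dots>" .
      qed simp
      also have "\<dots> = ennreal (E * I) + ennreal (3 powr p * (m * \<tau>)) * G t"
      proof -
        have "E * I = 3 powr p * (\<beta> powr (- p) * (D * I) + m * \<tau> powr (1 - p) * I)"
          by (simp add: E_def algebra_simps)
        thus ?thesis using D0 I0 m \<tau>(1)
          by (simp add: ennreal_mult[of "3 powr p"] ennreal_plus distrib_left mult.assoc)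
      qed
      also have "\<dots> \<le> ennreal (E * I) + ennreal (1 / 2) * G t"
        by (intro add_left_mono mult_right_mono ennreal_leI \<tau>(2)) simp
      finally show ?thesis .
    qed
    \<comment> \<open>Only levels up to \<alpha>: dividing a level by 3 stays in the range, and t^p
      \<le> \<alpha>^p in front of the measure of a fixed ball.\<close>
    define H where "H = (SUP t\<in>{0<..\<alpha>}. G t)"
    define c where "c = 8 ^ CARD('n) * C + 1"
    have c: "1 \<le> c" using C0 by (simp add: c_def)
    \<comment> \<open>Outside the ball of radius 2 \<rho>, T f is at most c M f, so a superlevel set
      of T f lies in this ball together with a superlevel set of M f.\<close>
    have "H \<le> ennreal (\<alpha> powr p) * emeasure \<omega> (cball 0 (2 * \<rho>)) + ennreal ((1 / c) powr (- p) * (D * I))"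
      unfolding H_def
    proof (rule SUP_least)
      fix t assume t: "t \<in> {0<..\<alpha>}"
      have "{x. ennreal t < T f x} \<subseteq> cball 0 (2 * \<rho>) \<union> {x. ennreal (1 / c * t) < M f x}"
      proof
        fix x assume x: "x \<in> {x. ennreal t < T f x}"
        show "x \<in> cball 0 (2 * \<rho>) \<union> {x. ennreal (1 / c * t) < M f x}"
        proof (rule ccontr)
          assume "\<not> ?thesis"
          hence "2 * \<rho> \<le> norm x" and M: "M f x \<le> ennreal (1 / c * t)" by auto
          hence "T f x \<le> ennreal (8 ^ CARD('n) * C) * M f x" using T_far(2)[OF fl \<rho>] supp by auto
          also have "\<dots> \<le> ennreal (8 ^ CARD('n) * C) * ennreal (1 / c * t)" by (intro mult_left_mono M) simp
          also have "\<dots> = ennreal (8 ^ CARD('n) * C * (1 / c * t))"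
            using C0 c t by (intro ennreal_mult[symmetric]) auto
          also have "\<dots> \<le> ennreal t"
          proof (intro ennreal_leI)
            have "8 ^ CARD('n) * C * (1 / c * t) = (c - 1) / c * t" by (simp add: c_def)
            also have "\<dots> \<le> 1 * t" using c t by (intro mult_right_mono) auto
            finally show "8 ^ CARD('n) * C * (1 / c * t) \<le> t" by simp
          qed
          finally show False using x by simp
        qed
      qed
      hence "emeasure \<omega> {x. ennreal t < T f x} \<le> emeasure \<omega> (cball 0 (2 * \<rho>) \<union> {x. ennreal (1 / c * t) < M f x})"
        using open_maximal_superlevel[OF \<sigma> fm, of "1 / c * t"] c t
        by (intro emeasure_mono) (auto simp: sets_lf[OF \<omega>])
      also have "\<dots> \<le> emeasure \<omega> (cball 0 (2 * \<rho>)) + emeasure \<omega> {x. ennreal (1 / c * t) < M f x}"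
        using open_maximal_superlevel[OF \<sigma> fm, of "1 / c * t"] c t
        by (intro emeasure_subadditive) (auto simp: sets_lf[OF \<omega>])
      finally have "G t \<le> ennreal (t powr p) * emeasure \<omega> (cball 0 (2 * \<rho>)) + ennreal (t powr p) * emeasure \<omega> {x. ennreal (1 / c * t) < M f x}"
        unfolding G_def distrib_left[symmetric] by (rule mult_left_mono) simp
      also have "\<dots> \<le> ennreal (\<alpha> powr p) * emeasure \<omega> (cball 0 (2 * \<rho>)) + ennreal ((1 / c) powr (- p) * (D * I))"
        using t c p by (intro add_mono mult_right_mono ennreal_leI powr_mono2 Msc) auto
      finally show "G t \<le> \<dots>" .
    qed
    also have "\<dots> < top"
      using emeasure_bounded_lf[OF \<omega>, of "cball 0 (2 * \<rho>)"] by (simp add: ennreal_mult_less_top)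
    finally obtain h where h: "H = ennreal h" "0 \<le> h" by (cases H) auto
    have "H \<le> ennreal (E * I) + ennreal (1 / 2) * H"
      unfolding H_def
    proof (rule SUP_least)
      fix t assume t: "t \<in> {0<..\<alpha>}"
      have "G (3 * (t / 3)) \<le> ennreal (E * I) + ennreal (1 / 2) * G (t / 3)" by (rule step) (use t in auto)
      also have "\<dots> \<le> ennreal (E * I) + ennreal (1 / 2) * (SUP t\<in>{0<..\<alpha>}. G t)"
        using t by (intro add_left_mono mult_left_mono SUP_upper) auto
      finally show "G t \<le> ennreal (E * I) + ennreal (1 / 2) * (SUP t\<in>{0<..\<alpha>}. G t)" by simp
    qed
    also have "\<dots> = ennreal (E * I + h / 2)"
    proof -
      have "ennreal (1 / 2) * ennreal h = ennreal (h / 2)"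
        by (subst ennreal_mult[symmetric]) (use h(2) in auto)
      thus ?thesis unfolding h(1) using E0 I0 h(2) by simp
    qed
    finally have "h \<le> 2 * E * I" using h E0 I0 by (simp del: ennreal_plus)
    moreover have "G \<alpha> \<le> H" unfolding H_def using \<alpha> by (intro SUP_upper) auto
    ultimately show ?thesis unfolding h G_def I_def by (meson ennreal_leI order_trans)
  qed
  show ?thesis
    by (rule exI[of _ "2 * E"], intro conjI allI impI, use E0 in simp, rule main) auto
qed

text \<open>A level exceeded by the supremum is exceeded by a single truncation. Its kernel has
  bounded support, so restricting f to a large ball does not change the integral.\<close>

lemma T_superlevel_approx:
  assumes f: "loc_integrable \<sigma> f" and x: "ennreal \<alpha> < T f x"
  shows "\<exists>k0. \<forall>k\<ge>k0. ennreal \<alpha> < T (\<lambda>y. indicator (cball 0 (real k)) y * f y) x"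
proof -
  obtain \<phi> where \<phi>: "\<phi> \<in> \<Phi>" "ennreal \<alpha> < ennreal (norm (\<integral>y. K x y * of_real (\<phi> (x - y)) * f y \<partial>\<sigma>))"
    using x by (auto simp: trunc_max_def less_SUP_iff)
  obtain R where R: "\<And>w. R \<le> norm w \<Longrightarrow> \<phi> w = 0"
    using trunc_props(3)[of \<phi>] \<phi> by blast
  obtain k0 :: nat where k0: "norm x + R \<le> real k0" using real_arch_simple by blast
  show ?thesis
  proof (intro exI[of _ k0] allI impI)
    fix k assume "k \<ge> k0"
    have eq: "K x y * of_real (\<phi> (x - y)) * f y = K x y * of_real (\<phi> (x - y)) * (indicator (cball 0 (real k)) y * f y)" for y
    proof (cases "norm y \<le> real k")
      case False
      hence "R \<le> norm (x - y)" using k0 \<open>k \<ge> k0\<close> norm_triangle_ineq4[of x "x - y"] by simp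
      thus ?thesis using R by simp
    qed simp
    have "ennreal \<alpha> < ennreal (norm (\<integral>y. K x y * of_real (\<phi> (x - y)) * (indicator (cball 0 (real k)) y * f y) \<partial>\<sigma>))"
      using \<phi>(2) by (simp only: eq[symmetric])
    thus "ennreal \<alpha> < T (\<lambda>y. indicator (cball 0 (real k)) y * f y) x"
      using trunc_le_T[of \<phi>] \<phi>(1) by (meson insertI2 less_le_trans)
  qed
qed

theorem testing_imp_weak_bound:
  assumes "testing_condition p p' \<sigma> \<omega> T C\<^sub>2" "weak_bound p \<sigma> \<omega> M D"
  shows "\<exists>E. weak_bound p \<sigma> \<omega> T E"
proof -
  from testing_imp_weak_bound_compact[OF assms] obtain E where E0: "0 \<le> E"
    and E: "\<And>f \<rho> \<alpha>. f \<in> Lp_fun p \<sigma> \<and> 0 < \<rho> \<and> (\<forall>y. y \<notin> cball 0 \<rho> \<longrightarrow> f y = 0) \<and> 0 < \<alpha> \<Longrightarrow>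
     ennreal (\<alpha> powr p) * emeasure \<omega> {x. ennreal \<alpha> < T f x} \<le> ennreal (E * (\<integral>x. norm (f x) powr p \<partial>\<sigma>))"
    by auto
  have "ennreal (\<alpha> powr p) * emeasure \<omega> {x. ennreal \<alpha> < T f x} \<le> ennreal (E * (\<integral>x. norm (f x) powr p \<partial>\<sigma>))"
    if f: "f \<in> Lp_fun p \<sigma>" and \<alpha>: "0 < \<alpha>" for f \<alpha>
  proof -
    note fl = Lp_loc_integrable[OF f]
    let ?f = "\<lambda>k y. indicator (cball 0 (real k)) y * f y"
    \<comment> \<open>The superlevel sets of the restricted functions may fail to increase with k;
      their tail intersections do increase.\<close>
    define U where "U k = (\<Inter>j\<in>{k..}. {x. ennreal \<alpha> < T (?f j) x})" for k
    have Um: "U k \<in> sets \<omega>" for k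
      unfolding U_def sets_lf[OF \<omega>]
      by (intro sets.countable_INT') (auto intro!: borel_open[OF open_T_superlevel] loc_integrable_indicator[OF fl])
    have U: "ennreal (\<alpha> powr p) * emeasure \<omega> (U k) \<le> ennreal (E * (\<integral>x. norm (f x) powr p \<partial>\<sigma>))" for k
    proof -
      \<comment> \<open>\<open>Suc k\<close>, because the bound for compact support asks for a ball
        of positive radius.\<close>
      have m: "cball 0 (real (Suc k)) \<in> sets \<sigma>" by (simp add: sets_lf[OF \<sigma>])
      note fk = Lp_fun_indicator[OF f m]
      have "U k \<subseteq> {x. ennreal \<alpha> < T (?f (Suc k)) x}" unfolding U_def by (rule INT_lower) simp
      hence "emeasure \<omega> (U k) \<le> emeasure \<omega> {x. ennreal \<alpha> < T (?f (Suc k)) x}"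
        by (rule emeasure_mono)
          (simp only: sets_lf[OF \<omega>], intro borel_open open_T_superlevel loc_integrable_indicator[OF fl] cball_in_borel)
      hence "ennreal (\<alpha> powr p) * emeasure \<omega> (U k) \<le> ennreal (\<alpha> powr p) * emeasure \<omega> {x. ennreal \<alpha> < T (?f (Suc k)) x}"
        by (rule mult_left_mono) simp
      also have "\<dots> \<le> ennreal (E * (\<integral>x. norm (?f (Suc k) x) powr p \<partial>\<sigma>))"
        by (rule E[where \<rho>="real (Suc k)"]) (use fk(1) \<alpha> in auto)
      also have "\<dots> \<le> ennreal (E * (\<integral>x. norm (f x) powr p \<partial>\<sigma>))"
      proof (intro ennreal_leI mult_left_mono E0 integral_mono)
        show "integrable \<sigma> (\<lambda>x. norm (?f (Suc k) x) powr p)" "integrable \<sigma> (\<lambda>x. norm (f x) powr p)"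
          using fk(1) f by (simp_all add: Lp_fun_def)
        show "norm (?f (Suc k) x) powr p \<le> norm (f x) powr p" for x by (auto split: split_indicator)
      qed
      finally show ?thesis .
    qed
    have "{x. ennreal \<alpha> < T f x} \<subseteq> (\<Union>k. U k)"
      using T_superlevel_approx[OF fl] by (fastforce simp: U_def)
    hence "emeasure \<omega> {x. ennreal \<alpha> < T f x} \<le> emeasure \<omega> (\<Union>k. U k)"
      using Um by (intro emeasure_mono) auto
    also have "\<dots> = (SUP k. emeasure \<omega> (U k))"
      using Um by (intro SUP_emeasure_incseq[symmetric]) (auto simp: incseq_def U_def)
    finally have "ennreal (\<alpha> powr p) * emeasure \<omega> {x. ennreal \<alpha> < T f x} \<le> ennreal (\<alpha> powr p) * (SUP k. emeasure \<omega> (U k))"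
      by (rule mult_left_mono) simp
    also have "\<dots> = (SUP k. ennreal (\<alpha> powr p) * emeasure \<omega> (U k))" by (rule SUP_mult_left_ennreal)
    also have "\<dots> \<le> ennreal (E * (\<integral>x. norm (f x) powr p \<partial>\<sigma>))" by (intro SUP_least U)
    finally show ?thesis .
  qed
  thus ?thesis using E0 unfolding weak_bound_def by blast
qed

lemma T_weak_bound_imp_testing:
  assumes "weak_bound p \<sigma> \<omega> T D"
  shows "\<exists>C. testing_condition p p' \<sigma> \<omega> T C"
  by (rule weak_bound_imp_testing[OF \<omega> \<sigma> p _ assms]) (auto intro: T_measurable Lp_loc_integrable)

end

subsection \<open>Density points by Vitali coverings\<close>

text \<open>A fine Vitali covering by balls centred in E and contained in an open set of almost the
  same measure. It turns estimates on all balls centred in E into estimates on the measure of E, in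
  place of a density theorem.\<close>

lemma vitali_approx:
  fixes E :: "(real ^ 'n) set"
  assumes E: "E \<in> sets borel" and e: "0 < (e::real)"
  obtains I where "countable I" "\<And>i. i \<in> I \<Longrightarrow> fst i \<in> E \<and> 0 < snd i"
    "disjoint_family_on (\<lambda>i. cball (fst i) (snd i)) I"
    "emeasure lborel (E - (\<Union>i\<in>I. cball (fst i) (snd i))) = 0"
    "emeasure lborel ((\<Union>i\<in>I. cball (fst i) (snd i)) - E) \<le> ennreal e"
proof -
  obtain U where U: "open U" "E \<subseteq> U" "emeasure lborel (U - E) < e"
    by (rule outer_regular_lborel[OF E e])
  let ?K = "{i. fst i \<in> E \<and> 0 < snd i \<and> cball (fst i) (snd i) \<subseteq> U}"
  obtain I where I: "countable I" "I \<subseteq> ?K"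
    and dis: "pairwise (\<lambda>i j. disjnt (cball (fst i) (snd i)) (cball (fst j) (snd j))) I"
    and neg: "negligible (E - (\<Union>i\<in>I. cball (fst i) (snd i)))"
  proof (rule Vitali_covering_theorem_cballs[where K="?K" and a=fst and r=snd and S=E])
    fix x d assume x: "x \<in> E" and d: "0 < (d::real)"
    obtain s where s: "0 < s" "cball x s \<subseteq> U" using U x by (metis open_contains_cball subsetD)
    show "\<exists>i. i \<in> ?K \<and> x \<in> cball (fst i) (snd i) \<and> snd i < d"
      using s d x subset_cball[of "min s (d / 2)" s x]
      by (intro exI[of _ "(x, min s (d / 2))"]) (auto simp: min_def)
  qed auto
  have un: "(\<Union>i\<in>I. cball (fst i) (snd i)) \<in> sets borel" using I(1) by auto
  have "emeasure lborel (E - (\<Union>i\<in>I. cball (fst i) (snd i))) = 0"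
    using neg E un by (auto simp: negligible_iff_null_sets null_sets_completion_iff null_sets_def)
  moreover have "emeasure lborel ((\<Union>i\<in>I. cball (fst i) (snd i)) - E) \<le> ennreal e"
  proof -
    have "emeasure lborel ((\<Union>i\<in>I. cball (fst i) (snd i)) - E) \<le> emeasure lborel (U - E)"
      using I(2) U(1) E by (intro emeasure_mono) auto
    thus ?thesis using U(3) by simp
  qed
  moreover have "disjoint_family_on (\<lambda>i. cball (fst i) (snd i)) I"
    using dis by (auto simp: disjoint_family_on_def pairwise_def disjnt_def)
  ultimately show ?thesis using I by (intro that[of I]) auto
qed

lemma emeasure_eq_measure_finite: "emeasure M A < \<infinity> \<Longrightarrow> emeasure M A = ennreal (measure M A)"
  by (rule emeasure_eq_ennreal_measure) auto

text \<open>Summed over the disjoint balls of a Vitali family, the hypotheses give b |E| \<le> a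
  (|E| + e') with arbitrarily small excess e'.\<close>

lemma null_of_small_averages:
  fixes E :: "(real ^ 'n) set" and u :: "real ^ 'n \<Rightarrow> ennreal"
  assumes E: "E \<in> sets borel" "emeasure lborel E < \<infinity>" and u: "u \<in> borel_measurable borel"
    and ab: "0 \<le> a" "a < b" and low: "\<And>x. x \<in> E \<Longrightarrow> ennreal b \<le> u x"
    and avg: "\<And>x s. x \<in> E \<Longrightarrow> 0 < s \<Longrightarrow> (\<integral>\<^sup>+y\<in>cball x s. u y \<partial>lborel) \<le> ennreal a * emeasure lborel (cball x s)"
  shows "emeasure lborel E = 0"
proof -
  define m where "m = measure lborel E"
  have m: "emeasure lborel E = ennreal m" "0 \<le> m"
    using emeasure_eq_measure_finite[OF E(2)] by (auto simp: m_def)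
  note [measurable] = u E(1)
  have "b * m \<le> a * m + e" if e: "0 < e" for e
  proof -
    have "0 < e / (a + 1)" using e ab by simp
    from vitali_approx[OF E(1) this]
    obtain I where I: "countable I" "\<And>i. i \<in> I \<Longrightarrow> fst i \<in> E \<and> 0 < snd i"
      and dis: "disjoint_family_on (\<lambda>i. cball (fst i) (snd i)) I"
      and nul: "emeasure lborel (E - (\<Union>i\<in>I. cball (fst i) (snd i))) = 0"
      and small: "emeasure lborel ((\<Union>i\<in>I. cball (fst i) (snd i)) - E) \<le> ennreal (e / (a + 1))" by blast
    let ?U = "\<Union>i\<in>I. cball (fst i) (snd i)"
    have Um: "?U \<in> sets borel" using I(1) by auto
    have un: "emeasure N ?U = (\<integral>\<^sup>+i. emeasure N (cball (fst i) (snd i)) \<partial>count_space I)"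
      if "sets N = sets borel" for N :: "(real ^ 'n) measure"
      using I(1) dis that by (intro emeasure_UN_countable) auto
    have dm: "emeasure (density lborel u) A = (\<integral>\<^sup>+y\<in>A. u y \<partial>lborel)" if "A \<in> sets borel" for A
      using that u by (intro emeasure_density) auto
    have "ennreal (b * m) = (\<integral>\<^sup>+y. ennreal b * indicator E y \<partial>lborel)"
      using ab m by (simp add: nn_integral_cmult_indicator ennreal_mult)
    also have "\<dots> \<le> (\<integral>\<^sup>+y\<in>?U. u y \<partial>lborel)"
    proof (rule nn_integral_mono_AE)
      have "E - ?U \<in> null_sets lborel" using nul Um E(1) by auto
      hence "AE y in lborel. y \<notin> E - ?U" by (rule AE_not_in)
      thus "AE y in lborel. ennreal b * indicator E y \<le> u y * indicator ?U y"
        by eventually_elim (use low in \<open>auto split: split_indicator\<close>)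
    qed
    also have "\<dots> = (\<integral>\<^sup>+i. (\<integral>\<^sup>+y\<in>cball (fst i) (snd i). u y \<partial>lborel) \<partial>count_space I)"
      using un[of "density lborel u"] dm Um by simp
    also have "\<dots> \<le> (\<integral>\<^sup>+i. ennreal a * emeasure lborel (cball (fst i) (snd i)) \<partial>count_space I)"
      using I(2) by (intro nn_integral_mono avg) auto
    also have "\<dots> = ennreal a * emeasure lborel ?U" by (simp add: un nn_integral_cmult)
    also have "emeasure lborel ?U \<le> emeasure lborel E + emeasure lborel (?U - E)"
      using Um E(1) emeasure_mono[of ?U "E \<union> (?U - E)" lborel] emeasure_subadditive[of E lborel "?U - E"]
      by (auto intro: order_trans)
    also have "\<dots> \<le> ennreal m + ennreal (e / (a + 1))" using m small by simp
    finally have "ennreal (b * m) \<le> ennreal a * (ennreal m + ennreal (e / (a + 1)))"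
      by (simp add: mult_left_mono)
    also have "\<dots> = ennreal (a * (m + e / (a + 1)))"
      using ab m(2) e by (simp add: ennreal_mult)
    finally have "b * m \<le> a * (m + e / (a + 1))" using ab m(2) e by (subst (asm) ennreal_le_iff) auto
    also have "\<dots> \<le> a * m + e"
    proof -
      have "a / (a + 1) * e \<le> 1 * e" using ab e by (intro mult_right_mono) auto
      thus ?thesis by (simp add: distrib_left)
    qed
    finally show ?thesis .
  qed
  hence "b * m \<le> a * m" by (rule field_le_epsilon)
  hence "m = 0" using ab m(2) by (simp add: mult_le_cancel_right)
  thus ?thesis using m by simp
qed

text \<open>The density bound sees only the half ball; the remaining shell is the fraction 1 - 2^-n
  of the ball. Summing over a Vitali family gives |E| \<le> (a c + 1 - 2^-n) |E| up to a small
  error, which forces |E| = 0 when a c < 2^-n. The bound b is applied on the small excess outside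
  E.\<close>

lemma null_of_small_density:
  fixes E :: "(real ^ 'n) set" and u :: "real ^ 'n \<Rightarrow> ennreal"
  assumes E: "E \<in> sets borel" "emeasure lborel E < \<infinity>" and u: "u \<in> borel_measurable borel"
    and bnd: "AE y in lborel. u y \<le> ennreal b" "0 \<le> b" and ac: "0 \<le> a" "0 \<le> c" "a * c < 1 / 2 ^ CARD('n)"
    and cE: "AE y in lborel. y \<in> E \<longrightarrow> u y \<le> ennreal c"
    and dens: "\<And>x s. x \<in> E \<Longrightarrow> 0 < s \<Longrightarrow> emeasure lborel (E \<inter> cball x (s / 2)) \<le> ennreal a * (\<integral>\<^sup>+y\<in>cball x s. u y \<partial>lborel)"
  shows "emeasure lborel E = 0"
proof -
  define m where "m = measure lborel E"
  have m: "emeasure lborel E = ennreal m" "0 \<le> m"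
    using emeasure_eq_measure_finite[OF E(2)] by (auto simp: m_def)
  note [measurable] = u E(1)
  define \<theta> where "\<theta> = 1 / (2::real) ^ CARD('n)"
  have \<theta>: "0 < \<theta>" "\<theta> \<le> 1" by (auto simp: \<theta>_def)
  have "\<theta> * m \<le> a * c * m + e" if e: "0 < e" for e
  proof -
    \<comment> \<open>The excess enters the final estimate with a factor of at most a b + 1.\<close>
    define e' where "e' = e / (a * b + 1)"
    have e': "0 < e'" "(a * b + 1) * e' = e"
    proof -
      have "0 < a * b + 1" using ac bnd by (simp add: add_nonneg_pos)
      thus "0 < e'" "(a * b + 1) * e' = e" using e by (auto simp: e'_def)
    qed
    from vitali_approx[OF E(1) e'(1)]
    obtain I where I: "countable I" "\<And>i. i \<in> I \<Longrightarrow> fst i \<in> E \<and> 0 < snd i"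
      and dis: "disjoint_family_on (\<lambda>i. cball (fst i) (snd i)) I"
      and nul: "emeasure lborel (E - (\<Union>i\<in>I. cball (fst i) (snd i))) = 0"
      and small: "emeasure lborel ((\<Union>i\<in>I. cball (fst i) (snd i)) - E) \<le> ennreal e'" by blast
    let ?U = "\<Union>i\<in>I. cball (fst i) (snd i)"
    have Um: "?U \<in> sets borel" using I(1) by auto
    have un: "emeasure N ?U = (\<integral>\<^sup>+i. emeasure N (cball (fst i) (snd i)) \<partial>count_space I)"
      if "sets N = sets borel" for N :: "(real ^ 'n) measure"
      using I(1) dis that by (intro emeasure_UN_countable) auto
    have dm: "emeasure (density lborel u) A = (\<integral>\<^sup>+y\<in>A. u y \<partial>lborel)" if "A \<in> sets borel" for A
      using that u by (intro emeasure_density) auto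
    have each: "emeasure lborel (E \<inter> cball (fst i) (snd i))
        \<le> ennreal a * (\<integral>\<^sup>+y\<in>cball (fst i) (snd i). u y \<partial>lborel) + ennreal (1 - \<theta>) * emeasure lborel (cball (fst i) (snd i))"
      if i: "i \<in> I" for i
    proof -
      let ?x = "fst i" and ?s = "snd i"
      have s: "0 < ?s" "?x \<in> E" using I(2)[OF i] by auto
      have "cball ?x (?s / 2) \<subseteq> cball ?x ?s" using s by (intro subset_cball) simp
      hence "E \<inter> cball ?x ?s \<subseteq> (E \<inter> cball ?x (?s / 2)) \<union> (cball ?x ?s - cball ?x (?s / 2))" by blast
      hence "emeasure lborel (E \<inter> cball ?x ?s) \<le> emeasure lborel ((E \<inter> cball ?x (?s / 2)) \<union> (cball ?x ?s - cball ?x (?s / 2)))"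
        using E(1) by (intro emeasure_mono) auto
      also have "\<dots> \<le> emeasure lborel (E \<inter> cball ?x (?s / 2)) + emeasure lborel (cball ?x ?s - cball ?x (?s / 2))"
        using E(1) by (intro emeasure_subadditive) auto
      also have "emeasure lborel (cball ?x ?s - cball ?x (?s / 2)) = ennreal (1 - \<theta>) * emeasure lborel (cball ?x ?s)"
      proof -
        have "emeasure lborel (cball ?x ?s - cball ?x (?s / 2)) = emeasure lborel (cball ?x ?s) - emeasure lborel (cball ?x (?s / 2))"
          using s emeasure_bounded_finite[of "cball ?x (?s / 2)"] by (intro emeasure_Diff subset_cball) auto
        also have "\<dots> = ennreal ((1 - \<theta>) * (unit_ball_vol CARD('n) * ?s ^ CARD('n)))"
          using s by (simp add: emeasure_cball ennreal_minus \<theta>_def power_divide algebra_simps)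
        finally show ?thesis using s \<theta> by (simp add: emeasure_cball ennreal_mult)
      qed
      finally show ?thesis using dens[OF s(2,1)] by (meson add_right_mono order_trans)
    qed
    have UE: "emeasure N ?U \<le> emeasure N E + emeasure N (?U - E)" if "sets N = sets borel" for N
      using Um E(1) that emeasure_mono[of ?U "E \<union> (?U - E)" N] emeasure_subadditive[of E N "?U - E"]
      by (auto intro: order_trans)
    have "emeasure lborel E \<le> emeasure lborel (E \<inter> ?U) + emeasure lborel (E - ?U)"
      using Um E(1) emeasure_subadditive[of "E \<inter> ?U" lborel "E - ?U"] by (simp add: Int_Diff_Un)
    also have "\<dots> = emeasure lborel (E \<inter> ?U)" using nul by simp
    also have "E \<inter> ?U = (\<Union>i\<in>I. E \<inter> cball (fst i) (snd i))" by blast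
    also have "emeasure lborel \<dots> \<le> (\<integral>\<^sup>+i. emeasure lborel (E \<inter> cball (fst i) (snd i)) \<partial>count_space I)"
      using I(1) E(1) by (intro emeasure_UN_le_nn_integral) auto
    also have "\<dots> \<le> (\<integral>\<^sup>+i. ennreal a * (\<integral>\<^sup>+y\<in>cball (fst i) (snd i). u y \<partial>lborel)
        + ennreal (1 - \<theta>) * emeasure lborel (cball (fst i) (snd i)) \<partial>count_space I)"
      by (intro nn_integral_mono each) simp
    also have "\<dots> = ennreal a * emeasure (density lborel u) ?U + ennreal (1 - \<theta>) * emeasure lborel ?U"
      by (simp add: nn_integral_add nn_integral_cmult un dm)
    also have "\<dots> \<le> ennreal a * (ennreal (c * m) + ennreal (b * e')) + ennreal (1 - \<theta>) * (ennreal m + ennreal e')"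
    proof (intro add_mono mult_left_mono)
      have "emeasure (density lborel u) E \<le> (\<integral>\<^sup>+y. ennreal c * indicator E y \<partial>lborel)"
        unfolding dm[OF E(1)] using cE by (intro nn_integral_mono_AE) (auto split: split_indicator)
      hence 1: "emeasure (density lborel u) E \<le> ennreal (c * m)"
        using ac m by (simp add: nn_integral_cmult_indicator ennreal_mult)
      have UE': "?U - E \<in> sets borel" using Um E(1) by auto
      have "emeasure (density lborel u) (?U - E) \<le> (\<integral>\<^sup>+y. ennreal b * indicator (?U - E) y \<partial>lborel)"
        unfolding dm[OF UE'] using bnd(1) by (intro nn_integral_mono_AE) (auto split: split_indicator)
      also have "\<dots> = ennreal b * emeasure lborel (?U - E)" using UE' by (simp add: nn_integral_cmult_indicator)
      also have "\<dots> \<le> ennreal b * ennreal e'" by (intro mult_left_mono small) simp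
      finally have 2: "emeasure (density lborel u) (?U - E) \<le> ennreal (b * e')"
        using bnd e' by (simp add: ennreal_mult)
      show "emeasure (density lborel u) ?U \<le> ennreal (c * m) + ennreal (b * e')"
        using UE[of "density lborel u"] add_mono[OF 1 2] by simp
      show "emeasure lborel ?U \<le> ennreal m + ennreal e'"
        using UE[of lborel] small m by (simp add: add_left_mono order_trans)
    qed simp_all
    also have "\<dots> = ennreal (a * (c * m + b * e') + (1 - \<theta>) * (m + e'))"
      using ac bnd m(2) e' \<theta> by (simp add: ennreal_mult ennreal_plus)
    finally have "m \<le> a * (c * m + b * e') + (1 - \<theta>) * (m + e')"
      unfolding m(1) using ac bnd m(2) e' \<theta> by (subst (asm) ennreal_le_iff) auto
    also have "\<dots> = a * c * m + (a * b + 1) * e' + m - \<theta> * m - \<theta> * e'" by (simp add: algebra_simps)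
    finally have "\<theta> * m + \<theta> * e' \<le> a * c * m + e" unfolding e'(2) by simp
    moreover have "0 \<le> \<theta> * e'" using \<theta> e' by simp
    ultimately show ?thesis by simp
  qed
  hence "\<theta> * m \<le> a * c * m" by (rule field_le_epsilon)
  hence "m = 0" using ac(3) m(2) unfolding \<theta>_def[symmetric] by (simp add: mult_le_cancel_right)
  thus ?thesis using m by simp
qed

text \<open>The complement is a union of possibly uncountably many open sets; by Lindelof countably
  many suffice, so the exceptional null sets can be united.\<close>

lemma AE_ess_support:
  fixes g :: "real ^ 'n \<Rightarrow> complex"
  shows "AE x in lborel. x \<notin> ess_support g \<longrightarrow> g x = 0"
proof -
  let ?F = "{U. open U \<and> (AE x in lborel. x \<in> U \<longrightarrow> g x = 0)}"
  obtain F where F: "F \<subseteq> ?F" "countable F" "\<Union>F = \<Union>?F"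
    by (rule Lindelof[of ?F]) auto
  have "AE x in lborel. \<forall>U\<in>F. x \<in> U \<longrightarrow> g x = 0"
    using F(1,2) by (subst AE_ball_countable) auto
  thus ?thesis
    by eventually_elim (use F(3) in \<open>auto simp: ess_support_def\<close>)
qed

lemma closed_ess_support: "closed (ess_support g)"
  by (auto simp: ess_support_def closed_def)

lemma ess_support_restrict:
  assumes "open V" "\<And>x. x \<in> V \<Longrightarrow> h x = 0" "\<And>x. h x = 0 \<or> h x = g x"
  shows "ess_support h \<subseteq> ess_support g - V"
proof -
  have "V \<subseteq> - ess_support h"
    using assms(1,2) by (auto simp: ess_support_def intro!: exI[of _ V])
  moreover have "- ess_support g \<subseteq> - ess_support h"
  proof (rule subsetI)
    fix x assume "x \<in> - ess_support g"
    then obtain U where U: "open U" "x \<in> U" "AE y in lborel. y \<in> U \<longrightarrow> g y = 0"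
      by (auto simp: ess_support_def)
    from U(3) have "AE y in lborel. y \<in> U \<longrightarrow> h y = 0"
      by eventually_elim (metis assms(3))
    thus "x \<in> - ess_support h" using U by (auto simp: ess_support_def)
  qed
  ultimately show ?thesis by blast
qed

subsection \<open>Singular integrals and their maximal truncations\<close>

lemma lf_lborel: "locally_finite_borel (lborel :: (real ^ 'n) measure)"
  using emeasure_bounded_finite by (auto simp: locally_finite_borel_def dest: compact_imp_bounded)

lemma Lp_chebyshev:
  assumes h: "h \<in> Lp_fun q \<mu>" and q: "0 < q" and s: "0 < s"
  shows "emeasure \<mu> {x \<in> space \<mu>. s < norm (h x)} \<le> ennreal (s powr (- q) * (\<integral>x. norm (h x) powr q \<partial>\<mu>))"
proof -
  have [measurable]: "h \<in> borel_measurable \<mu>" and i: "integrable \<mu> (\<lambda>x. norm (h x) powr q)"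
    using h by (auto simp: Lp_fun_def)
  have "emeasure \<mu> {x \<in> space \<mu>. s < norm (h x)} = (\<integral>\<^sup>+x. indicator {x \<in> space \<mu>. s < norm (h x)} x \<partial>\<mu>)"
    by (intro nn_integral_indicator[symmetric]) measurable
  also have "\<dots> \<le> (\<integral>\<^sup>+x. ennreal (s powr (- q)) * ennreal (norm (h x) powr q) \<partial>\<mu>)"
  proof (intro nn_integral_mono)
    fix x
    have "1 \<le> s powr (- q) * norm (h x) powr q" if "s < norm (h x)"
    proof -
      have "s powr q \<le> norm (h x) powr q" using that s q by (intro powr_mono2) auto
      hence "s powr (- q) * s powr q \<le> s powr (- q) * norm (h x) powr q" by (intro mult_left_mono) auto
      thus ?thesis using s by (simp add: powr_add[symmetric])
    qed
    thus "indicator {x \<in> space \<mu>. s < norm (h x)} x \<le> ennreal (s powr (- q)) * ennreal (norm (h x) powr q)"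
      by (auto split: split_indicator simp: ennreal_mult[symmetric])
  qed
  also have "\<dots> = ennreal (s powr (- q)) * (\<integral>\<^sup>+x. ennreal (norm (h x) powr q) \<partial>\<mu>)"
    by (intro nn_integral_cmult) measurable
  also have "\<dots> = ennreal (s powr (- q) * (\<integral>x. norm (h x) powr q \<partial>\<mu>))"
    using i by (simp add: nn_integral_eq_integral ennreal_mult)
  finally show ?thesis .
qed

text \<open>Where the restricted f lives, the distances to x are between a and norm x + R, and some
  cutoff of the family is one there. So the untruncated integral is among those of the
  supremum.\<close>

lemma (in trunc_setting) kernel_integral_le_T:
  assumes f: "loc_integrable \<sigma> f" and S: "S \<in> sets borel" and sep: "\<And>y. y \<in> S \<Longrightarrow> a \<le> norm (x - y)" and a: "0 < a"
    and supp: "AE y in \<sigma>. y \<in> S \<longrightarrow> R < norm y \<longrightarrow> f y = 0"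
  shows "ennreal (norm (\<integral>y. K x y * (indicator S y * f y) \<partial>\<sigma>)) \<le> T (\<lambda>y. indicator S y * f y) x"
proof -
  have "\<forall>a>0. \<forall>R. \<exists>\<phi>\<in>\<Phi>. \<forall>w. a \<le> norm w \<and> norm w \<le> R \<longrightarrow> \<phi> w = 1"
    using \<Phi> unfolding truncation_family_def by blast
  then obtain \<phi> where \<phi>: "\<phi> \<in> \<Phi>" "\<And>w. a \<le> norm w \<Longrightarrow> norm w \<le> norm x + R \<Longrightarrow> \<phi> w = 1"
    using a by blast
  have fm [measurable]: "f \<in> borel_measurable borel" using f by (simp add: loc_integrable_def)
  have fS: "(\<lambda>y. indicator S y * f y) \<in> borel_measurable borel"
    using loc_integrable_indicator[OF f S] by (simp add: loc_integrable_def)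
  have "(\<integral>y. K x y * (indicator S y * f y) \<partial>\<sigma>) = (\<integral>y. K x y * of_real (\<phi> (x - y)) * (indicator S y * f y) \<partial>\<sigma>)"
  proof (rule integral_cong_AE)
    show "(\<lambda>y. K x y * (indicator S y * f y)) \<in> borel_measurable \<sigma>"
      unfolding measurable_lf[OF \<sigma>] by (intro borel_measurable_times Km fS)
    show "(\<lambda>y. K x y * of_real (\<phi> (x - y)) * (indicator S y * f y)) \<in> borel_measurable \<sigma>"
      unfolding measurable_lf[OF \<sigma>] by (intro borel_measurable_times Km fS trunc_measurable) (simp add: \<phi>(1))
    show "AE y in \<sigma>. K x y * (indicator S y * f y) = K x y * of_real (\<phi> (x - y)) * (indicator S y * f y)"
      using supp
    proof eventually_elim
      case (elim y)
      show ?case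
      proof (cases "y \<in> S \<and> norm y \<le> R")
        case True
        hence "\<phi> (x - y) = 1" using norm_triangle_ineq4[of x y] by (intro \<phi>(2) sep) auto
        thus ?thesis by simp
      qed (use elim in \<open>auto split: split_indicator\<close>)
    qed
  qed
  thus ?thesis using trunc_le_T[of \<phi>] \<phi>(1) by simp
qed

text \<open>Split g at a ball about a point of the set in question. In the half ball the far part is
  an untruncated integral, at most T g + A M g \<le> t / 2, so on the set the near part exceeds t /
  2; the L^q bound then limits the measure of the set there by the integral of |g|^q over the ball.
  On the set |g| is at most a multiple of \<beta> t almost everywhere, so
  \<open>null_of_small_density\<close> applies for small \<beta>.\<close>

lemma (in trunc_setting) sio_null_set:
  assumes L: "\<sigma> = lborel" and q: "1 < q" and S: "bounded_linear_on_Lp q S"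
    and off: "\<And>f. f \<in> Lp_fun q lborel \<Longrightarrow> compact (ess_support f) \<Longrightarrow>
      AE x in lborel. x \<notin> ess_support f \<longrightarrow> S f x = (\<integral>y. K x y * f y \<partial>lborel)"
  shows "\<exists>\<beta>>0. \<forall>g t. g \<in> Lp_fun q lborel \<and> ess_bounded g \<and> compact (ess_support g) \<and> 0 < t \<longrightarrow>
    emeasure lborel {x. t < norm (S g x) \<and> T g x \<le> ennreal (t / 4) \<and> M g x \<le> ennreal (\<beta> * t)} = 0"
proof -
  obtain A where A: "0 \<le> A" and max: "\<And>f x z L S. loc_integrable \<sigma> f \<and> 0 < L \<and> norm (x - z) \<le> L \<and> S \<in> sets borel \<and>
      (\<forall>y\<in>S. 1 / 3 * L \<le> norm (x - y)) \<and> - S \<subseteq> cball x L \<Longrightarrow>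
      T (\<lambda>y. indicator S y * f y) x \<le> T f z + ennreal A * M f x"
    using maximum_principle[of "1 / 3"] by auto
  obtain b\<^sub>0 where b\<^sub>0: "\<And>f. f \<in> Lp_fun q lborel \<Longrightarrow> Lp_norm q lborel (S f) \<le> b\<^sub>0 * Lp_norm q lborel f"
    using S unfolding bounded_linear_on_Lp_def by blast
  have SL: "\<And>f. f \<in> Lp_fun q lborel \<Longrightarrow> S f \<in> Lp_fun q lborel"
    and lin: "\<And>f g a b. f \<in> Lp_fun q lborel \<Longrightarrow> g \<in> Lp_fun q lborel \<Longrightarrow>
        AE x in lborel. S (\<lambda>z. a * f z + b * g z) x = a * S f x + b * S g x"
    using S by (auto simp: bounded_linear_on_Lp_def)
  define b where "b = \<bar>b\<^sub>0\<bar> + 1"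
  have b1: "1 \<le> b" by (simp add: b_def)
  have Sb: "(\<integral>x. norm (S f x) powr q \<partial>lborel) \<le> b powr q * (\<integral>x. norm (f x) powr q \<partial>lborel)"
    if f: "f \<in> Lp_fun q lborel" for f
  proof -
    have nn: "0 \<le> (\<integral>x. norm (h x) powr q \<partial>lborel)" for h :: "real ^ 'n \<Rightarrow> complex"
      by (rule Bochner_Integration.integral_nonneg) simp
    have "Lp_norm q lborel (S f) \<le> b * Lp_norm q lborel f"
      using b\<^sub>0[OF f] by (rule order_trans) (auto simp: b_def Lp_norm_def intro!: mult_right_mono)
    hence "Lp_norm q lborel (S f) powr q \<le> (b * Lp_norm q lborel f) powr q"
      using q by (intro powr_mono2) (auto simp: Lp_norm_def)
    thus ?thesis using q nn b1 by (simp add: Lp_norm_def powr_mult powr_powr)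
  qed
  define v where "v = unit_ball_vol (real CARD('n))"
  have v: "0 < v" by (simp add: v_def)
  \<comment> \<open>2^n / v compares the cube of side 2 s with the ball of radius s; the additional
    2 creates the gap between averages and values.\<close>
  define c where "c = 2 * 2 ^ CARD('n) / v"
  have c: "0 < c" using v by (simp add: c_def)
  \<comment> \<open>The first summand keeps A M g below t / 4, the second makes the density
    condition hold.\<close>
  define \<beta> where "\<beta> = 1 / (4 * (A + 1) + 4 * b * c * 2 ^ CARD('n))"
  have bc: "0 < b * c * 2 ^ CARD('n)" using b1 c by simp
  have \<beta>: "0 < \<beta>" "A * \<beta> \<le> 1 / 4" "2 * b * c * \<beta> * 2 ^ CARD('n) \<le> 1 / 2"
    using A bc by (auto simp: \<beta>_def field_simps add_pos_pos)
  have "emeasure lborel {x. t < norm (S g x) \<and> T g x \<le> ennreal (t / 4) \<and> M g x \<le> ennreal (\<beta> * t)} = 0"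
    if g: "g \<in> Lp_fun q lborel" and eb: "ess_bounded g" and cs: "compact (ess_support g)" and t: "0 < t" for g t
  proof -
    define E where "E = {x. t < norm (S g x) \<and> T g x \<le> ennreal (t / 4) \<and> M g x \<le> ennreal (\<beta> * t)}"
    have gl: "loc_integrable \<sigma> g" unfolding L by (rule loc_integrable_Lp[OF lf_lborel _ g]) (use q in simp)
    have gm [measurable]: "g \<in> borel_measurable borel" using gl by (simp add: loc_integrable_def)
    have Sm [measurable]: "S g \<in> borel_measurable borel" using SL[OF g] by (simp add: Lp_fun_def)
    note [measurable] = T_measurable[OF gl] maximal_op_measurable[OF \<sigma> gm]
    have Em: "E \<in> sets borel" unfolding E_def by measurable
    have fin: "emeasure lborel {x. s < norm (h x)} < \<infinity>" if "h \<in> Lp_fun q lborel" "0 < s" for h :: "real ^ 'n \<Rightarrow> complex" and s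
      using Lp_chebyshev[OF that(1) _ that(2)] q by (auto intro: order.strict_trans1)
    have Efin: "emeasure lborel E < \<infinity>"
    proof -
      have "emeasure lborel E \<le> emeasure lborel {x. t < norm (S g x)}"
        by (intro emeasure_mono) (auto simp: E_def)
      thus ?thesis using fin[OF SL[OF g] t] by (rule order.strict_trans1)
    qed
    \<comment> \<open>Averages of |g| over balls centred at points with M g \<le> \<beta> t are
      small, so |g| can be large at such points only on a null set.\<close>
    have avg: "AE y in lborel. y \<in> E \<longrightarrow> norm (g y) \<le> c * \<beta> * t"
    proof -
      define N where "N = {x. c * \<beta> * t < norm (g x) \<and> M g x \<le> ennreal (\<beta> * t)}"
      have Nm: "N \<in> sets borel" unfolding N_def by measurable
      have "emeasure lborel N = 0"
      proof (rule null_of_small_averages[OF Nm, where u="\<lambda>y. ennreal (norm (g y))" and a="2 ^ CARD('n) / v * (\<beta> * t)" and b="c * \<beta> * t"])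
        have "emeasure lborel N \<le> emeasure lborel {x. c * \<beta> * t < norm (g x)}"
          by (intro emeasure_mono) (auto simp: N_def)
        thus "emeasure lborel N < \<infinity>" using fin[OF g] c \<beta> t by (auto intro: order.strict_trans1)
        show "2 ^ CARD('n) / v * (\<beta> * t) < c * \<beta> * t"
        proof -
          have eq: "c * \<beta> * t = 2 * (2 ^ CARD('n) / v * (\<beta> * t))" by (simp add: c_def)
          have X: "X < 2 * X" if "0 < X" for X :: real using that by simp
          show ?thesis unfolding eq by (rule X) (use v \<beta>(1) t in simp)
        qed
        show "ennreal (c * \<beta> * t) \<le> ennreal (norm (g x))" if "x \<in> N" for x
          using that by (intro ennreal_leI) (simp add: N_def)
        fix x and s :: real assume x: "x \<in> N" and s: "0 < s"
        have "(\<integral>\<^sup>+y\<in>cball x s. ennreal (norm (g y)) \<partial>lborel) \<le> ennreal ((2 * s) ^ CARD('n)) * M g x"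
          using abs_mass_cball_le_maximal[OF \<sigma> gm s] by (simp add: abs_mass_def L)
        also have "\<dots> \<le> ennreal ((2 * s) ^ CARD('n)) * ennreal (\<beta> * t)"
          using x by (intro mult_left_mono) (auto simp: N_def)
        also have "\<dots> = ennreal (2 ^ CARD('n) / v * (\<beta> * t)) * emeasure lborel (cball x s)"
          using s v \<beta> t by (simp add: emeasure_cball v_def[symmetric] ennreal_mult[symmetric] power_mult_distrib)
        finally show "(\<integral>\<^sup>+y\<in>cball x s. ennreal (norm (g y)) \<partial>lborel) \<le> \<dots>" .
      qed (use v \<beta> t in auto)
      hence "AE y in lborel. y \<notin> N" using Nm by (intro AE_not_in) auto
      thus ?thesis by eventually_elim (auto simp: N_def E_def)
    qed
    obtain R where R: "\<And>y. y \<in> ess_support g \<Longrightarrow> norm y \<le> R"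
      using compact_imp_bounded[OF cs] by (auto simp: bounded_iff)
    have g0: "AE y in lborel. R < norm y \<longrightarrow> g y = 0"
      using AE_ess_support[of g] by eventually_elim (use R in force)
    obtain m where m: "AE y in lborel. norm (g y) \<le> m" using eb by (auto simp: ess_bounded_def)
    have "emeasure lborel E = 0"
    proof (rule null_of_small_density[OF Em Efin, where u="\<lambda>y. ennreal (norm (g y) powr q)"
          and b="\<bar>m\<bar> powr q" and a="(2 * b / t) powr q" and c="(c * \<beta> * t) powr q"])
      show "AE y in lborel. ennreal (norm (g y) powr q) \<le> ennreal (\<bar>m\<bar> powr q)"
        using m by eventually_elim (use q in \<open>auto intro!: ennreal_leI powr_mono2\<close>)
      show "AE y in lborel. y \<in> E \<longrightarrow> ennreal (norm (g y) powr q) \<le> ennreal ((c * \<beta> * t) powr q)"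
        using avg by eventually_elim (use q in \<open>auto intro!: ennreal_leI powr_mono2\<close>)
      have "(2 * b / t) powr q * (c * \<beta> * t) powr q = (2 * b / t * (c * \<beta> * t)) powr q"
        by (rule powr_mult[symmetric])
      also have "2 * b / t * (c * \<beta> * t) = 2 * b * c * \<beta>" using t by simp
      \<comment> \<open>The base is at most 1, so the exponent q > 1 only decreases the
        power.\<close>
      also have "(2 * b * c * \<beta>) powr q \<le> (2 * b * c * \<beta>) powr 1"
      proof (rule powr_mono')
        have "2 * b * c * \<beta> * 1 \<le> 2 * b * c * \<beta> * 2 ^ CARD('n)"
          using b1 c \<beta>(1) by (intro mult_left_mono one_le_power) auto
        thus "2 * b * c * \<beta> \<le> 1" using \<beta>(3) by simp
        show "1 \<le> q" using q by simp
        show "0 \<le> 2 * b * c * \<beta>" using b1 c \<beta>(1) by simp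
      qed
      also have "\<dots> < 1 / 2 ^ CARD('n)"
      proof -
        have "2 * b * c * \<beta> * 2 ^ CARD('n) < 1" using \<beta>(3) by simp
        moreover have "0 \<le> 2 * b * c * \<beta>" using b1 c \<beta>(1) by simp
        ultimately show ?thesis by (simp add: pos_less_divide_eq)
      qed
      finally show "(2 * b / t) powr q * (c * \<beta> * t) powr q < 1 / 2 ^ CARD('n)" .
      fix x\<^sub>0 :: "real ^ 'n" and s :: real assume s: "0 < s"
      define D where "D = cball x\<^sub>0 s"
      have Dm: "D \<in> sets lborel" "- D \<in> sets lborel" by (auto simp: D_def)
      define g\<^sub>1 where "g\<^sub>1 y = indicator D y * g y" for y
      define g\<^sub>2 where "g\<^sub>2 y = indicator (- D) y * g y" for y
      have gL: "g\<^sub>1 \<in> Lp_fun q lborel" "g\<^sub>2 \<in> Lp_fun q lborel"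
        using Lp_fun_indicator(1)[OF g Dm(1)] Lp_fun_indicator(1)[OF g Dm(2)] by (simp_all add: g\<^sub>1_def[abs_def] g\<^sub>2_def[abs_def])
      have "(\<lambda>z. 1 * g\<^sub>1 z + 1 * g\<^sub>2 z) = g" by (auto simp: g\<^sub>1_def g\<^sub>2_def split: split_indicator)
      hence split: "AE x in lborel. S g x = S g\<^sub>1 x + S g\<^sub>2 x" using lin[OF gL, of 1 1] by simp
      have es: "ess_support g\<^sub>2 \<subseteq> ess_support g - ball x\<^sub>0 s"
        by (rule ess_support_restrict) (auto simp: g\<^sub>2_def D_def split: split_indicator)
      have "compact (ess_support g\<^sub>2)"
        using es cs closed_ess_support[of g\<^sub>2] by (metis Diff_subset compact_Int_closed inf.absorb_iff2 order_trans)
      note offg = off[OF gL(2) this]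
      have "AE x in lborel. x \<in> E \<inter> cball x\<^sub>0 (s / 2) \<longrightarrow> x \<in> {x. t / 2 < norm (S g\<^sub>1 x)}"
        using split offg
      proof eventually_elim
        case (elim x)
        show ?case
        proof
          assume x: "x \<in> E \<inter> cball x\<^sub>0 (s / 2)"
          hence "x \<in> ball x\<^sub>0 s" using s by simp
          hence Sx: "S g\<^sub>2 x = (\<integral>y. K x y * g\<^sub>2 y \<partial>lborel)" using elim(2) es by blast
          have far: "s / 2 \<le> norm (x - y)" if "y \<in> - D" for y
            using that x dist_triangle[of x\<^sub>0 y x] by (simp add: D_def dist_norm[symmetric])
          have "ennreal (norm (\<integral>y. K x y * (indicator (- D) y * g y) \<partial>\<sigma>)) \<le> T (\<lambda>y. indicator (- D) y * g y) x"
          proof (rule kernel_integral_le_T[OF gl _ far])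
            show "AE y in \<sigma>. y \<in> - D \<longrightarrow> R < norm y \<longrightarrow> g y = 0" unfolding L using g0 by eventually_elim auto
          qed (use s Dm in auto)
          also have "\<dots> \<le> T g x + ennreal A * M g x"
          \<comment> \<open>Here the base point does not move: z = x, and g off the ball is compared
            with g itself. The radius 3 s / 2 covers the ball from any point of the half ball, and a
            third of it is the separation s / 2.\<close>
          proof (rule max[of g "3 / 2 * s" x x "- D"], intro conjI ballI gl)
            show "- (- D) \<subseteq> cball x (3 / 2 * s)"
            proof
              fix y assume "y \<in> - (- D)"
              thus "y \<in> cball x (3 / 2 * s)" using x dist_triangle[of x y x\<^sub>0] by (simp add: D_def dist_commute)
            qed
          qed (use s far Dm in auto)
          also have "\<dots> \<le> ennreal (t / 4) + ennreal A * ennreal (\<beta> * t)"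
            using x by (intro add_mono mult_left_mono) (auto simp: E_def)
          also have "\<dots> = ennreal (t / 4 + A * \<beta> * t)"
            using A \<beta> t by (simp add: ennreal_mult[symmetric] mult.assoc)
          finally have "norm (S g\<^sub>2 x) \<le> t / 4 + A * \<beta> * t"
            using A \<beta>(1) t unfolding Sx L g\<^sub>2_def by (subst (asm) ennreal_le_iff) auto
          also have "\<dots> \<le> t / 4 + 1 / 4 * t" by (intro add_left_mono mult_right_mono \<beta>(2)) (use t in simp)
          also have "\<dots> = t / 2" by simp
          finally show "x \<in> {x. t / 2 < norm (S g\<^sub>1 x)}"
            using x elim(1) norm_triangle_ineq[of "S g\<^sub>1 x" "S g\<^sub>2 x"] by (simp add: E_def)
        qed
      qed
      hence "emeasure lborel (E \<inter> cball x\<^sub>0 (s / 2)) \<le> emeasure lborel {x. t / 2 < norm (S g\<^sub>1 x)}"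
        using SL[OF gL(1)] by (intro emeasure_mono_AE) (auto simp: Lp_fun_def)
      also have "\<dots> \<le> ennreal ((t / 2) powr (- q) * (\<integral>x. norm (S g\<^sub>1 x) powr q \<partial>lborel))"
        using Lp_chebyshev[OF SL[OF gL(1)], of "t / 2"] q t by simp
      also have "\<dots> \<le> ennreal ((t / 2) powr (- q) * (b powr q * (\<integral>x. norm (g\<^sub>1 x) powr q \<partial>lborel)))"
        by (intro ennreal_leI mult_left_mono Sb gL) auto
      also have "(t / 2) powr (- q) * (b powr q * (\<integral>x. norm (g\<^sub>1 x) powr q \<partial>lborel)) = (2 * b / t) powr q * (\<integral>x. norm (g\<^sub>1 x) powr q \<partial>lborel)"
      proof -
        have "(t / 2) powr (- q) * b powr q = (2 * b / t) powr q"
          using t b1 by (simp add: powr_minus powr_divide powr_mult field_simps)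
        thus ?thesis by (simp add: mult.assoc[symmetric])
      qed
      also have "ennreal \<dots> = ennreal ((2 * b / t) powr q) * (\<integral>\<^sup>+x. ennreal (norm (g\<^sub>1 x) powr q) \<partial>lborel)"
        using gL(1) by (simp add: Lp_fun_def nn_integral_eq_integral ennreal_mult)
      also have "(\<integral>\<^sup>+x. ennreal (norm (g\<^sub>1 x) powr q) \<partial>lborel) = (\<integral>\<^sup>+y\<in>cball x\<^sub>0 s. ennreal (norm (g y) powr q) \<partial>lborel)"
        by (intro nn_integral_cong) (auto simp: g\<^sub>1_def D_def split: split_indicator)
      finally show "emeasure lborel (E \<inter> cball x\<^sub>0 (s / 2)) \<le> ennreal ((2 * b / t) powr q) * (\<integral>\<^sup>+y\<in>cball x\<^sub>0 s. ennreal (norm (g y) powr q) \<partial>lborel)" .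
    qed auto
    thus ?thesis by (simp add: E_def)
  qed
  thus ?thesis using \<beta>(1) by blast
qed

section \<open>Passage from \<sigma> to Lebesgue measure\<close>

lemma sigma_finite_lf:
  assumes "locally_finite_borel \<sigma>"
  shows "sigma_finite_measure \<sigma>"
proof
  show "\<exists>A. countable A \<and> A \<subseteq> sets \<sigma> \<and> \<Union>A = space \<sigma> \<and> (\<forall>a\<in>A. emeasure \<sigma> a \<noteq> \<infinity>)"
  proof (intro exI[of _ "range (\<lambda>k::nat. cball 0 (real k))"] conjI ballI)
    show "\<Union>(range (\<lambda>k::nat. cball 0 (real k))) = space \<sigma>"
      by (auto simp: space_lf[OF assms] intro: real_arch_simple)
    fix a assume "a \<in> range (\<lambda>k::nat. cball (0 :: real ^ 'a) (real k))"
    thus "emeasure \<sigma> a \<noteq> \<infinity>" using emeasure_bounded_lf[OF assms, of a] by auto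
  qed (auto simp: sets_lf[OF assms])
qed

text \<open>Sigma-finiteness makes the Radon-Nikodym derivative finite almost everywhere, so
  \<open>enn2real\<close> in \<open>density_fun\<close> alters it only on a null set.\<close>

lemma density_fun_transfer:
  fixes \<sigma> :: "(real ^ 'n) measure"
  assumes \<sigma>: "locally_finite_borel \<sigma>" and ac: "absolutely_continuous lborel \<sigma>" and f: "f \<in> borel_measurable borel"
  shows "density_fun \<sigma> f \<in> borel_measurable borel"
    "A \<in> sets borel \<Longrightarrow> abs_mass \<sigma> f A = abs_mass lborel (density_fun \<sigma> f) A"
    "h \<in> borel_measurable borel \<Longrightarrow> (\<integral>y. h y * f y \<partial>\<sigma>) = (\<integral>y. h y * density_fun \<sigma> f y \<partial>lborel)"
proof -
  define r where "r x = enn2real (RN_deriv lborel \<sigma> x)" for x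
  have r [measurable]: "r \<in> borel_measurable borel" using borel_measurable_RN_deriv[of lborel \<sigma>] by (simp add: r_def[abs_def])
  note [measurable] = f
  have d: "density_fun \<sigma> f = (\<lambda>y. f y * of_real (r y))" by (simp add: density_fun_def[abs_def] r_def)
  show "density_fun \<sigma> f \<in> borel_measurable borel" unfolding d by measurable
  have eq: "\<sigma> = density lborel (\<lambda>x. ennreal (r x))"
  proof -
    have "AE x in lborel. RN_deriv lborel \<sigma> x \<noteq> \<infinity>"
      using sigma_finite_lf[OF \<sigma>] ac by (intro sigma_finite_measure.RN_deriv_finite[OF sigma_finite_lborel]) (auto simp: sets_lf[OF \<sigma>])
    hence "AE x in lborel. RN_deriv lborel \<sigma> x = ennreal (r x)"
      by eventually_elim (auto simp: r_def less_top[symmetric])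
    hence "density lborel (RN_deriv lborel \<sigma>) = density lborel (\<lambda>x. ennreal (r x))"
      by (intro density_cong) auto
    thus ?thesis using sigma_finite_measure.density_RN_deriv[OF sigma_finite_lborel ac] by (simp add: sets_lf[OF \<sigma>])
  qed
  have r0: "0 \<le> r x" for x by (simp add: r_def)
  show "abs_mass \<sigma> f A = abs_mass lborel (density_fun \<sigma> f) A" if "A \<in> sets borel"
    unfolding abs_mass_def d using that r0
    by (subst eq, subst nn_integral_density)
      (auto intro!: nn_integral_cong simp: norm_mult ennreal_mult mult_ac)
  show "(\<integral>y. h y * f y \<partial>\<sigma>) = (\<integral>y. h y * density_fun \<sigma> f y \<partial>lborel)" if "h \<in> borel_measurable borel"
    unfolding d using that r0
    by (subst eq, subst integral_density) (auto intro!: Bochner_Integration.integral_cong simp: scaleR_conv_of_real mult_ac)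
qed

lemma maximal_op_density_fun:
  assumes \<sigma>: "locally_finite_borel \<sigma>" and ac: "absolutely_continuous lborel \<sigma>" and f: "f \<in> borel_measurable borel"
  shows "maximal_op \<sigma> f = maximal_op lborel (density_fun \<sigma> f)"
  unfolding maximal_op_alt[OF \<sigma> f] maximal_op_alt[OF lf_lborel density_fun_transfer(1)[OF assms]] fun_eq_iff
  by (intro allI SUP_cong refl arg_cong2[where f="(/)"] density_fun_transfer(2)[OF assms]) (auto simp: cubes_borel)

lemma ess_bounded_compact_Lp:
  fixes g :: "real ^ 'n \<Rightarrow> complex"
  assumes g: "g \<in> borel_measurable borel" "ess_bounded g" "compact (ess_support g)" and q: "0 < q"
  shows "g \<in> Lp_fun q lborel"
proof -
  obtain m where m: "AE y in lborel. norm (g y) \<le> m" using g(2) by (auto simp: ess_bounded_def)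
  obtain R where R: "\<And>y. y \<in> ess_support g \<Longrightarrow> norm y \<le> R"
    using compact_imp_bounded[OF g(3)] by (auto simp: bounded_iff)
  note [measurable] = g(1)
  have "(\<integral>\<^sup>+y. ennreal (norm (norm (g y) powr q)) \<partial>lborel) \<le> (\<integral>\<^sup>+y. ennreal (\<bar>m\<bar> powr q) * indicator (cball (0 :: real ^ 'n) R) y \<partial>lborel)"
  proof (rule nn_integral_mono_AE)
    show "AE y in lborel. ennreal (norm (norm (g y) powr q)) \<le> ennreal (\<bar>m\<bar> powr q) * indicator (cball 0 R) y"
      using m AE_ess_support[of g]
    proof eventually_elim
      case (elim y)
      show ?case
      proof (cases "norm y \<le> R")
        case True
        thus ?thesis using elim(1) q by (auto intro!: ennreal_leI powr_mono2)
      next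
        case False
        hence "g y = 0" using elim(2) R by blast
        thus ?thesis by simp
      qed
    qed
  qed
  also have "\<dots> < \<infinity>"
    using emeasure_bounded_finite[of "cball (0 :: real ^ 'n) R"]
    by (simp add: nn_integral_cmult_indicator ennreal_mult_less_top)
  finally show ?thesis unfolding Lp_fun_def using g(1) by (auto intro!: integrableI_bounded)
qed

text \<open>T and M take the same values on f \<sigma> and on its Lebesgue density. By
  \<open>sio_null_set\<close> a superlevel set of S is covered by superlevel sets of T f and M f and
  a Lebesgue null set, which is \<omega>-null by absolute continuity.\<close>

theorem (in two_weight) sio_weak_type:
  assumes ac: "absolutely_continuous lborel \<sigma>" "absolutely_continuous lborel \<omega>"
    and S: "standard_sio K S" and T: "weak_bound p \<sigma> \<omega> T D\<^sub>1" and M: "weak_bound p \<sigma> \<omega> M D\<^sub>2"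
  shows "\<exists>C. \<forall>f\<in>Lp_fun p \<sigma>. ess_bounded (density_fun \<sigma> f) \<and> compact (ess_support (density_fun \<sigma> f)) \<longrightarrow>
    weak_Lp_norm p \<omega> (\<lambda>x. ennreal (norm (S (density_fun \<sigma> f) x))) \<le> ennreal (C * Lp_norm p \<sigma> f)"
proof -
  interpret L: trunc_setting lborel K C d \<Phi> B
    by (unfold_locales) (fact lf_lborel K \<Phi>)+
  obtain q where q: "1 < q" and bl: "bounded_linear_on_Lp q S"
    and off: "\<And>f. f \<in> Lp_fun q lborel \<Longrightarrow> compact (ess_support f) \<Longrightarrow>
      AE x in lborel. x \<notin> ess_support f \<longrightarrow> S f x = (\<integral>y. K x y * f y \<partial>lborel)"
    using S by (auto simp: standard_sio_def)
  from L.sio_null_set[OF refl q bl off] obtain \<beta> where \<beta>: "0 < \<beta>"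
    and nul: "\<And>g t. g \<in> Lp_fun q lborel \<and> ess_bounded g \<and> compact (ess_support g) \<and> 0 < t \<Longrightarrow>
      emeasure lborel {x. t < norm (S g x) \<and> L.T g x \<le> ennreal (t / 4) \<and> L.M g x \<le> ennreal (\<beta> * t)} = 0"
    by auto
  define E where "E = 4 powr p * D\<^sub>1 + \<beta> powr (- p) * D\<^sub>2"
  have D0: "0 \<le> D\<^sub>1" "0 \<le> D\<^sub>2" using T M by (auto simp: weak_bound_def)
  hence E0: "0 \<le> E" by (simp add: E_def)
  show ?thesis
  proof (intro exI[of _ "E powr (1 / p)"] ballI impI)
    fix f assume f: "f \<in> Lp_fun p \<sigma>"
      and b: "ess_bounded (density_fun \<sigma> f) \<and> compact (ess_support (density_fun \<sigma> f))"
    define g where "g = density_fun \<sigma> f"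
    define I where "I = (\<integral>x. norm (f x) powr p \<partial>\<sigma>)"
    have I0: "0 \<le> I" unfolding I_def by (rule integral_powr_nonneg)
    note fl = Lp_loc_integrable[OF f]
    have fm: "f \<in> borel_measurable borel" using fl by (simp add: loc_integrable_def)
    have gm: "g \<in> borel_measurable borel" unfolding g_def by (rule density_fun_transfer(1)[OF \<sigma> ac(1) fm])
    have gq: "g \<in> Lp_fun q lborel" using b q gm by (intro ess_bounded_compact_Lp) (auto simp: g_def)
    have Meq: "L.M g = M f" unfolding g_def by (rule maximal_op_density_fun[OF \<sigma> ac(1) fm, symmetric])
    have Teq: "L.T g = T f"
      unfolding trunc_max_def g_def fun_eq_iff
      by (intro allI SUP_cong refl arg_cong[where f="\<lambda>z. ennreal (norm z)"] density_fun_transfer(3)[OF \<sigma> ac(1) fm, symmetric]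
          borel_measurable_times Km trunc_measurable) simp
    have Sm: "S g \<in> borel_measurable borel" using bl gq by (auto simp: bounded_linear_on_Lp_def Lp_fun_def)
    have main: "ennreal (t powr p) * emeasure \<omega> {x. ennreal t < ennreal (norm (S g x))} \<le> ennreal (E * I)" if t: "0 < t" for t
    proof -
      define N where "N = {x. t < norm (S g x) \<and> T f x \<le> ennreal (t / 4) \<and> M f x \<le> ennreal (\<beta> * t)}"
      note [measurable] = Sm T_measurable[OF fl] maximal_op_measurable[OF \<sigma> fm]
      have Nm: "N \<in> sets borel" unfolding N_def by measurable
      have "emeasure lborel N = 0" using nul[of g t] gq b t by (simp add: N_def Meq Teq g_def[symmetric])
      hence "N \<in> null_sets lborel" using Nm by auto
      hence N0: "emeasure \<omega> N = 0" using ac(2) by (auto simp: absolutely_continuous_def)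
      let ?X = "{x. ennreal (t / 4) < T f x}" and ?Y = "{x. ennreal (\<beta> * t) < M f x}"
      have XY: "?X \<in> sets \<omega>" "?Y \<in> sets \<omega>" "N \<in> sets \<omega>"
        using open_T_superlevel[OF fl] open_maximal_superlevel[OF \<sigma> fm, of "\<beta> * t"] \<beta> t Nm
        by (auto simp: sets_lf[OF \<omega>])
      have "{x. ennreal t < ennreal (norm (S g x))} \<subseteq> (?X \<union> ?Y) \<union> N"
        using t by (auto simp: N_def not_less ennreal_less_iff)
      hence "emeasure \<omega> {x. ennreal t < ennreal (norm (S g x))} \<le> emeasure \<omega> ((?X \<union> ?Y) \<union> N)"
        using XY by (intro emeasure_mono) auto
      also have "\<dots> \<le> emeasure \<omega> ?X + emeasure \<omega> ?Y + emeasure \<omega> N"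
        using XY by (intro order_trans[OF emeasure_subadditive] add_mono emeasure_subadditive) auto
      finally have "ennreal (t powr p) * emeasure \<omega> {x. ennreal t < ennreal (norm (S g x))}
          \<le> ennreal (t powr p) * emeasure \<omega> ?X + ennreal (t powr p) * emeasure \<omega> ?Y"
        by (simp add: N0 mult_left_mono flip: distrib_left)
      also have "\<dots> \<le> ennreal (4 powr p * (D\<^sub>1 * I)) + ennreal (\<beta> powr (- p) * (D\<^sub>2 * I))"
      proof (intro add_mono)
        have "ennreal (t powr p) * emeasure \<omega> ?X = ennreal (4 powr p) * (ennreal ((t / 4) powr p) * emeasure \<omega> ?X)"
          using t by (simp add: ennreal_mult[symmetric] mult.assoc[symmetric] powr_mult[symmetric])
        also have "\<dots> \<le> ennreal (4 powr p) * ennreal (D\<^sub>1 * I)"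
          using T f t by (intro mult_left_mono) (auto simp: weak_bound_def I_def)
        finally show "ennreal (t powr p) * emeasure \<omega> ?X \<le> ennreal (4 powr p * (D\<^sub>1 * I))"
          using D0 I0 by (simp add: ennreal_mult)
        have "t powr p = \<beta> powr (- p) * (\<beta> * t) powr p" using \<beta> by (simp add: powr_mult powr_minus)
        hence "ennreal (t powr p) * emeasure \<omega> ?Y = ennreal (\<beta> powr (- p)) * (ennreal ((\<beta> * t) powr p) * emeasure \<omega> ?Y)"
          by (simp add: ennreal_mult mult.assoc)
        also have "\<dots> \<le> ennreal (\<beta> powr (- p)) * ennreal (D\<^sub>2 * I)"
          using M f t \<beta> by (intro mult_left_mono) (auto simp: weak_bound_def I_def)
        finally show "ennreal (t powr p) * emeasure \<omega> ?Y \<le> ennreal (\<beta> powr (- p) * (D\<^sub>2 * I))"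
          using D0 I0 by (simp add: ennreal_mult)
      qed
      also have "\<dots> = ennreal (E * I)"
        using D0 I0 by (subst ennreal_plus[symmetric]) (auto simp: E_def algebra_simps)
      finally show ?thesis .
    qed
    have "(E powr (1 / p) * Lp_norm p \<sigma> f) powr p = E * I"
      using p E0 I0 by (simp add: Lp_norm_def powr_mult powr_powr I_def)
    moreover have "0 \<le> E powr (1 / p) * Lp_norm p \<sigma> f" by (simp add: Lp_norm_def)
    ultimately show "weak_Lp_norm p \<omega> (\<lambda>x. ennreal (norm (S (density_fun \<sigma> f) x))) \<le> ennreal (E powr (1 / p) * Lp_norm p \<sigma> f)"
      using main p unfolding g_def by (subst weak_Lp_norm_le_iff) auto
  qed
qed

subsection \<open>The two weight condition and the maximal operator\<close>

lemma Ap_product: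
  fixes w s L :: real
  assumes p: "1 < p" "1 / p + 1 / p' = 1" and ws: "0 \<le> w" "0 \<le> s" and L: "0 < L"
  shows "(w / L) powr (1 / p) * (s / L) powr (1 / p') = (w * s powr (p - 1)) powr (1 / p) / L"
proof -
  have p': "1 / p' = 1 - 1 / p" using p(2) by simp
  have e: "(p - 1) * (1 / p) = 1 / p'" unfolding p' using p by (simp add: field_simps)
  have "(w / L) powr (1 / p) * (s / L) powr (1 / p')
      = w powr (1 / p) * s powr (1 / p') / (L powr (1 / p) * L powr (1 / p'))"
    using ws L by (simp add: powr_divide)
  also have "L powr (1 / p) * L powr (1 / p') = L" using L by (simp add: powr_add[symmetric] p(2))
  also have "w powr (1 / p) * s powr (1 / p') = (w * s powr (p - 1)) powr (1 / p)"
    by (simp only: powr_mult powr_powr e)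
  finally show ?thesis .
qed

text \<open>Raising to the power p removes the roots. The product \<omega>(Q) \<sigma>(Q)^(p - 1) is
  the quantity that covering arguments and separated sets produce.\<close>

lemma two_weight_Ap_iff:
  fixes \<sigma> \<omega> :: "(real ^ 'n) measure"
  assumes p: "1 < p" "1 / p + 1 / p' = 1"
  shows "(\<exists>C. two_weight_Ap p p' \<sigma> \<omega> C) \<longleftrightarrow>
    (\<exists>C\<ge>0. \<forall>a l. 0 < l \<longrightarrow> measure \<omega> (cbox a (\<chi> i. a $ i + l)) * measure \<sigma> (cbox a (\<chi> i. a $ i + l)) powr (p - 1)
       \<le> C * (l ^ CARD('n)) powr p)"
proof -
  have eq: "(measure \<omega> Q / measure lborel Q) powr (1 / p) * (measure \<sigma> Q / measure lborel Q) powr (1 / p')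
      = (measure \<omega> Q * measure \<sigma> Q powr (p - 1)) powr (1 / p) / l ^ CARD('n)"
    if "0 < l" "Q = cbox a (\<chi> i. a $ i + l)" for Q l and a :: "real ^ 'n"
    using that lborel_cube(2)[of l a] by (simp add: Ap_product[OF p])
  show ?thesis
  proof
    assume "\<exists>C. two_weight_Ap p p' \<sigma> \<omega> C"
    then obtain C where C: "two_weight_Ap p p' \<sigma> \<omega> C" by blast
    show "\<exists>C\<ge>0. \<forall>a l. 0 < l \<longrightarrow> measure \<omega> (cbox a (\<chi> i. a $ i + l)) * measure \<sigma> (cbox a (\<chi> i. a $ i + l)) powr (p - 1)
       \<le> C * (l ^ CARD('n)) powr p"
    proof (intro exI[of _ "\<bar>C\<bar> powr p"] conjI allI impI)
      fix a :: "real ^ 'n" and l :: real assume l: "0 < l"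
      let ?Q = "cbox a (\<chi> i. a $ i + l)"
      let ?X = "measure \<omega> ?Q * measure \<sigma> ?Q powr (p - 1)"
      have "?Q \<in> cubes" using l by (auto simp: cubes_def)
      hence "?X powr (1 / p) / l ^ CARD('n) \<le> C"
        using bspec[OF C[unfolded two_weight_Ap_def]] unfolding eq[OF l refl, symmetric] by blast
      hence "?X powr (1 / p) \<le> C * l ^ CARD('n)" using l by (simp add: pos_divide_le_eq)
      also have "\<dots> \<le> \<bar>C\<bar> * l ^ CARD('n)" using l by (intro mult_right_mono) auto
      finally have "(?X powr (1 / p)) powr p \<le> (\<bar>C\<bar> * l ^ CARD('n)) powr p"
        using p by (intro powr_mono2) auto
      thus "?X \<le> \<bar>C\<bar> powr p * (l ^ CARD('n)) powr p" using p by (simp add: powr_powr powr_mult)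
    qed simp
  next
    assume "\<exists>C\<ge>0. \<forall>a l. 0 < l \<longrightarrow> measure \<omega> (cbox a (\<chi> i. a $ i + l)) * measure \<sigma> (cbox a (\<chi> i. a $ i + l)) powr (p - 1)
       \<le> C * (l ^ CARD('n)) powr p"
    then obtain C where C: "0 \<le> C" "\<And>a l. 0 < l \<Longrightarrow> measure \<omega> (cbox a (\<chi> i. a $ i + l)) * measure \<sigma> (cbox a (\<chi> i. a $ i + l)) powr (p - 1)
       \<le> C * (l ^ CARD('n)) powr p" by blast
    have "two_weight_Ap p p' \<sigma> \<omega> (C powr (1 / p))"
      unfolding two_weight_Ap_def
    proof
      fix Q :: "(real ^ 'n) set" assume "Q \<in> cubes"
      then obtain a l where l: "0 < l" and Q: "Q = cbox a (\<chi> i. a $ i + l)" by (auto simp: cubes_def)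
      have "(measure \<omega> Q * measure \<sigma> Q powr (p - 1)) powr (1 / p) \<le> (C * (l ^ CARD('n)) powr p) powr (1 / p)"
        unfolding Q using p by (intro powr_mono2 C l) auto
      also have "\<dots> = C powr (1 / p) * l ^ CARD('n)" using p l by (simp add: powr_mult powr_powr)
      finally show "(measure \<omega> Q / measure lborel Q) powr (1 / p) * (measure \<sigma> Q / measure lborel Q) powr (1 / p') \<le> C powr (1 / p)"
        using l eq[OF l Q] by (simp add: pos_divide_le_eq)
    qed
    thus "\<exists>C. two_weight_Ap p p' \<sigma> \<omega> C" ..
  qed
qed

text \<open>Hoelder's inequality up to a factor, from \<open>weighted_young\<close> applied
  pointwise with the weight for which the constant term integrates to h / 2, half of the mass
  exceeded.\<close>

lemma cube_average_bound:
  fixes f :: "real ^ 'n \<Rightarrow> complex"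
  assumes \<sigma>: "locally_finite_borel \<sigma>" and p: "1 < p" "1 / p + 1 / p' = 1" and f: "f \<in> Lp_fun p \<sigma>"
    and Q: "compact Q" and h: "0 < h" "ennreal h < abs_mass \<sigma> f Q"
  shows "h powr p \<le> 2 powr p * (LINT x:Q|\<sigma>. norm (f x) powr p) * measure \<sigma> Q powr (p - 1)"
proof -
  define F where "F = (LINT x:Q|\<sigma>. norm (f x) powr p)"
  define s where "s = measure \<sigma> Q"
  have Qm: "Q \<in> sets \<sigma>" using Q by (simp add: sets_lf[OF \<sigma>] borel_compact)
  have fm: "f \<in> borel_measurable \<sigma>" using f by (simp add: Lp_fun_def)
  have s: "emeasure \<sigma> Q = ennreal s" "0 \<le> s"
    using emeasure_eq_measure_finite[OF emeasure_bounded_lf[OF \<sigma> compact_imp_bounded[OF Q]]] by (auto simp: s_def)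
  have F: "(\<integral>\<^sup>+x\<in>Q. ennreal (norm (f x) powr p) \<partial>\<sigma>) = ennreal F" "0 \<le> F"
  proof -
    have int: "integrable \<sigma> (\<lambda>x. indicator Q x *\<^sub>R norm (f x) powr p)"
      using f Qm by (intro integrable_mult_indicator) (auto simp: Lp_fun_def)
    show "0 \<le> F" unfolding F_def set_lebesgue_integral_def by (rule Bochner_Integration.integral_nonneg) simp
    show "(\<integral>\<^sup>+x\<in>Q. ennreal (norm (f x) powr p) \<partial>\<sigma>) = ennreal F"
      unfolding F_def set_lebesgue_integral_def
      by (subst nn_integral_eq_integral[OF int, symmetric]) (auto intro!: nn_integral_cong split: split_indicator)
  qed
  have s0: "0 < s"
  proof (rule ccontr)
    assume "\<not> 0 < s"
    hence "Q \<in> null_sets \<sigma>" using s Qm by (auto simp: null_sets_def)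
    hence "abs_mass \<sigma> f Q = 0" unfolding abs_mass_def by (rule nn_integral_null_set)
    thus False using h by simp
  qed
  define \<tau> where "\<tau> = h / (2 * s)"
  have \<tau>: "0 < \<tau>" "\<tau> * s = h / 2" using h s0 by (auto simp: \<tau>_def)
  have "abs_mass \<sigma> f Q \<le> (\<integral>\<^sup>+x. ennreal (\<tau> powr (1 - p)) * (ennreal (norm (f x) powr p) * indicator Q x) + ennreal \<tau> * indicator Q x \<partial>\<sigma>)"
    unfolding abs_mass_def
  proof (rule nn_integral_mono)
    fix x
    have "norm (f x) \<le> \<tau> powr (1 - p) * norm (f x) powr p + \<tau>"
      using weighted_young[OF p _ _ \<tau>(1), of "norm (f x) powr p" 1] p by (simp add: powr_powr)
    hence "ennreal (norm (f x)) \<le> ennreal (\<tau> powr (1 - p)) * ennreal (norm (f x) powr p) + ennreal \<tau>"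
      using \<tau>(1) by (simp add: ennreal_leI ennreal_mult[symmetric] ennreal_plus[symmetric] del: ennreal_plus)
    thus "ennreal (norm (f x)) * indicator Q x \<le> ennreal (\<tau> powr (1 - p)) * (ennreal (norm (f x) powr p) * indicator Q x) + ennreal \<tau> * indicator Q x"
      by (auto split: split_indicator)
  qed
  also have "\<dots> = ennreal (\<tau> powr (1 - p)) * ennreal F + ennreal \<tau> * ennreal s"
    using fm Qm by (subst nn_integral_add) (auto simp: nn_integral_cmult F nn_integral_cmult_indicator s)
  also have "\<dots> = ennreal (\<tau> powr (1 - p) * F + h / 2)"
    using \<tau> F s0 h by (simp add: ennreal_mult[symmetric] ennreal_plus[symmetric] del: ennreal_plus)
  finally have "ennreal h < ennreal (\<tau> powr (1 - p) * F + h / 2)" using h(2) by simp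
  hence "h / 2 \<le> \<tau> powr (1 - p) * F" using h by (simp add: ennreal_less_iff)
  hence "h / 2 * \<tau> powr (p - 1) \<le> \<tau> powr (1 - p) * F * \<tau> powr (p - 1)" by (rule mult_right_mono) simp
  also have "\<dots> = F" using \<tau>(1) by (simp add: powr_add[symmetric] mult.commute mult.left_commute mult.assoc[symmetric])
  finally have "h / 2 * \<tau> powr (p - 1) * s powr (p - 1) \<le> F * s powr (p - 1)" by (rule mult_right_mono) simp
  moreover have "h / 2 * \<tau> powr (p - 1) * s powr (p - 1) = (h / 2) powr p"
  proof -
    have "\<tau> powr (p - 1) * s powr (p - 1) = (h / 2) powr (p - 1)" by (simp only: powr_mult[symmetric] \<tau>(2))
    hence "h / 2 * \<tau> powr (p - 1) * s powr (p - 1) = (h / 2) powr 1 * (h / 2) powr (p - 1)" using h by (simp add: mult.assoc)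
    thus ?thesis by (simp only: powr_add[symmetric]) simp
  qed
  ultimately have "2 powr p * (h / 2) powr p \<le> 2 powr p * (F * s powr (p - 1))" by (intro mult_left_mono) auto
  moreover have "2 powr p * (h / 2) powr p = h powr p" by (simp only: powr_mult[symmetric]) simp
  ultimately show ?thesis by (simp add: F_def s_def mult.assoc)
qed

text \<open>In a Vitali family of balls around cubes of large average, the disjoint cubes q share
  the integral of |f|^p, while the fivefold balls lie in cubes q' to which the two weight condition
  applies.\<close>

lemma (in two_weight) Ap_imp_maximal_weak_bound:
  assumes A: "0 \<le> A" and Ap: "\<And>a l. 0 < l \<Longrightarrow> measure \<omega> (cbox a (\<chi> i. a $ i + l)) * measure \<sigma> (cbox a (\<chi> i. a $ i + l)) powr (p - 1)
       \<le> A * (l ^ CARD('n)) powr p"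
  shows "\<exists>D. weak_bound p \<sigma> \<omega> M D"
proof -
  define n where "n = real CARD('n)"
  have n: "1 \<le> n" by (simp add: n_def Suc_leI)
  \<comment> \<open>10 n is the ratio of the side of q' to that of q: a cube of side l lies in a
    ball of radius n l about its corner, and the fivefold ball in a cube of side 10 n l.\<close>
  define D where "D = 2 powr p * A * ((10 * n) ^ CARD('n)) powr p"
  have D0: "0 \<le> D" using A by (simp add: D_def)
  have "ennreal (t powr p) * emeasure \<omega> {x. ennreal t < M f x} \<le> ennreal (D * (\<integral>x. norm (f x) powr p \<partial>\<sigma>))"
    if f: "f \<in> Lp_fun p \<sigma>" and t: "0 < t" for f t
  proof -
    have fm: "f \<in> borel_measurable borel" using Lp_loc_integrable[OF f] by (simp add: loc_integrable_def)
    define q where "q i = cbox (fst i) (\<chi> j. fst i $ j + snd i)" for i :: "(real ^ 'n) \<times> real"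
    \<comment> \<open>Sides below m keep the radii bounded for Vitali's lemma; an increasing union
      over m removes the restriction.\<close>
    define U where "U m = {x. \<exists>a l. 0 < l \<and> l < m \<and> x \<in> cbox a (\<chi> i. a $ i + l) \<and>
        ennreal (t * l ^ CARD('n)) < abs_mass \<sigma> f (cbox a (\<chi> i. a $ i + l))}" for m
    have Uo: "open (U m)" for m unfolding U_def by (rule open_cube_average_superlevel)
    have each: "ennreal (t powr p) * emeasure \<omega> (U m) \<le> ennreal (D * (\<integral>x. norm (f x) powr p \<partial>\<sigma>))" for m
    proof -
      define X where "X = {i. 0 < snd i \<and> snd i < m \<and> ennreal (t * snd i ^ CARD('n)) < abs_mass \<sigma> f (q i)}"
      have qb: "q i \<subseteq> cball (fst i) (n * snd i)" if "i \<in> X" for i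
      proof
        fix y assume y: "y \<in> q i"
        have "\<bar>(fst i - y) $ j\<bar> \<le> snd i" for j
          using y[unfolded q_def mem_box_cart, rule_format, of j] by simp
        hence "(\<Sum>j\<in>UNIV. \<bar>(fst i - y) $ j\<bar>) \<le> (\<Sum>j\<in>(UNIV :: 'n set). snd i)" by (intro sum_mono)
        thus "y \<in> cball (fst i) (n * snd i)" using norm_le_l1_cart[of "fst i - y"] by (simp add: dist_norm n_def)
      qed
      have cov: "U m \<subseteq> (\<Union>i\<in>X. cball (fst i) (n * snd i))"
      proof
        fix x assume "x \<in> U m"
        then obtain a l where "0 < l" "l < m" "x \<in> q (a, l)" "ennreal (t * l ^ CARD('n)) < abs_mass \<sigma> f (q (a, l))"
          by (auto simp: U_def q_def)
        thus "x \<in> (\<Union>i\<in>X. cball (fst i) (n * snd i))" using qb[of "(a, l)"] by (intro UN_I[of "(a, l)"]) (auto simp: X_def)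
      qed
      obtain I where I: "countable I" "I \<subseteq> X"
        and dis: "pairwise (\<lambda>i j. disjnt (cball (fst i) (n * snd i)) (cball (fst j) (n * snd j))) I"
        and cov5: "U m \<subseteq> (\<Union>i\<in>I. cball (fst i) (5 * (n * snd i)))"
        by (rule Vitali_covering_lemma_cballs[OF cov, of "n * m"]) (use n in \<open>auto simp: X_def\<close>)
      define q' where "q' i = centered_cube (fst i) (5 * (n * snd i))" for i :: "(real ^ 'n) \<times> real"
      define F where "F i = (LINT x:q i|\<sigma>. norm (f x) powr p)" for i
      have one: "ennreal (t powr p) * emeasure \<omega> (q' i) \<le> ennreal D * ennreal (F i)" if i: "i \<in> I" for i
      proof -
        let ?l = "snd i"
        have l: "0 < ?l" "ennreal (t * ?l ^ CARD('n)) < abs_mass \<sigma> f (q i)" using i I(2) by (auto simp: X_def)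
        have F0: "0 \<le> F i" unfolding F_def set_lebesgue_integral_def by (rule Bochner_Integration.integral_nonneg) simp
        have "q i \<subseteq> cball (fst i) (5 * (n * ?l))"
          by (rule order_trans[OF qb subset_cball]) (use i I(2) n l in auto)
        hence qq: "q i \<subseteq> q' i" using cball_subset_centered_cube unfolding q'_def by blast
        have bq: "bounded (q' i)" by (simp add: q'_def)
        have \<omega>q: "emeasure \<omega> (q' i) = ennreal (measure \<omega> (q' i))"
          by (rule emeasure_eq_measure_finite[OF emeasure_bounded_lf[OF \<omega> bq]])
        have "measure \<sigma> (q i) \<le> measure \<sigma> (q' i)"
          by (rule measure_mono_fmeasurable[OF qq]) (use emeasure_bounded_lf[OF \<sigma> bq] in \<open>auto simp: sets_lf[OF \<sigma>] q_def q'_def fmeasurable_def\<close>)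
        hence \<sigma>q: "measure \<sigma> (q i) powr (p - 1) \<le> measure \<sigma> (q' i) powr (p - 1)" using p by (intro powr_mono2) auto
        have "(t * ?l ^ CARD('n)) powr p * measure \<omega> (q' i) \<le> 2 powr p * F i * measure \<sigma> (q i) powr (p - 1) * measure \<omega> (q' i)"
          unfolding F_def by (intro mult_right_mono cube_average_bound[OF \<sigma> p f _ _ l(2)]) (use l t in \<open>auto simp: q_def\<close>)
        also have "\<dots> \<le> 2 powr p * F i * measure \<sigma> (q' i) powr (p - 1) * measure \<omega> (q' i)"
          using F0 by (intro mult_right_mono mult_left_mono \<sigma>q) auto
        also have "\<dots> = 2 powr p * F i * (measure \<omega> (q' i) * measure \<sigma> (q' i) powr (p - 1))" by simp
        also have "\<dots> \<le> 2 powr p * F i * (A * ((2 * (5 * (n * ?l))) ^ CARD('n)) powr p)"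
          unfolding q'_def centered_cube_eq using F0 n l(1) by (intro mult_left_mono Ap) auto
        also have "(2 * (5 * (n * ?l))) ^ CARD('n) = (10 * n) ^ CARD('n) * ?l ^ CARD('n)"
        proof -
          have "2 * (5 * (n * ?l)) = 10 * n * ?l" by simp
          thus ?thesis by (simp only: power_mult_distrib)
        qed
        also have "2 powr p * F i * (A * ((10 * n) ^ CARD('n) * ?l ^ CARD('n)) powr p) = D * F i * (?l ^ CARD('n)) powr p"
          by (simp only: powr_mult D_def mult_ac)
        finally have "(?l ^ CARD('n)) powr p * (t powr p * measure \<omega> (q' i)) \<le> (?l ^ CARD('n)) powr p * (D * F i)"
          by (simp only: powr_mult mult_ac)
        moreover have "0 < (?l ^ CARD('n)) powr p" using l by simp
        ultimately have "t powr p * measure \<omega> (q' i) \<le> D * F i" by (simp only: mult_le_cancel_left_pos)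
        thus ?thesis using D0 F0 by (simp add: \<omega>q ennreal_mult[symmetric] ennreal_leI)
      qed
      have "emeasure \<omega> (U m) \<le> emeasure \<omega> (\<Union>i\<in>I. q' i)"
      proof (rule emeasure_mono)
        have "(\<Union>i\<in>I. cball (fst i) (5 * (n * snd i))) \<subseteq> (\<Union>i\<in>I. q' i)"
          unfolding q'_def by (intro UN_mono order_refl cball_subset_centered_cube)
        thus "U m \<subseteq> (\<Union>i\<in>I. q' i)" using cov5 by blast
        show "(\<Union>i\<in>I. q' i) \<in> sets \<omega>" using I(1) by (auto simp: sets_lf[OF \<omega>] q'_def)
      qed
      also have "\<dots> \<le> (\<integral>\<^sup>+i. emeasure \<omega> (q' i) \<partial>count_space I)"
        using I(1) by (intro emeasure_UN_le_nn_integral) (auto simp: sets_lf[OF \<omega>] q'_def)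
      finally have "ennreal (t powr p) * emeasure \<omega> (U m) \<le> ennreal (t powr p) * (\<integral>\<^sup>+i. emeasure \<omega> (q' i) \<partial>count_space I)"
        by (rule mult_left_mono) simp
      also have "\<dots> = (\<integral>\<^sup>+i. ennreal (t powr p) * emeasure \<omega> (q' i) \<partial>count_space I)" by (simp add: nn_integral_cmult)
      also have "\<dots> \<le> (\<integral>\<^sup>+i. ennreal D * ennreal (F i) \<partial>count_space I)" by (intro nn_integral_mono one) simp
      also have "\<dots> = ennreal D * (\<integral>\<^sup>+i. ennreal (F i) \<partial>count_space I)" by (simp add: nn_integral_cmult)
      also have "(\<integral>\<^sup>+i. ennreal (F i) \<partial>count_space I) = (\<integral>\<^sup>+i. (\<integral>\<^sup>+x\<in>q i. ennreal (norm (f x) powr p) \<partial>\<sigma>) \<partial>count_space I)"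
      proof (intro nn_integral_cong)
        fix i
        have int: "integrable \<sigma> (\<lambda>x. indicator (q i) x *\<^sub>R norm (f x) powr p)"
          using f by (intro integrable_mult_indicator) (auto simp: Lp_fun_def q_def sets_lf[OF \<sigma>])
        show "ennreal (F i) = (\<integral>\<^sup>+x\<in>q i. ennreal (norm (f x) powr p) \<partial>\<sigma>)"
          unfolding F_def set_lebesgue_integral_def
          by (subst nn_integral_eq_integral[OF int, symmetric]) (auto intro!: nn_integral_cong split: split_indicator)
      qed
      also have "\<dots> \<le> ennreal 1 * (\<integral>\<^sup>+x\<in>UNIV. ennreal (norm (f x) powr p) \<partial>\<sigma>)"
      proof (rule nn_integral_bounded_overlap[OF I(1)])
        fix x
        show "finite {i \<in> I. x \<in> q i} \<and> real (card {i \<in> I. x \<in> q i}) \<le> 1"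
        proof (cases "{i \<in> I. x \<in> q i} = {}")
          case False
          then obtain i where i: "i \<in> I" "x \<in> q i" by blast
          have "{i \<in> I. x \<in> q i} = {i}"
          proof -
            have "j = i" if "j \<in> I" "x \<in> q j" for j
              using dis i that qb I(2) unfolding pairwise_def disjnt_iff by blast
            thus ?thesis using i by blast
          qed
          thus ?thesis by simp
        qed (simp only: finite.emptyI card.empty, simp)
      qed (use f in \<open>auto simp: Lp_fun_def q_def sets_lf[OF \<sigma>]\<close>)
      also have "\<dots> = ennreal (\<integral>x. norm (f x) powr p \<partial>\<sigma>)" using f by (simp add: Lp_fun_def nn_integral_eq_integral)
      finally show ?thesis using D0 integral_powr_nonneg[of f] by (simp add: ennreal_mult mult_left_mono)
    qed
    have "{x. ennreal t < M f x} = (\<Union>m::nat. U (real m))"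
      unfolding less_maximal_op_iff[OF \<sigma> fm less_imp_le[OF t]] U_def using reals_Archimedean2 by (auto; blast)
    also have "emeasure \<omega> \<dots> = (SUP m. emeasure \<omega> (U (real m)))"
    proof (rule SUP_emeasure_incseq[symmetric])
      show "range (\<lambda>m. U (real m)) \<subseteq> sets \<omega>" using Uo by (auto simp: sets_lf[OF \<omega>])
      show "incseq (\<lambda>m. U (real m))"
        unfolding incseq_def
      proof (intro allI impI subsetI)
        fix k m :: nat and x assume "k \<le> m" "x \<in> U (real k)"
        moreover from this obtain a l where "0 < l" "l < real k" "x \<in> cbox a (\<chi> i. a $ i + l)"
          "ennreal (t * l ^ CARD('n)) < abs_mass \<sigma> f (cbox a (\<chi> i. a $ i + l))" by (auto simp: U_def)
        moreover from this have "l < real m" using \<open>k \<le> m\<close> by simp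
        ultimately show "x \<in> U (real m)" unfolding U_def by blast
      qed
    qed
    finally have "ennreal (t powr p) * emeasure \<omega> {x. ennreal t < M f x} = (SUP m. ennreal (t powr p) * emeasure \<omega> (U (real m)))"
      by (simp add: SUP_mult_left_ennreal)
    also have "\<dots> \<le> ennreal (D * (\<integral>x. norm (f x) powr p \<partial>\<sigma>))" by (intro SUP_least each)
    finally show ?thesis .
  qed
  thus ?thesis using D0 unfolding weak_bound_def by blast
qed

subsection \<open>Separated sets and the two weight condition\<close>


text \<open>An A_p type bound for a small set near x against a set in an annulus about x. The
  exponents are parameters because the two measures exchange roles when p > 2.\<close>

definition separated_bound ::
  "(real ^ 'n) measure \<Rightarrow> (real ^ 'n) measure \<Rightarrow> real \<Rightarrow> real \<Rightarrow> real \<Rightarrow> real \<Rightarrow> real \<Rightarrow> bool" where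
  "separated_bound \<mu> \<nu> q \<alpha> \<theta> b C \<longleftrightarrow> 0 \<le> C \<and> (\<forall>x s P P'. 0 < s \<and> P \<in> sets borel \<and> P' \<in> sets borel \<and>
     P \<subseteq> cball x (\<theta> * s) \<and> P' \<subseteq> {y. s \<le> dist x y \<and> dist x y \<le> b * s} \<longrightarrow>
     measure \<mu> P * measure \<nu> P' powr q \<le> C * s powr \<alpha>)"

text \<open>The test function is the conjugate phase of the kernel at the centre, restricted to P'.
  On P the kernel differs from that at the centre by at most half of the lower bound, so nothing
  cancels and T f is at least r \<sigma>(P') on all of P.\<close>

lemma (in two_weight) kernel_separated:
  assumes D: "weak_bound p \<sigma> \<omega> T D" and c: "0 < c" and k: "1 \<le> k" "d k \<le> c / 2" and b: "1 \<le> b"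
    and s: "0 < s" and P: "P \<in> sets borel" "P \<subseteq> cball x\<^sub>0 (s / 2 ^ k)"
    and P': "P' \<in> sets borel" "P' \<subseteq> {y. s \<le> dist x\<^sub>0 y \<and> dist x\<^sub>0 y \<le> b * s}"
    and lower: "\<And>y. y \<in> P' \<Longrightarrow> c / dist x\<^sub>0 y ^ CARD('n) \<le> norm (K x\<^sub>0 y)"
  shows "measure \<omega> P * measure \<sigma> P' powr (p - 1) \<le> D * (4 / c) powr p * ((b * s) ^ CARD('n)) powr p"
proof -
  define m where "m = measure \<sigma> P'"
  \<comment> \<open>Half of the lower bound at the largest distance b s; the other half pays for
    leaving the centre.\<close>
  define r where "r = c / 2 / (b * s) ^ CARD('n)"
  have r: "0 < r" using c b s by (simp add: r_def)
  have D0: "0 \<le> D" using D by (simp add: weak_bound_def)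
  have bP': "bounded P'" by (rule bounded_subset[of "cball x\<^sub>0 (b * s)"]) (use P' in auto)
  have bP: "bounded P" by (rule bounded_subset[OF _ P(2)]) simp
  have eP: "emeasure \<omega> P = ennreal (measure \<omega> P)" "emeasure \<sigma> P' = ennreal m"
    unfolding m_def using emeasure_eq_measure_finite emeasure_bounded_lf \<omega> \<sigma> bP bP' by blast+
  define f where "f y = indicator P' y * (cnj (K x\<^sub>0 y) / of_real (norm (K x\<^sub>0 y)))" for y
  have Kpos: "0 < norm (K x\<^sub>0 y)" if "y \<in> P'" for y
  proof -
    have "0 < dist x\<^sub>0 y" using P'(2) s that by force
    hence "0 < c / dist x\<^sub>0 y ^ CARD('n)" using c by simp
    thus ?thesis using lower[OF that] by linarith
  qed
  have fn: "norm (f y) = indicator P' y" for y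
    using Kpos[of y] by (auto simp: f_def norm_mult norm_divide split: split_indicator)
  hence fp: "norm (f y) powr p = indicator P' y" for y by (auto split: split_indicator)
  have fm: "f \<in> borel_measurable borel"
  proof -
    have "cnj \<in> borel_measurable borel" "complex_of_real \<in> borel_measurable borel"
      by (intro borel_measurable_continuous_onI continuous_intros)+
    hence "(\<lambda>y. cnj (K x\<^sub>0 y)) \<in> borel_measurable borel" "(\<lambda>y. complex_of_real (norm (K x\<^sub>0 y))) \<in> borel_measurable borel"
      using Km by (auto intro: measurable_compose)
    thus ?thesis unfolding f_def[abs_def]
      using P'(1) by (intro borel_measurable_times borel_measurable_divide borel_measurable_indicator)
  qed
  have int: "integrable \<sigma> (\<lambda>x. indicator P' x :: real)"
    using P'(1) eP(2) by (intro integrable_real_indicator) (auto simp: sets_lf[OF \<sigma>])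
  have f: "f \<in> Lp_fun p \<sigma>" using fm int by (simp add: Lp_fun_def fp measurable_lf[OF \<sigma>])
  have I: "(\<integral>x. norm (f x) powr p \<partial>\<sigma>) = m"
    unfolding fp m_def by (simp add: space_lf[OF \<sigma>])
  note fl = Lp_loc_integrable[OF f]
  have "\<forall>a>0. \<forall>R. \<exists>\<phi>\<in>\<Phi>. \<forall>w. a \<le> norm w \<and> norm w \<le> R \<longrightarrow> \<phi> w = 1"
    using \<Phi> unfolding truncation_family_def by blast
  \<comment> \<open>Distances between P and P' lie between s / 2 and b s + s, so one cutoff is one
    on all of them.\<close>
  then obtain \<phi> where \<phi>: "\<phi> \<in> \<Phi>" "\<And>w. s / 2 \<le> norm w \<Longrightarrow> norm w \<le> b * s + s \<Longrightarrow> \<phi> w = 1"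
    using s by (meson half_gt_zero)
  have T: "ennreal (r * m) \<le> T f x" if x: "x \<in> P" for x
  proof -
    have "(2::real) ^ 1 \<le> 2 ^ k" using k(1) by (intro power_increasing) auto
    hence "s / 2 ^ k \<le> s / 2" using s by (intro divide_left_mono) auto
    moreover have "norm (x\<^sub>0 - x) \<le> s / 2 ^ k" using x P(2) by (auto simp: dist_norm)
    ultimately have xx: "norm (x\<^sub>0 - x) \<le> s / 2" "norm (x\<^sub>0 - x) * 2 ^ k \<le> s"
      by (linarith, simp add: pos_le_divide_eq)
    define h where "h y = K x y * of_real (\<phi> (x - y)) * f y" for y
    have hint: "integrable \<sigma> h" unfolding h_def by (rule trunc_integrable[OF fl]) (use \<phi> in simp)
    have re: "r * indicator P' y \<le> Re (h y)" for y
    proof (cases "y \<in> P'")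
      case True
      have y: "s \<le> norm (x\<^sub>0 - y)" "norm (x\<^sub>0 - y) \<le> b * s" using True P'(2) by (auto simp: dist_norm)
      hence ne: "x\<^sub>0 \<noteq> y" using s by auto
      have "\<phi> (x - y) = 1"
        using norm_triangle_ineq[of "x\<^sub>0 - x" "x - y"] norm_triangle_ineq[of "x - x\<^sub>0" "x\<^sub>0 - y"] xx(1) y s
        by (intro \<phi>(2)) (auto simp: norm_minus_commute[of x x\<^sub>0])
      moreover have "K x\<^sub>0 y * f y = of_real (norm (K x\<^sub>0 y))"
        using True Kpos[OF True] by (simp add: f_def complex_norm_square[symmetric] power2_eq_square)
      ultimately have "h y = of_real (norm (K x\<^sub>0 y)) - (K x\<^sub>0 y - K x y) * f y"
        by (simp add: h_def left_diff_distrib)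
      hence "Re (h y) = norm (K x\<^sub>0 y) - Re ((K x\<^sub>0 y - K x y) * f y)" by simp
      moreover have "Re ((K x\<^sub>0 y - K x y) * f y) \<le> norm ((K x\<^sub>0 y - K x y) * f y)" by (rule complex_Re_le_cmod)
      moreover have "norm ((K x\<^sub>0 y - K x y) * f y) = norm (K x\<^sub>0 y - K x y)" using True by (simp add: norm_mult fn)
      moreover have "norm (K x\<^sub>0 y - K x y) \<le> d k / norm (x\<^sub>0 - y) ^ CARD('n)"
        by (rule Ksmooth[OF k(1) ne]) (use xx y in linarith)
      moreover have "d k / norm (x\<^sub>0 - y) ^ CARD('n) \<le> c / 2 / norm (x\<^sub>0 - y) ^ CARD('n)"
        using k(2) by (intro divide_right_mono) auto
      moreover have "c / norm (x\<^sub>0 - y) ^ CARD('n) \<le> norm (K x\<^sub>0 y)" using lower[OF True] by (simp add: dist_norm)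
      moreover have "c / norm (x\<^sub>0 - y) ^ CARD('n) = c / 2 / norm (x\<^sub>0 - y) ^ CARD('n) + c / 2 / norm (x\<^sub>0 - y) ^ CARD('n)"
        by (simp add: field_simps)
      moreover have "r \<le> c / 2 / norm (x\<^sub>0 - y) ^ CARD('n)"
        unfolding r_def using y ne c b s by (intro divide_left_mono power_mono mult_pos_pos zero_less_power) auto
      ultimately have "r \<le> Re (h y)" by linarith
      thus ?thesis using True by simp
    qed (simp add: h_def f_def)
    have "r * m = (\<integral>y. r * indicator P' y \<partial>\<sigma>)" using int by (simp add: m_def space_lf[OF \<sigma>])
    also have "\<dots> \<le> (\<integral>y. Re (h y) \<partial>\<sigma>)"
      using int hint re by (intro integral_mono integrable_mult_right integrable_bounded_linear[OF bounded_linear_Re]) auto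
    also have "\<dots> = Re (\<integral>y. h y \<partial>\<sigma>)" by (rule integral_bounded_linear[OF bounded_linear_Re hint])
    also have "\<dots> \<le> norm (\<integral>y. h y \<partial>\<sigma>)" by (rule complex_Re_le_cmod)
    finally have "ennreal (r * m) \<le> ennreal (norm (\<integral>y. h y \<partial>\<sigma>))" by (rule ennreal_leI)
    also have "\<dots> \<le> T f x" unfolding h_def by (rule trunc_le_T) (use \<phi> in simp)
    finally show ?thesis .
  qed
  show ?thesis
  proof (cases "m = 0")
    case True
    thus ?thesis using D0 p by (simp add: m_def)
  next
    case False
    hence m0: "0 < m" by (simp add: m_def less_le)
    \<comment> \<open>A level strictly below the bound r m, since superlevel sets are
      strict.\<close>
    define t where "t = r * m / 2"
    have t: "0 < t" using r m0 by (simp add: t_def)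
    have "P \<subseteq> {x. ennreal t < T f x}"
    proof
      fix x assume "x \<in> P"
      have "ennreal t < ennreal (r * m)" using r m0 by (simp add: t_def ennreal_less_iff)
      thus "x \<in> {x. ennreal t < T f x}" using T[OF \<open>x \<in> P\<close>] by simp
    qed
    hence "emeasure \<omega> P \<le> emeasure \<omega> {x. ennreal t < T f x}"
      by (rule emeasure_mono) (simp add: sets_lf[OF \<omega>] open_T_superlevel[OF fl])
    hence "ennreal (t powr p) * emeasure \<omega> P \<le> ennreal (t powr p) * emeasure \<omega> {x. ennreal t < T f x}"
      by (rule mult_left_mono) simp
    also have "\<dots> \<le> ennreal (D * m)" using D f t I by (auto simp: weak_bound_def)
    finally have "t powr p * measure \<omega> P \<le> D * m"
      using D0 m0 by (simp add: eP ennreal_mult[symmetric])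
    moreover have "t powr p = (r / 2) powr p * m powr p" unfolding powr_mult[symmetric] by (simp add: t_def)
    moreover have "m powr p = m powr (p - 1) * m" using m0 powr_add[of m "p - 1" 1] by simp
    ultimately have "m * ((r / 2) powr p * (measure \<omega> P * m powr (p - 1))) \<le> m * D" by (simp add: mult_ac)
    hence "(r / 2) powr p * (measure \<omega> P * m powr (p - 1)) \<le> D" using m0 by simp
    hence "(2 / r) powr p * ((r / 2) powr p * (measure \<omega> P * m powr (p - 1))) \<le> (2 / r) powr p * D"
      by (rule mult_left_mono) simp
    moreover have "(2 / r) powr p * (r / 2) powr p = 1" unfolding powr_mult[symmetric] using r by simp
    moreover have "(2 / r) powr p = (4 / c) powr p * ((b * s) ^ CARD('n)) powr p"
      unfolding powr_mult[symmetric] by (simp add: r_def)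
    ultimately show ?thesis unfolding m_def[symmetric] by (simp only: mult.assoc[symmetric] mult_1_left) (simp add: mult_ac)
  qed
qed

text \<open>Which kernel is large at the centre depends on the direction, so the annular set is
  covered by J pieces, one of which carries at least 1 / J of its mass. Since the kernels are
  finitely many, one k serves all of them.\<close>

lemma kernels_separated:
  fixes \<sigma> \<omega> :: "(real ^ 'n) measure" and p p' :: real and K :: "nat \<Rightarrow> real ^ 'n \<Rightarrow> real ^ 'n \<Rightarrow> complex"
  assumes \<sigma>: "locally_finite_borel \<sigma>" and \<omega>: "locally_finite_borel \<omega>" and p: "1 < p" "1 / p + 1 / p' = 1"
    and \<Phi>: "truncation_family B \<Phi>" and K: "\<And>j. j \<in> {1..J} \<Longrightarrow> \<exists>C d. dini_kernel C d (K j)"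
    and weak: "\<And>j. j \<in> {1..J} \<Longrightarrow> \<exists>D. weak_bound p \<sigma> \<omega> (trunc_max \<Phi> (K j) \<sigma>) D"
    and c: "0 < c" and b: "1 \<le> b"
    and dir: "\<And>u::real ^ 'n. norm u = 1 \<Longrightarrow> \<exists>j\<in>{1..J}. \<forall>t x. t \<noteq> 0 \<longrightarrow> norm (K j x (x + t *\<^sub>R u)) \<ge> c / \<bar>t\<bar> ^ CARD('n)"
  shows "\<exists>\<theta> C. 0 < \<theta> \<and> \<theta> \<le> 1 / 2 \<and> separated_bound \<omega> \<sigma> (p - 1) (real CARD('n) * p) \<theta> b C"
proof -
  obtain C d where Cd: "\<And>j. j \<in> {1..J} \<Longrightarrow> dini_kernel (C j) (d j) (K j)" using K by metis
  obtain D where D: "\<And>j. j \<in> {1..J} \<Longrightarrow> weak_bound p \<sigma> \<omega> (trunc_max \<Phi> (K j) \<sigma>) (D j)" using weak by metis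
  have D0: "0 \<le> D j" if "j \<in> {1..J}" for j using D[OF that] by (simp add: weak_bound_def)
  have dir': "\<exists>j\<in>{1..J}. c / dist x y ^ CARD('n) \<le> norm (K j x y)" if "x \<noteq> y" for x y
  proof -
    have "norm ((1 / norm (y - x)) *\<^sub>R (y - x)) = 1" using that by simp
    from dir[OF this] obtain j where j: "j \<in> {1..J}" "\<And>t x'. t \<noteq> 0 \<Longrightarrow>
        c / \<bar>t\<bar> ^ CARD('n) \<le> norm (K j x' (x' + t *\<^sub>R ((1 / norm (y - x)) *\<^sub>R (y - x))))" by blast
    show ?thesis using j(2)[of "norm (y - x)" x] that j(1) by (intro bexI[of _ j]) (auto simp: dist_norm norm_minus_commute)
  qed
  \<comment> \<open>The existence of a direction provides at least one kernel.\<close>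
  have J: "{1..J} \<noteq> {}"
  proof -
    have "(0 :: real ^ 'n) \<noteq> axis undefined 1" by (metis axis_eq_0_iff zero_neq_one)
    from dir'[OF this] show ?thesis by blast
  qed
  have "\<forall>\<^sub>F k in sequentially. \<forall>j\<in>{1..J}. d j k < c / 2"
  proof (intro eventually_ball_finite ballI)
    fix j assume "j \<in> {1..J}"
    hence "d j \<longlonglongrightarrow> 0" using Cd by (intro summable_LIMSEQ_zero) (auto simp: dini_kernel_def)
    thus "\<forall>\<^sub>F k in sequentially. d j k < c / 2" using c by (intro order_tendstoD(2)) auto
  qed simp
  hence "\<forall>\<^sub>F k in sequentially. (\<forall>j\<in>{1..J}. d j k < c / 2) \<and> 1 \<le> k"
    using eventually_ge_at_top[of 1] by eventually_elim auto
  from eventually_happens'[OF sequentially_bot this] obtain k where kc: "\<forall>j\<in>{1..J}. d j k < c / 2" "1 \<le> k"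
    by blast
  hence k: "\<And>j. j \<in> {1..J} \<Longrightarrow> d j k \<le> c / 2" "1 \<le> k" by (auto intro: less_imp_le)
  define A where "A = (\<Sum>j\<in>{1..J}. D j) * (4 / c) powr p * (b ^ CARD('n)) powr p"
  have "(2::real) ^ 1 \<le> 2 ^ k" using k by (intro power_increasing) auto
  hence k2: "1 / 2 ^ k \<le> (1::real) / 2" by (intro divide_left_mono) auto
  have "separated_bound \<omega> \<sigma> (p - 1) (real CARD('n) * p) (1 / 2 ^ k) b (real J powr (p - 1) * A)"
    unfolding separated_bound_def
  proof (intro conjI allI impI; (elim conjE)?)
    show "0 \<le> real J powr (p - 1) * A" using D0 by (auto simp: A_def intro!: mult_nonneg_nonneg sum_nonneg)
    fix x :: "real ^ 'n" and s P P'
    assume s: "0 < s" and P: "P \<in> sets borel" "P \<subseteq> cball x (1 / 2 ^ k * s)"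
      and P': "P' \<in> sets borel" "P' \<subseteq> {y. s \<le> dist x y \<and> dist x y \<le> b * s}"
    define S where "S j = {y \<in> P'. c / dist x y ^ CARD('n) \<le> norm (K j x y)}" for j
    have Sm: "S j \<in> sets borel" if "j \<in> {1..J}" for j
    proof -
      have [measurable]: "K j x \<in> borel_measurable borel" using Cd[OF that] by (simp add: dini_kernel_def)
      note [measurable] = P'(1)
      show ?thesis unfolding S_def by measurable
    qed
    have "P' \<subseteq> (\<Union>j\<in>{1..J}. S j)"
    proof
      fix y assume y: "y \<in> P'"
      hence "x \<noteq> y" using P'(2) s by auto
      thus "y \<in> (\<Union>j\<in>{1..J}. S j)" using dir' y unfolding S_def by blast
    qed
    hence PU: "P' = (\<Union>j\<in>{1..J}. S j)" by (auto simp: S_def)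
    have bP': "bounded P'" by (rule bounded_subset[of "cball x (b * s)"]) (use P' in auto)
    have "emeasure \<sigma> (S j) \<noteq> \<infinity>" for j
      using emeasure_bounded_lf[OF \<sigma> bounded_subset[OF bP', of "S j"]] by (auto simp: S_def)
    hence sum: "measure \<sigma> P' \<le> (\<Sum>j\<in>{1..J}. measure \<sigma> (S j))"
      unfolding PU using Sm by (intro measure_subadditive_finite) (auto simp: sets_lf[OF \<sigma>])
    have "\<exists>j\<in>{1..J}. measure \<sigma> P' \<le> real J * measure \<sigma> (S j)"
    proof (rule ccontr)
      assume "\<not> ?thesis"
      hence "(\<Sum>j\<in>{1..J}. real J * measure \<sigma> (S j)) < (\<Sum>j\<in>{1..J}. measure \<sigma> P')"
        using J by (intro sum_strict_mono) (auto simp: not_le)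
      hence "real J * (\<Sum>j\<in>{1..J}. measure \<sigma> (S j)) < real J * measure \<sigma> P'" by (simp add: sum_distrib_left)
      thus False using sum by (simp add: mult_less_cancel_left)
    qed
    then obtain j where j: "j \<in> {1..J}" "measure \<sigma> P' \<le> real J * measure \<sigma> (S j)" by blast
    interpret two_weight \<sigma> "K j" "C j" "d j" \<Phi> B \<omega> p p'
      by unfold_locales (use \<sigma> \<omega> \<Phi> p Cd[OF j(1)] in auto)
    have "measure \<omega> P * measure \<sigma> P' powr (p - 1) \<le> measure \<omega> P * (real J * measure \<sigma> (S j)) powr (p - 1)"
      using j(2) p by (intro mult_left_mono powr_mono2) auto
    also have "\<dots> = real J powr (p - 1) * (measure \<omega> P * measure \<sigma> (S j) powr (p - 1))"
      by (simp only: powr_mult mult_ac)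
    also have "\<dots> \<le> real J powr (p - 1) * (D j * (4 / c) powr p * ((b * s) ^ CARD('n)) powr p)"
    proof (rule mult_left_mono)
      have 1: "P \<subseteq> cball x (s / 2 ^ k)" using P(2) by simp
      have 2: "S j \<subseteq> {y. s \<le> dist x y \<and> dist x y \<le> b * s}" using P'(2) by (auto simp: S_def)
      show "measure \<omega> P * measure \<sigma> (S j) powr (p - 1) \<le> D j * (4 / c) powr p * ((b * s) ^ CARD('n)) powr p"
        by (rule kernel_separated[OF D[OF j(1)] c k(2) k(1)[OF j(1)] b s P(1) 1 Sm[OF j(1)] 2]) (simp add: S_def)
    qed simp
    also have "\<dots> \<le> real J powr (p - 1) * ((\<Sum>j\<in>{1..J}. D j) * (4 / c) powr p * ((b * s) ^ CARD('n)) powr p)"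
      using D0 j(1) by (intro mult_left_mono mult_right_mono member_le_sum) auto
    also have "((b * s) ^ CARD('n)) powr p = (b ^ CARD('n)) powr p * s powr (real CARD('n) * p)"
      using s by (simp only: power_mult_distrib powr_mult) (simp add: powr_powr flip: powr_realpow)
    finally show "measure \<omega> P * measure \<sigma> P' powr (p - 1) \<le> real J powr (p - 1) * A * s powr (real CARD('n) * p)"
      by (simp add: A_def mult_ac)
  qed
  thus ?thesis using k2 by (intro exI[of _ "1 / 2 ^ k"] exI[of _ "real J powr (p - 1) * A"]) auto
qed

text \<open>Disjoint Vitali balls of radius r / 5 fit into a ball of radius R + r / 5, which bounds
  their number; their fivefold enlargements cover.\<close>

lemma finite_cball_cover:
  fixes x :: "real ^ 'n"
  assumes A: "A \<subseteq> cball x R" and r: "0 < r" and R: "0 \<le> R"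
  obtains F where "finite F" "F \<subseteq> A" "A \<subseteq> (\<Union>z\<in>F. cball z r)" "real (card F) \<le> (5 * R / r + 1) ^ CARD('n)"
proof -
  obtain F where F: "F \<subseteq> A" and dis: "pairwise (\<lambda>i j. disjnt (cball i (r / 5)) (cball j (r / 5))) F"
    and cov: "A \<subseteq> (\<Union>z\<in>F. cball z (5 * (r / 5)))"
  proof (rule Vitali_covering_lemma_cballs[where S=A and K=A and a="\<lambda>z. z" and r="\<lambda>_. r / 5" and B="r / 5"])
    show "A \<subseteq> (\<Union>i\<in>A. cball i (r / 5))" using r by force
  qed (use r in auto)
  have sub: "cball z (r / 5) \<subseteq> cball x (R + r / 5)" if "z \<in> F" for z
  proof
    fix y assume "y \<in> cball z (r / 5)"
    moreover have "dist x z \<le> R" using that F A by auto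
    ultimately show "y \<in> cball x (R + r / 5)" using dist_triangle[of x y z] by simp
  qed
  have "(R + r / 5) / (r / 5) = 5 * R / r + 1" using r by (simp add: field_simps)
  thus ?thesis
    using card_disjoint_cballs[OF _ _ dis _ sub] r R F cov by (intro that[of F]) auto
qed

text \<open>Cover the annular set by boundedly many balls of radius \<theta> s / 2. From the centre
  of one of them P lies at distances between s / 2 and 6 s, an annulus of ratio 12 at scale s / 2.
  Hence the ratio drops from 12 to 5 in the exchange.\<close>

lemma separated_bound_swap:
  fixes \<mu> \<nu> :: "(real ^ 'n) measure"
  assumes \<mu>: "locally_finite_borel \<mu>" and q: "0 < q" and \<theta>: "0 < \<theta>" "\<theta> \<le> 1 / 2" and \<alpha>: "0 \<le> \<alpha>"
    and sep: "separated_bound \<mu> \<nu> q \<alpha> \<theta> 12 C"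
  shows "\<exists>C'. separated_bound \<nu> \<mu> (1 / q) (\<alpha> / q) \<theta> 5 C'"
proof -
  define m where "m = (50 / \<theta> + 1) ^ CARD('n)"
  have m0: "0 \<le> m" using \<theta> by (simp add: m_def)
  have C0: "0 \<le> C" using sep by (simp add: separated_bound_def)
  have "separated_bound \<nu> \<mu> (1 / q) (\<alpha> / q) \<theta> 5 ((m * C) powr (1 / q))"
    unfolding separated_bound_def
  proof (intro conjI allI impI; (elim conjE)?)
    fix y :: "real ^ 'n" and s P P'
    assume s: "0 < s" and P: "P \<in> sets borel" "P \<subseteq> cball y (\<theta> * s)"
      and P': "P' \<in> sets borel" "P' \<subseteq> {x. s \<le> dist y x \<and> dist y x \<le> 5 * s}"
    have sub: "P' \<subseteq> cball y (5 * s)" using P'(2) by auto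
    have \<theta>s: "\<theta> * s \<le> 1 / 2 * s" using \<theta> s by (intro mult_right_mono) auto
    obtain F where F: "finite F" "F \<subseteq> P'" "P' \<subseteq> (\<Union>z\<in>F. cball z (\<theta> * (s / 2)))"
      and card: "real (card F) \<le> (5 * (5 * s) / (\<theta> * (s / 2)) + 1) ^ CARD('n)"
      by (rule finite_cball_cover[OF sub, of "\<theta> * (s / 2)"]) (use \<theta> s in auto)
    have eq50: "5 * (5 * s) / (\<theta> * (s / 2)) = 50 / \<theta>" using \<theta> s by (simp add: field_simps)
    have card: "real (card F) \<le> m" using card unfolding eq50 by (simp add: m_def)
    have each: "measure \<mu> (P' \<inter> cball z (\<theta> * (s / 2))) * measure \<nu> P powr q \<le> C * s powr \<alpha>" if z: "z \<in> F" for z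
    proof -
      have yz: "s \<le> dist y z" "dist y z \<le> 5 * s" using z F(2) P'(2) by auto
      have "P \<subseteq> {w. s / 2 \<le> dist z w \<and> dist z w \<le> 12 * (s / 2)}"
      proof
        fix w assume "w \<in> P"
        hence "dist y w \<le> 1 / 2 * s" using P(2) \<theta>s by auto
        thus "w \<in> {w. s / 2 \<le> dist z w \<and> dist z w \<le> 12 * (s / 2)}"
          using yz dist_triangle[of y z w] dist_triangle[of z w y] s by (simp add: dist_commute)
      qed
      hence "measure \<mu> (P' \<inter> cball z (\<theta> * (s / 2))) * measure \<nu> P powr q \<le> C * (s / 2) powr \<alpha>"
        using sep s P P' unfolding separated_bound_def
        by (elim conjE allE[of _ z] allE[of _ "s / 2"] allE[of _ "P' \<inter> cball z (\<theta> * (s / 2))"] allE[of _ P]) auto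
      also have "\<dots> \<le> C * s powr \<alpha>" using C0 s \<alpha> by (intro mult_left_mono powr_mono2) auto
      finally show ?thesis .
    qed
    have "measure \<mu> P' \<le> (\<Sum>z\<in>F. measure \<mu> (P' \<inter> cball z (\<theta> * (s / 2))))"
    proof -
      have "P' = (\<Union>z\<in>F. P' \<inter> cball z (\<theta> * (s / 2)))" using F(3) by blast
      moreover have "measure \<mu> (\<Union>z\<in>F. P' \<inter> cball z (\<theta> * (s / 2))) \<le> (\<Sum>z\<in>F. measure \<mu> (P' \<inter> cball z (\<theta> * (s / 2))))"
      proof (intro measure_subadditive_finite F(1))
        show "emeasure \<mu> (P' \<inter> cball z (\<theta> * (s / 2))) \<noteq> \<infinity>" for z
          using emeasure_bounded_lf[OF \<mu>, of "P' \<inter> cball z (\<theta> * (s / 2))"] by (simp add: bounded_Int less_top)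
      qed (use P' in \<open>auto simp: sets_lf[OF \<mu>]\<close>)
      ultimately show ?thesis by simp
    qed
    hence "measure \<mu> P' * measure \<nu> P powr q \<le> (\<Sum>z\<in>F. measure \<mu> (P' \<inter> cball z (\<theta> * (s / 2))) * measure \<nu> P powr q)"
      unfolding sum_distrib_right[symmetric] by (rule mult_right_mono) simp
    also have "\<dots> \<le> (\<Sum>z\<in>F. C * s powr \<alpha>)" by (intro sum_mono each)
    also have "\<dots> \<le> m * (C * s powr \<alpha>)" using card C0 by (auto intro: mult_right_mono)
    finally have "(measure \<mu> P' * measure \<nu> P powr q) powr (1 / q) \<le> (m * C * s powr \<alpha>) powr (1 / q)"
      using q by (intro powr_mono2) auto
    thus "measure \<nu> P * measure \<mu> P' powr (1 / q) \<le> (m * C) powr (1 / q) * s powr (\<alpha> / q)"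
      using q by (simp add: powr_mult powr_powr mult.commute)
  qed simp
  thus ?thesis ..
qed

text \<open>After division by x + y both numbers lie between 0 and 1, where t \<le> t^q.\<close>

lemma powr_add_le:
  fixes x y :: real
  assumes "0 \<le> x" "0 \<le> y" "0 < q" "q \<le> 1"
  shows "(x + y) powr q \<le> x powr q + y powr q"
proof (cases "x + y = 0")
  case True
  thus ?thesis using assms by simp
next
  case False
  define t where "t = x + y"
  have t: "0 < t" using False assms by (simp add: t_def)
  have le: "u / t \<le> (u / t) powr q" if "0 \<le> u" "u \<le> t" for u
    using powr_mono'[of q 1 "u / t"] that t assms(3,4) by simp
  have "1 = x / t + y / t" using t by (simp add: t_def add_divide_distrib[symmetric])
  also have "\<dots> \<le> (x / t) powr q + (y / t) powr q" using assms by (intro add_mono le) (auto simp: t_def)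
  also have "\<dots> = (x powr q + y powr q) / t powr q" using assms t by (simp add: powr_divide add_divide_distrib)
  finally show ?thesis using t by (simp add: t_def[symmetric] pos_le_divide_eq)
qed

text \<open>Only finitely many atoms exceed a given size, as their total mass is at most
  \<nu>(Q).\<close>

lemma countable_atoms:
  fixes \<nu> :: "(real ^ 'n) measure"
  assumes \<nu>: "locally_finite_borel \<nu>" and Q: "compact Q"
  shows "countable {x \<in> Q. measure \<nu> {x} \<noteq> 0}"
proof -
  have fin: "finite {x \<in> Q. 1 / real (Suc m) < measure \<nu> {x}}" for m
  proof (rule finite_if_finite_subsets_card_bdd[THEN conjunct1])
    fix G assume G: "G \<subseteq> {x \<in> Q. 1 / real (Suc m) < measure \<nu> {x}}" "finite G"
    have "real (card G) * (1 / real (Suc m)) \<le> (\<Sum>x\<in>G. measure \<nu> {x})"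
      using G by (intro sum_bounded_below) (auto intro: less_imp_le)
    also have "\<dots> = measure \<nu> (\<Union>x\<in>G. {x})"
    proof (rule measure_finite_Union[OF G(2), symmetric])
      show "emeasure \<nu> {x} \<noteq> \<infinity>" for x using emeasure_bounded_lf[OF \<nu>, of "{x}"] by auto
    qed (auto simp: sets_lf[OF \<nu>] disjoint_family_on_def)
    also have "\<dots> \<le> measure \<nu> Q"
      using G Q emeasure_bounded_lf[OF \<nu> compact_imp_bounded[OF Q]]
      by (intro measure_mono_fmeasurable)
        (auto simp: sets_lf[OF \<nu>] fmeasurable_def borel_compact intro!: borel_closed finite_imp_closed)
    finally have "real (card G) \<le> measure \<nu> Q * real (Suc m)" by (simp add: field_simps)
    thus "card G \<le> nat \<lfloor>measure \<nu> Q * real (Suc m)\<rfloor>" by linarith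
  qed
  have "{x \<in> Q. measure \<nu> {x} \<noteq> 0} \<subseteq> (\<Union>m. {x \<in> Q. 1 / real (Suc m) < measure \<nu> {x}})"
  proof
    fix x assume x: "x \<in> {x \<in> Q. measure \<nu> {x} \<noteq> 0}"
    hence "0 < measure \<nu> {x}" by (simp add: less_le)
    then obtain m where "inverse (real (Suc m)) < measure \<nu> {x}" using reals_Archimedean by blast
    hence "1 / real (Suc m) < measure \<nu> {x}" by (simp only: inverse_eq_divide)
    thus "x \<in> (\<Union>m. {x \<in> Q. 1 / real (Suc m) < measure \<nu> {x}})" using x by blast
  qed
  thus ?thesis by (rule countable_subset[OF _ countable_UN[OF countableI_type countable_finite[OF fin]]])
qed

lemma separated_boundD:
  assumes "separated_bound \<mu> \<nu> q \<alpha> \<theta> b C" "0 < s" "P \<in> sets borel" "P' \<in> sets borel"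
    "P \<subseteq> cball x (\<theta> * s)" "P' \<subseteq> {y. s \<le> dist x y \<and> dist x y \<le> b * s}"
  shows "measure \<mu> P * measure \<nu> P' powr q \<le> C * s powr \<alpha>"
  using assms unfolding separated_bound_def by blast

text \<open>Split \<open>\<nu> Q\<close> at each \<open>x\<close> into dyadic annuli around \<open>x\<close>. For small balls of centres \<open>x\<close> the
  annuli of one generation are separated from the ball, and \<open>n < \<alpha>\<close> makes the generations summable;
  what remains is the atom at \<open>x\<close>, which \<open>\<mu>\<close> does not see.\<close>

lemma separated_imp_product_bound:
  fixes \<mu> \<nu> :: "(real ^ 'n) measure"
  assumes \<mu>: "locally_finite_borel \<mu>" and \<nu>: "locally_finite_borel \<nu>"
    and at: "\<And>x. emeasure \<nu> {x} * emeasure \<mu> {x} = 0" and q: "0 < q" "q \<le> 1" and \<alpha>: "real CARD('n) < \<alpha>"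
    and \<theta>: "0 < \<theta>" "\<theta> \<le> 1 / 2" and sep: "separated_bound \<mu> \<nu> q \<alpha> \<theta> 5 C"
  shows "\<exists>C'\<ge>0. \<forall>a l. 0 < l \<longrightarrow> measure \<mu> (cbox a (\<chi> i. a $ i + l)) * measure \<nu> (cbox a (\<chi> i. a $ i + l)) powr q \<le> C' * l powr \<alpha>"
proof -
  define n where "n = real CARD('n)"
  have n: "1 \<le> n" by (simp add: n_def Suc_leI)
  have C0: "0 \<le> C" using sep by (simp add: separated_bound_def)
  \<comment> \<open>Generation k has of the order of 2^(k n) balls, each contributing a multiple of
    2^(-k \<alpha>).\<close>
  define r where "r = 2 powr (n - \<alpha>)"
  have r: "0 < r" "r < 1" using \<alpha> by (auto simp: r_def n_def powr_less_one)
  define A where "A = (21 / \<theta>) ^ CARD('n) * C * (n / 4) powr \<alpha>"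
  have A0: "0 \<le> A" using C0 \<theta> by (simp add: A_def)
  show ?thesis
  proof (intro exI[of _ "A / (1 - r)"] conjI allI impI)
    show "0 \<le> A / (1 - r)" using A0 r by simp
    fix a :: "real ^ 'n" and l :: real assume l: "0 < l"
    define Q where "Q = cbox a (\<chi> i. a $ i + l)"
    have Qc: "compact Q" and Qb [measurable]: "Q \<in> sets borel" by (auto simp: Q_def)
    have fin\<nu>: "emeasure \<nu> X < \<infinity>" if "X \<subseteq> Q" for X
      by (rule emeasure_bounded_lf[OF \<nu> bounded_subset[OF compact_imp_bounded[OF Qc] that]])
    have fin\<mu>: "emeasure \<mu> X = ennreal (measure \<mu> X)" if "X \<subseteq> Q" for X
      by (rule emeasure_eq_measure_finite[OF emeasure_bounded_lf[OF \<mu> bounded_subset[OF compact_imp_bounded[OF Qc] that]]])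
    have mono\<nu>: "measure \<nu> X \<le> measure \<nu> Y" if "X \<subseteq> Y" "Y \<subseteq> Q" "X \<in> sets borel" "Y \<in> sets borel" for X Y
      using that fin\<nu>[of Y] by (intro measure_mono_fmeasurable) (auto simp: fmeasurable_def sets_lf[OF \<nu>])
    define D where "D = n * l"
    have D: "0 < D" using n l by (simp add: D_def)
    have diam: "dist x y \<le> D" if "x \<in> Q" "y \<in> Q" for x y
    proof -
      have "\<bar>(x - y) $ i\<bar> \<le> l" for i
        using that[unfolded Q_def mem_box_cart] by (simp add: abs_le_iff) (smt (verit))
      hence "(\<Sum>i\<in>UNIV. \<bar>(x - y) $ i\<bar>) \<le> (\<Sum>i\<in>(UNIV :: 'n set). l)" by (intro sum_mono)
      thus ?thesis using norm_le_l1_cart[of "x - y"] by (simp add: dist_norm D_def n_def)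
    qed
    \<comment> \<open>The annulus about x between D / 2^(k+1) and D / 2^k reaches from 2 s k to 4 s
      k. From a centre z within s k / 2 of x it appears between s k and 5 s k, which explains the
      ratio 5.\<close>
    define s where "s k = D / 2 ^ (k + 2)" for k :: nat
    have s: "0 < s k" for k using D by (simp add: s_def)
    have aQ: "a \<in> Q" using l by (auto simp: Q_def mem_box_cart)
    hence QD: "Q \<subseteq> cball a D" using diam by auto
    have "\<exists>F. finite F \<and> F \<subseteq> Q \<and> Q \<subseteq> (\<Union>z\<in>F. cball z (\<theta> * s k)) \<and> real (card F) \<le> (21 / \<theta>) ^ CARD('n) * (2 ^ k) ^ CARD('n)" for k
    proof -
      obtain F where F: "finite F" "F \<subseteq> Q" "Q \<subseteq> (\<Union>z\<in>F. cball z (\<theta> * s k))"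
        and card: "real (card F) \<le> (5 * D / (\<theta> * s k) + 1) ^ CARD('n)"
        by (rule finite_cball_cover[OF QD, of "\<theta> * s k"]) (use \<theta> s D in auto)
      have "5 * D / (\<theta> * s k) = 20 / \<theta> * 2 ^ k" using D by (simp add: s_def)
      moreover have "1 * 1 \<le> 1 / \<theta> * 2 ^ k" using \<theta> by (intro mult_mono one_le_power) auto
      moreover have "21 / \<theta> * 2 ^ k = 20 / \<theta> * 2 ^ k + 1 / \<theta> * 2 ^ k" by (simp add: field_simps)
      ultimately have "5 * D / (\<theta> * s k) + 1 \<le> 21 / \<theta> * 2 ^ k" by linarith
      hence "(5 * D / (\<theta> * s k) + 1) ^ CARD('n) \<le> (21 / \<theta> * 2 ^ k) ^ CARD('n)"
        using D \<theta> s[of k] by (intro power_mono) auto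
      hence "real (card F) \<le> (21 / \<theta>) ^ CARD('n) * (2 ^ k) ^ CARD('n)"
        unfolding power_mult_distrib[symmetric] using card by linarith
      thus ?thesis using F by blast
    qed
    then obtain F where F: "\<And>k. finite (F k)" "\<And>k. F k \<subseteq> Q" "\<And>k. Q \<subseteq> (\<Union>z\<in>F k. cball z (\<theta> * s k))"
      and card: "\<And>k. real (card (F k)) \<le> (21 / \<theta>) ^ CARD('n) * (2 ^ k) ^ CARD('n)" by metis
    define P where "P k z = Q \<inter> cball z (\<theta> * s k)" for k z
    define P' where "P' k z = Q \<inter> (cball z (5 * s k) - ball z (s k))" for k z
    have Pm [measurable]: "P k z \<in> sets borel" "P' k z \<in> sets borel" for k z by (auto simp: P_def P'_def)
    have PP': "measure \<mu> (P k z) * measure \<nu> (P' k z) powr q \<le> C * s k powr \<alpha>" for k z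
    proof -
      have "P k z \<subseteq> cball z (\<theta> * s k)" "P' k z \<subseteq> {y. s k \<le> dist z y \<and> dist z y \<le> 5 * s k}"
        by (auto simp: P_def P'_def not_less)
      thus ?thesis by (rule separated_boundD[OF sep s Pm])
    qed
    \<comment> \<open>The indicator selects the centres whose ball contains x; their annuli stand in
      for the annulus about x.\<close>
    define G where "G k x = (\<Sum>z\<in>F k. ennreal (measure \<nu> (P' k z) powr q) * indicator (P k z) x)" for k x
    have Gm [measurable]: "G k \<in> borel_measurable borel" for k unfolding G_def[abs_def] by measurable
    \<comment> \<open>Since t^q is subadditive for q \<le> 1, \<nu>(Q)^q telescopes over the
      shrinking balls about x, whose \<nu> measure tends to that of the point x, namely
      zero.\<close>
    have point: "ennreal (measure \<nu> Q powr q) \<le> (\<Sum>k. G k x)" if x: "x \<in> Q" and x0: "measure \<nu> {x} = 0" for x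
    proof -
      define b where "b k = Q \<inter> cball x (D / 2 ^ k)" for k :: nat
      have bm: "b k \<in> sets borel" "b k \<subseteq> Q" for k by (auto simp: b_def)
      have step: "ennreal (measure \<nu> (b k) powr q) \<le> G k x + ennreal (measure \<nu> (b (Suc k)) powr q)" for k
      proof -
        obtain z where z: "z \<in> F k" "x \<in> cball z (\<theta> * s k)" using F(3) x by blast
        have \<theta>s: "\<theta> * s k \<le> 1 / 2 * s k" using \<theta> s[of k] by (intro mult_right_mono) auto
        have sk: "D / 2 ^ k = 4 * s k" "D / 2 ^ Suc k = 2 * s k" by (simp_all add: s_def)
        have "b k \<subseteq> P' k z \<union> b (Suc k)"
        proof
          fix y assume y: "y \<in> b k"
          show "y \<in> P' k z \<union> b (Suc k)"
          proof (cases "y \<in> b (Suc k)")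
            case False
            hence d: "2 * s k < dist x y" "dist x y \<le> 4 * s k" using y unfolding b_def sk by auto
            have "dist z x \<le> 1 / 2 * s k" using z(2) \<theta>s by simp
            hence "s k \<le> dist z y" "dist z y \<le> 5 * s k"
              using d s[of k] dist_triangle[of z y x] dist_triangle[of x y z] by (auto simp: dist_commute)
            thus ?thesis using y by (auto simp: P'_def b_def)
          qed simp
        qed
        hence "measure \<nu> (b k) \<le> measure \<nu> (P' k z \<union> b (Suc k))"
          using bm Pm by (intro mono\<nu>) (auto simp: P'_def)
        also have "\<dots> \<le> measure \<nu> (P' k z) + measure \<nu> (b (Suc k))"
          using fin\<nu>[of "P' k z"] fin\<nu>[OF bm(2), of "Suc k"] Pm bm
          by (intro measure_Un_le) (auto simp: sets_lf[OF \<nu>])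
        finally have "measure \<nu> (b k) powr q \<le> (measure \<nu> (P' k z) + measure \<nu> (b (Suc k))) powr q"
          using q by (intro powr_mono2) auto
        also have "\<dots> \<le> measure \<nu> (P' k z) powr q + measure \<nu> (b (Suc k)) powr q" by (intro powr_add_le q) auto
        finally have "ennreal (measure \<nu> (b k) powr q) \<le> ennreal (measure \<nu> (P' k z) powr q) + ennreal (measure \<nu> (b (Suc k)) powr q)"
          by (simp add: ennreal_leI ennreal_plus[symmetric] del: ennreal_plus)
        moreover have "ennreal (measure \<nu> (P' k z) powr q) = ennreal (measure \<nu> (P' k z) powr q) * indicator (P k z) x"
          using z x by (simp add: P_def)
        moreover have "\<dots> \<le> G k x" unfolding G_def by (rule member_le_sum) (use z F(1) in auto)
        ultimately show ?thesis by (metis add_right_mono order_trans)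
      qed
      have sum: "ennreal (measure \<nu> Q powr q) \<le> (\<Sum>k<m. G k x) + ennreal (measure \<nu> (b m) powr q)" for m
      proof (induction m)
        case 0
        have "b 0 = Q" using diam[OF x] by (auto simp: b_def)
        thus ?case by simp
      next
        case (Suc m)
        have "(\<Sum>k<m. G k x) + ennreal (measure \<nu> (b m) powr q) \<le> (\<Sum>k<m. G k x) + (G m x + ennreal (measure \<nu> (b (Suc m)) powr q))"
          by (intro add_left_mono step)
        from order_trans[OF Suc this] show ?case by (simp only: sum.lessThan_Suc add.assoc)
      qed
      have "(\<lambda>m. measure \<nu> (b m)) \<longlonglongrightarrow> measure \<nu> (\<Inter>m. b m)"
      proof (rule Lim_measure_decseq)
        show "range b \<subseteq> sets \<nu>" using bm by (auto simp: sets_lf[OF \<nu>])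
        show "decseq b" unfolding decseq_def
        proof (intro allI impI)
          fix i j :: nat assume "i \<le> j"
          hence "D / 2 ^ j \<le> D / 2 ^ i" using D by (intro divide_left_mono power_increasing) auto
          thus "b j \<subseteq> b i" by (auto simp: b_def)
        qed
        show "emeasure \<nu> (b i) \<noteq> \<infinity>" for i using fin\<nu>[OF bm(2)] by (simp add: less_top)
      qed
      moreover have "(\<Inter>m. b m) = {x}"
      proof -
        have "y = x" if y: "\<And>m. y \<in> b m" for y
        proof (rule ccontr)
          assume "y \<noteq> x"
          hence d: "0 < dist x y" by simp
          obtain m where "D / dist x y < 2 ^ m" using real_arch_pow[of 2 "D / dist x y"] by auto
          hence "D / 2 ^ m < dist x y" using d by (simp add: field_simps)
          thus False using y[of m] by (simp add: b_def)
        qed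
        thus ?thesis using x D by (auto simp: b_def)
      qed
      ultimately have "(\<lambda>m. measure \<nu> (b m)) \<longlonglongrightarrow> 0" using x0 by simp
      hence "(\<lambda>m. measure \<nu> (b m) powr q) \<longlonglongrightarrow> 0"
        using q by (intro tendsto_zero_powrI[where b=q]) auto
      hence lim: "(\<lambda>m. (\<Sum>k. G k x) + ennreal (measure \<nu> (b m) powr q)) \<longlonglongrightarrow> (\<Sum>k. G k x) + ennreal 0"
        by (intro tendsto_add tendsto_const tendsto_ennrealI)
      have up: "ennreal (measure \<nu> Q powr q) \<le> (\<Sum>k. G k x) + ennreal (measure \<nu> (b m) powr q)" for m
        by (rule order_trans[OF sum add_right_mono[OF sum_le_suminf]]) (auto simp: summableI)
      have "ennreal (measure \<nu> Q powr q) \<le> (\<Sum>k. G k x) + ennreal 0"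
        by (rule LIMSEQ_le_const[OF lim]) (intro exI allI impI up)
      thus ?thesis by simp
    qed
    \<comment> \<open>The pointwise bound is available off the atoms of \<nu>. These are countably
      many, and each is \<mu>-null because there are no common point masses.\<close>
    have "(\<Union>x\<in>{x \<in> Q. measure \<nu> {x} \<noteq> 0}. {x}) \<in> null_sets \<mu>"
    proof (intro null_sets_UN' countable_atoms[OF \<nu> Qc])
      fix x assume "x \<in> {x \<in> Q. measure \<nu> {x} \<noteq> 0}"
      hence "emeasure \<nu> {x} \<noteq> 0" by (auto simp: measure_def)
      thus "{x} \<in> null_sets \<mu>" using at[of x] by (auto simp: null_sets_def sets_lf[OF \<mu>])
    qed
    hence "AE x in \<mu>. x \<notin> (\<Union>x\<in>{x \<in> Q. measure \<nu> {x} \<noteq> 0}. {x})" by (rule AE_not_in)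
    hence "(\<integral>\<^sup>+x. ennreal (measure \<nu> Q powr q) * indicator Q x \<partial>\<mu>) \<le> (\<integral>\<^sup>+x. (\<Sum>k. G k x) \<partial>\<mu>)"
      by (intro nn_integral_mono_AE, elim eventually_mono) (auto split: split_indicator intro: point)
    also have "\<dots> = (\<Sum>k. \<integral>\<^sup>+x. G k x \<partial>\<mu>)" by (intro nn_integral_suminf) (simp add: measurable_lf[OF \<mu>])
    also have "\<dots> \<le> (\<Sum>k. ennreal (A * l powr \<alpha> * r ^ k))"
    proof (intro suminf_le summableI)
      fix k
      have "(\<integral>\<^sup>+x. G k x \<partial>\<mu>) = (\<Sum>z\<in>F k. ennreal (measure \<nu> (P' k z) powr q) * emeasure \<mu> (P k z))"
        unfolding G_def using Pm by (subst nn_integral_sum) (auto simp: measurable_lf[OF \<mu>] sets_lf[OF \<mu>] nn_integral_cmult_indicator)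
      also have "\<dots> \<le> (\<Sum>z\<in>F k. ennreal (C * s k powr \<alpha>))"
      proof (rule sum_mono)
        fix z
        have "emeasure \<mu> (P k z) = ennreal (measure \<mu> (P k z))" by (rule fin\<mu>) (auto simp: P_def)
        thus "ennreal (measure \<nu> (P' k z) powr q) * emeasure \<mu> (P k z) \<le> ennreal (C * s k powr \<alpha>)"
          using PP'[of k z] by (simp add: ennreal_mult[symmetric] mult.commute ennreal_leI)
      qed
      also have "\<dots> = ennreal (real (card (F k)) * (C * s k powr \<alpha>))"
        using C0 by (simp add: ennreal_mult ennreal_of_nat_eq_real_of_nat)
      also have "\<dots> \<le> ennreal ((21 / \<theta>) ^ CARD('n) * (2 ^ k) ^ CARD('n) * (C * s k powr \<alpha>))"
        using C0 by (intro ennreal_leI mult_right_mono card) auto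
      also have "(21 / \<theta>) ^ CARD('n) * (2 ^ k) ^ CARD('n) * (C * s k powr \<alpha>) = A * l powr \<alpha> * r ^ k"
      proof -
        have 1: "(2 ^ k) ^ CARD('n) = 2 powr (real k * n)" by (simp add: n_def powr_realpow[symmetric] powr_powr mult.commute flip: power_mult)
        have sk: "s k = n / 4 * l * 2 powr (- real k)" by (simp add: s_def D_def powr_minus powr_realpow field_simps)
        have 2: "s k powr \<alpha> = (n / 4) powr \<alpha> * l powr \<alpha> * 2 powr (- real k * \<alpha>)"
          unfolding sk by (simp only: powr_mult powr_powr)
        have 3: "r ^ k = 2 powr (real k * n) * 2 powr (- real k * \<alpha>)"
          by (simp add: r_def powr_realpow[symmetric] powr_powr powr_add[symmetric] algebra_simps)
        show ?thesis unfolding 1 2 3 A_def by (simp only: mult_ac)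
      qed
      finally show "(\<integral>\<^sup>+x. G k x \<partial>\<mu>) \<le> ennreal (A * l powr \<alpha> * r ^ k)" .
    qed
    also have "\<dots> = ennreal (\<Sum>k. A * l powr \<alpha> * r ^ k)"
      using r A0 by (intro suminf_ennreal2 summable_mult summable_geometric) auto
    also have "(\<Sum>k. A * l powr \<alpha> * r ^ k) = A / (1 - r) * l powr \<alpha>"
      using r by (subst suminf_mult) (auto simp: suminf_geometric summable_geometric)
    also have "(\<integral>\<^sup>+x. ennreal (measure \<nu> Q powr q) * indicator Q x \<partial>\<mu>) = ennreal (measure \<mu> Q * measure \<nu> Q powr q)"
      using fin\<mu>[OF order_refl] Qb
      by (subst nn_integral_cmult_indicator) (auto simp: sets_lf[OF \<mu>] ennreal_mult[symmetric] mult.commute)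
    finally show "measure \<mu> (cbox a (\<chi> i. a $ i + l)) * measure \<nu> (cbox a (\<chi> i. a $ i + l)) powr q \<le> A / (1 - r) * l powr \<alpha>"
      unfolding Q_def[symmetric] using A0 r by (subst (asm) ennreal_le_iff) auto
  qed
qed

text \<open>For p \<le> 2 the exponent p - 1 is at most 1 and the bound is summed directly. For p >
  2 the exchanged bound has exponent 1 / (p - 1) < 1 and the power n p / (p - 1), still above
  n.\<close>

lemma separated_imp_Ap:
  fixes \<sigma> \<omega> :: "(real ^ 'n) measure"
  assumes \<sigma>: "locally_finite_borel \<sigma>" and \<omega>: "locally_finite_borel \<omega>" and p: "1 < p" "1 / p + 1 / p' = 1"
    and at: "\<And>x. emeasure \<sigma> {x} * emeasure \<omega> {x} = 0"
    and \<theta>: "0 < \<theta>" "\<theta> \<le> 1 / 2" and sep: "separated_bound \<omega> \<sigma> (p - 1) (real CARD('n) * p) \<theta> 12 C"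
  shows "\<exists>C. two_weight_Ap p p' \<sigma> \<omega> C"
proof -
  have lp: "l powr (real CARD('n) * p) = (l ^ CARD('n)) powr p" if "0 < l" for l
    using that by (simp add: powr_powr flip: powr_realpow)
  have np: "real CARD('n) < real CARD('n) * p" using p by simp
  consider "p - 1 \<le> 1" | "1 < p - 1" by linarith
  thus ?thesis
  proof cases
    case 1
    have "separated_bound \<omega> \<sigma> (p - 1) (real CARD('n) * p) \<theta> 5 C"
      unfolding separated_bound_def
    proof (intro conjI allI impI; (elim conjE)?)
      show "0 \<le> C" using sep by (simp add: separated_bound_def)
      fix x :: "real ^ 'n" and s P P'
      assume *: "0 < s" "P \<in> sets borel" "P' \<in> sets borel" "P \<subseteq> cball x (\<theta> * s)"
        and P': "P' \<subseteq> {y. s \<le> dist x y \<and> dist x y \<le> 5 * s}"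
      have "{y. s \<le> dist x y \<and> dist x y \<le> 5 * s} \<subseteq> {y. s \<le> dist x y \<and> dist x y \<le> 12 * s}" using *(1) by auto
      hence "P' \<subseteq> {y. s \<le> dist x y \<and> dist x y \<le> 12 * s}" using P' by blast
      thus "measure \<omega> P * measure \<sigma> P' powr (p - 1) \<le> C * s powr (real CARD('n) * p)"
        by (rule separated_boundD[OF sep *])
    qed
    from separated_imp_product_bound[OF \<omega> \<sigma> at _ 1 np \<theta> this] p
    show ?thesis unfolding two_weight_Ap_iff[OF p] by (auto simp: lp)
  next
    case 2
    obtain C' where sep': "separated_bound \<sigma> \<omega> (1 / (p - 1)) (real CARD('n) * p / (p - 1)) \<theta> 5 C'"
      using separated_bound_swap[OF \<omega> _ \<theta> _ sep] p by auto
    have "real CARD('n) * 1 < real CARD('n) * (p / (p - 1))" using 2 by (intro mult_strict_left_mono) auto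
    hence n: "real CARD('n) < real CARD('n) * p / (p - 1)" by simp
    have at': "emeasure \<omega> {x} * emeasure \<sigma> {x} = 0" for x using at[of x] by (simp add: mult.commute)
    obtain A where A: "0 \<le> A" "\<And>a l. 0 < l \<Longrightarrow> measure \<sigma> (cbox a (\<chi> i. a $ i + l)) * measure \<omega> (cbox a (\<chi> i. a $ i + l)) powr (1 / (p - 1))
        \<le> A * l powr (real CARD('n) * p / (p - 1))"
      using separated_imp_product_bound[OF \<sigma> \<omega> at' _ _ n \<theta> sep'] 2 by auto
    show ?thesis unfolding two_weight_Ap_iff[OF p]
    proof (intro exI[of _ "A powr (p - 1)"] conjI allI impI)
      fix a :: "real ^ 'n" and l :: real assume l: "0 < l"
      let ?Q = "cbox a (\<chi> i. a $ i + l)"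
      have "(measure \<sigma> ?Q * measure \<omega> ?Q powr (1 / (p - 1))) powr (p - 1) \<le> (A * l powr (real CARD('n) * p / (p - 1))) powr (p - 1)"
        using p by (intro powr_mono2 A l) auto
      thus "measure \<omega> ?Q * measure \<sigma> ?Q powr (p - 1) \<le> A powr (p - 1) * (l ^ CARD('n)) powr p"
        using 2 lp[OF l] by (simp add: powr_mult powr_powr mult.commute)
    qed simp
  qed
qed

subsection \<open>The characterizations\<close>

lemma finite_uniform_constant:
  fixes P :: "'a \<Rightarrow> real \<Rightarrow> bool"
  assumes "finite I" "\<And>i. i \<in> I \<Longrightarrow> \<exists>C. P i C" and mono: "\<And>i C C'. P i C \<Longrightarrow> C \<le> C' \<Longrightarrow> P i C'"
  shows "\<exists>C. \<forall>i\<in>I. P i C"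
  using assms(1,2)
proof (induction I rule: finite_induct)
  case (insert i I)
  then obtain C C' where "\<forall>i\<in>I. P i C" "P i C'" by blast
  thus ?case using mono by (intro exI[of _ "max C C'"]) (metis insert_iff max.cobounded1 max.cobounded2)
qed simp

lemma weak_type_mono:
  assumes "weak_type p \<sigma> \<omega> S C" "C \<le> C'"
  shows "weak_type p \<sigma> \<omega> S C'"
  unfolding weak_type_def
proof
  fix f assume "f \<in> Lp_fun p \<sigma>"
  hence "weak_Lp_norm p \<omega> (S f) \<le> ennreal (C * Lp_norm p \<sigma> f)" using assms(1) by (simp add: weak_type_def)
  also have "\<dots> \<le> ennreal (C' * Lp_norm p \<sigma> f)"
    using assms(2) by (intro ennreal_leI mult_right_mono) (auto simp: Lp_norm_def)
  finally show "weak_Lp_norm p \<omega> (S f) \<le> ennreal (C' * Lp_norm p \<sigma> f)" .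
qed

lemma weak_type_iff_testing:
  fixes \<sigma> \<omega> :: "(real ^ 'n) measure"
  assumes \<sigma>: "locally_finite_borel \<sigma>" and \<omega>: "locally_finite_borel \<omega>" and p: "1 < p" "1 / p + 1 / p' = 1"
    and \<Phi>: "truncation_family B \<Phi>" and K: "size_smooth_kernel K"
  shows "(\<exists>C. weak_type p \<sigma> \<omega> (trunc_max \<Phi> K \<sigma>) C) \<Longrightarrow> (\<exists>C. testing_condition p p' \<sigma> \<omega> (trunc_max \<Phi> K \<sigma>) C)"
    and "\<exists>C. weak_type p \<sigma> \<omega> (maximal_op \<sigma>) C \<Longrightarrow>
      (\<exists>C. testing_condition p p' \<sigma> \<omega> (trunc_max \<Phi> K \<sigma>) C) \<Longrightarrow> (\<exists>C. weak_type p \<sigma> \<omega> (trunc_max \<Phi> K \<sigma>) C)"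
proof -
  obtain C d where Cd: "dini_kernel C d K" by (rule size_smooth_dini_kernel[OF K])
  interpret two_weight \<sigma> K C d \<Phi> B \<omega> p p'
    by unfold_locales (use \<sigma> \<omega> \<Phi> p Cd in auto)
  have p0: "0 < p" using p by simp
  show "(\<exists>C. weak_type p \<sigma> \<omega> T C) \<Longrightarrow> (\<exists>C. testing_condition p p' \<sigma> \<omega> T C)"
    unfolding weak_type_iff_weak_bound[OF p0] using T_weak_bound_imp_testing by blast
  show "\<exists>C. weak_type p \<sigma> \<omega> M C \<Longrightarrow> (\<exists>C. testing_condition p p' \<sigma> \<omega> T C) \<Longrightarrow> (\<exists>C. weak_type p \<sigma> \<omega> T C)"
    unfolding weak_type_iff_weak_bound[OF p0] using testing_imp_weak_bound by blast
qed

lemma sio_weak_type_of_trunc_max: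
  fixes \<sigma> \<omega> :: "(real ^ 'n) measure"
  assumes \<sigma>: "locally_finite_borel \<sigma>" and \<omega>: "locally_finite_borel \<omega>" and p: "1 < p" "1 / p + 1 / p' = 1"
    and \<Phi>: "truncation_family B \<Phi>"
    and ac: "absolutely_continuous lborel \<sigma>" "absolutely_continuous lborel \<omega>"
    and M: "\<exists>C. weak_type p \<sigma> \<omega> (maximal_op \<sigma>) C" and S: "standard_sio K S"
    and T: "\<exists>C. weak_type p \<sigma> \<omega> (trunc_max \<Phi> K \<sigma>) C"
  shows "\<exists>C. \<forall>f\<in>Lp_fun p \<sigma>. ess_bounded (density_fun \<sigma> f) \<and> compact (ess_support (density_fun \<sigma> f)) \<longrightarrow>
    weak_Lp_norm p \<omega> (\<lambda>x. ennreal (norm (S (density_fun \<sigma> f) x))) \<le> ennreal (C * Lp_norm p \<sigma> f)"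
proof -
  have K: "size_smooth_kernel K" using S by (simp add: standard_sio_def standard_kernel_def)
  obtain C d where Cd: "dini_kernel C d K" by (rule size_smooth_dini_kernel[OF K])
  interpret two_weight \<sigma> K C d \<Phi> B \<omega> p p'
    by unfold_locales (use \<sigma> \<omega> \<Phi> p Cd in auto)
  have p0: "0 < p" using p by simp
  obtain D\<^sub>1 D\<^sub>2 where "weak_bound p \<sigma> \<omega> T D\<^sub>1" "weak_bound p \<sigma> \<omega> M D\<^sub>2"
    using T M unfolding weak_type_iff_weak_bound[OF p0] by blast
  thus ?thesis by (rule sio_weak_type[OF ac S])
qed

lemma weak_type_family_iff:
  fixes \<sigma> \<omega> :: "(real ^ 'n) measure" and p p' :: real and K :: "nat \<Rightarrow> real ^ 'n \<Rightarrow> real ^ 'n \<Rightarrow> complex"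
  assumes \<sigma>: "locally_finite_borel \<sigma>" and \<omega>: "locally_finite_borel \<omega>" and p: "1 < p" "1 / p + 1 / p' = 1"
    and \<Phi>: "truncation_family B \<Phi>" and K: "\<And>j. j \<in> {1..J} \<Longrightarrow> size_smooth_kernel (K j)" and c: "0 < c"
    and dir: "\<And>u::real ^ 'n. norm u = 1 \<Longrightarrow> \<exists>j\<in>{1..J}. \<forall>t x. t \<noteq> 0 \<longrightarrow> norm (K j x (x + t *\<^sub>R u)) \<ge> c / \<bar>t\<bar> ^ CARD('n)"
    and at: "\<And>x. emeasure \<sigma> {x} * emeasure \<omega> {x} = 0"
  shows "(\<exists>C. \<forall>j\<in>{1..J}. weak_type p \<sigma> \<omega> (trunc_max \<Phi> (K j) \<sigma>) C) \<longleftrightarrow>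
    (\<exists>C. two_weight_Ap p p' \<sigma> \<omega> C) \<and> (\<exists>C. \<forall>j\<in>{1..J}. testing_condition p p' \<sigma> \<omega> (trunc_max \<Phi> (K j) \<sigma>) C)"
    (is "?W \<longleftrightarrow> ?A \<and> ?T")
proof (intro iffI conjI)
  have p0: "0 < p" using p by simp
  have dini: "\<exists>C d. dini_kernel C d (K j)" if "j \<in> {1..J}" for j
    by (rule size_smooth_dini_kernel[OF K[OF that]]) blast
  {
    assume W: ?W
    have "\<exists>D. weak_bound p \<sigma> \<omega> (trunc_max \<Phi> (K j) \<sigma>) D" if "j \<in> {1..J}" for j
      using W that unfolding weak_type_iff_weak_bound[OF p0, symmetric] by blast
    \<comment> \<open>The ratio 12 is what an exchange of the measures requires.\<close>
    from kernels_separated[where b=12, OF \<sigma> \<omega> p \<Phi> dini this c _ dir]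
    obtain \<theta> C where "0 < \<theta>" "\<theta> \<le> 1 / 2" "separated_bound \<omega> \<sigma> (p - 1) (real CARD('n) * p) \<theta> 12 C" by auto
    thus ?A by (rule separated_imp_Ap[OF \<sigma> \<omega> p at])
    show ?T
      by (rule finite_uniform_constant)
        (use W weak_type_iff_testing(1)[OF \<sigma> \<omega> p \<Phi> K] testing_condition_mono in blast)+
  next
    assume AT: "?A \<and> ?T"
    then obtain A where A: "0 \<le> A" "\<And>a l. 0 < l \<Longrightarrow> measure \<omega> (cbox a (\<chi> i. a $ i + l)) * measure \<sigma> (cbox a (\<chi> i. a $ i + l)) powr (p - 1)
       \<le> A * (l ^ CARD('n)) powr p"
      unfolding two_weight_Ap_iff[OF p] by blast
    show ?W
    proof (rule finite_uniform_constant)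
      fix j assume j: "j \<in> {1..J}"
      note test = weak_type_iff_testing(2)[OF \<sigma> \<omega> p \<Phi> K[OF j]]
      obtain C d where Cd: "dini_kernel C d (K j)" using dini[OF j] by blast
      interpret two_weight \<sigma> "K j" C d \<Phi> B \<omega> p p'
        by unfold_locales (use \<sigma> \<omega> \<Phi> p Cd in auto)
      \<comment> \<open>Here the weak type inequality for the maximal operator is a consequence of
        the two weight condition, which brings the situation back to the single kernel case.\<close>
      have "\<exists>C. weak_type p \<sigma> \<omega> (maximal_op \<sigma>) C"
        unfolding weak_type_iff_weak_bound[OF p0] by (rule Ap_imp_maximal_weak_bound[OF A])
      moreover have "\<exists>C. testing_condition p p' \<sigma> \<omega> (trunc_max \<Phi> (K j) \<sigma>) C" using AT j by blast
      ultimately show "\<exists>C. weak_type p \<sigma> \<omega> (trunc_max \<Phi> (K j) \<sigma>) C"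
        by (rule test)
    qed (auto intro: weak_type_mono)
  }
qed

theorem mainTheorem3:
  fixes \<sigma> \<omega> :: "(real ^ 'n) measure"
    and p p' :: real
    and \<zeta> \<eta> :: "real \<Rightarrow> real"
  assumes "locally_finite_borel \<sigma>" and "locally_finite_borel \<omega>"
    and "1 < p" and "1 / p + 1 / p' = 1"
    and "truncation_pair \<zeta> \<eta>"
  shows
    "(\<forall>K. size_smooth_kernel K \<and> (\<exists>C. weak_type p \<sigma> \<omega> (maximal_op \<sigma>) C) \<longrightarrow>
        ((\<exists>C. weak_type p \<sigma> \<omega> (T_strong \<zeta> \<eta> K \<sigma>) C) \<longleftrightarrow>
         (\<exists>C\<^sub>2. testing_condition p p' \<sigma> \<omega> (T_strong \<zeta> \<eta> K \<sigma>) C\<^sub>2)))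
     \<and>
     (\<forall>K. size_smooth_kernel K \<and> (\<exists>C. weak_type p \<sigma> \<omega> (maximal_op \<sigma>) C) \<longrightarrow>
        ((\<exists>C. weak_type p \<sigma> \<omega> (T_flat \<zeta> \<eta> K \<sigma>) C) \<longleftrightarrow>
         (\<exists>C\<^sub>2. testing_condition p p' \<sigma> \<omega> (T_flat \<zeta> \<eta> K \<sigma>) C\<^sub>2)))
     \<and>
     (\<forall>K T. absolutely_continuous lborel \<sigma> \<and> absolutely_continuous lborel \<omega> \<and>
        (\<exists>C. weak_type p \<sigma> \<omega> (maximal_op \<sigma>) C) \<and>
        standard_sio K T \<and>
        ((\<exists>C. weak_type p \<sigma> \<omega> (T_strong \<zeta> \<eta> K \<sigma>) C) \<or>
         (\<exists>C. weak_type p \<sigma> \<omega> (T_flat \<zeta> \<eta> K \<sigma>) C)) \<longrightarrow>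
        (\<exists>C. \<forall>f\<in>Lp_fun p \<sigma>.
           ess_bounded (density_fun \<sigma> f) \<and> compact (ess_support (density_fun \<sigma> f)) \<longrightarrow>
           weak_Lp_norm p \<omega> (\<lambda>x. ennreal (norm (T (density_fun \<sigma> f) x)))
             \<le> ennreal (C * Lp_norm p \<sigma> f)))
     \<and>
     (\<forall>(c::real) (J::nat) K.
        0 < c \<and>
        (\<forall>j\<in>{1..J}. standard_kernel (K j)) \<and>
        (\<forall>u::real ^ 'n. norm u = 1 \<longrightarrow> (\<exists>j\<in>{1..J}. \<forall>t x. t \<noteq> 0 \<longrightarrow>
           norm (K j x (x + t *\<^sub>R u)) \<ge> c / \<bar>t\<bar> ^ CARD('n))) \<and>
        (\<forall>x. emeasure \<sigma> {x} * emeasure \<omega> {x} = 0) \<longrightarrow>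
        ((\<exists>C. \<forall>j\<in>{1..J}. weak_type p \<sigma> \<omega> (T_flat \<zeta> \<eta> (K j) \<sigma>) C) \<longleftrightarrow>
         (\<exists>C\<^sub>2. two_weight_Ap p p' \<sigma> \<omega> C\<^sub>2) \<and>
         (\<exists>C\<^sub>2. \<forall>j\<in>{1..J}. testing_condition p p' \<sigma> \<omega> (T_flat \<zeta> \<eta> (K j) \<sigma>) C\<^sub>2)))"
proof -
  note \<sigma> = assms(1) and \<omega> = assms(2) and p = assms(3,4)
  obtain B\<^sub>1 where flat: "truncation_family B\<^sub>1 (flat_truncations \<zeta> \<eta> :: (real ^ 'n \<Rightarrow> real) set)"
    using truncation_family_flat[OF assms(5)] by blast
  obtain B\<^sub>2 where strong: "truncation_family B\<^sub>2 (strong_truncations \<zeta> \<eta> :: (real ^ 'n \<Rightarrow> real) set)"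
    using truncation_family_strong[OF assms(5)] by blast
  note iff_strong = weak_type_iff_testing[OF \<sigma> \<omega> p strong] and iff_flat = weak_type_iff_testing[OF \<sigma> \<omega> p flat]
  show ?thesis
    unfolding T_flat_eq_trunc_max T_strong_eq_trunc_max
  proof (intro conjI)
    show "\<forall>K. size_smooth_kernel K \<and> (\<exists>C. weak_type p \<sigma> \<omega> (maximal_op \<sigma>) C) \<longrightarrow>
        ((\<exists>C. weak_type p \<sigma> \<omega> (trunc_max (strong_truncations \<zeta> \<eta>) K \<sigma>) C) \<longleftrightarrow>
         (\<exists>C\<^sub>2. testing_condition p p' \<sigma> \<omega> (trunc_max (strong_truncations \<zeta> \<eta>) K \<sigma>) C\<^sub>2))"
      using iff_strong by blast
    show "\<forall>K. size_smooth_kernel K \<and> (\<exists>C. weak_type p \<sigma> \<omega> (maximal_op \<sigma>) C) \<longrightarrow>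
        ((\<exists>C. weak_type p \<sigma> \<omega> (trunc_max (flat_truncations \<zeta> \<eta>) K \<sigma>) C) \<longleftrightarrow>
         (\<exists>C\<^sub>2. testing_condition p p' \<sigma> \<omega> (trunc_max (flat_truncations \<zeta> \<eta>) K \<sigma>) C\<^sub>2))"
      using iff_flat by blast
    show "\<forall>K T. absolutely_continuous lborel \<sigma> \<and> absolutely_continuous lborel \<omega> \<and>
        (\<exists>C. weak_type p \<sigma> \<omega> (maximal_op \<sigma>) C) \<and> standard_sio K T \<and>
        ((\<exists>C. weak_type p \<sigma> \<omega> (trunc_max (strong_truncations \<zeta> \<eta>) K \<sigma>) C) \<or>
         (\<exists>C. weak_type p \<sigma> \<omega> (trunc_max (flat_truncations \<zeta> \<eta>) K \<sigma>) C)) \<longrightarrow>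
        (\<exists>C. \<forall>f\<in>Lp_fun p \<sigma>.
           ess_bounded (density_fun \<sigma> f) \<and> compact (ess_support (density_fun \<sigma> f)) \<longrightarrow>
           weak_Lp_norm p \<omega> (\<lambda>x. ennreal (norm (T (density_fun \<sigma> f) x))) \<le> ennreal (C * Lp_norm p \<sigma> f))"
      using sio_weak_type_of_trunc_max[OF \<sigma> \<omega> p strong] sio_weak_type_of_trunc_max[OF \<sigma> \<omega> p flat]
      by (intro allI impI, elim conjE disjE) simp_all
  qed (intro allI impI weak_type_family_iff[OF \<sigma> \<omega> p flat], auto simp: standard_kernel_def)
qed

end
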